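(* With the notation of the context, as formal power series in $\boldsymbol t=(t_1,t_2,\dots)$ and $\bar{\boldsymbol t}=(\bar t_1,\bar t_2,\dots)$, for every $s\in\mathbb{Z}$, $$Z'(s,\boldsymbol t,\bar{\boldsymbol t})=\exp\Big(\sum_{k\ge1}\frac{q^kt_k-\bar t_k}{1-q^k}\Big)\,\tau'\big(s,\iota(\boldsymbol t),-\bar{\boldsymbol t}\big),$$ where $\iota(\boldsymbol t)=(-t_1,t_2,-t_3,\dots,(-1)^kt_k,\dots)$ and $$\tau'(s,\boldsymbol t,\bar{\boldsymbol t})=\langle s|\exp\Big(\sum_{k\ge1}t_kJ_k\Big)\,g'\,\exp\Big(-\sum_{k\ge1}\bar t_kJ_{-k}\Big)|s\rangle,\qquad g'=q^{W_0/2}\Gamma_-(q^{-\rho})\Gamma_+(q^{-\rho})Q^{L_0}\Gamma'_-(q^{-\rho})\Gamma'_+(q^{-\rho})q^{-W_0/2}.$$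
   Context: Let $q,Q$ be complex numbers with $0<|q|<1$, $|Q|<1$ (or formal variables), with a fixed square root $q^{1/2}$. For a partition $\lambda=(\lambda_1,\lambda_2,\dots)$ let $|\lambda|=\sum_i\lambda_i$, let $\lambda^{T}$ be the conjugate partition, and let $s_\lambda(q^{-\rho})$ denote the Schur function $s_\lambda(x_1,x_2,\dots)$ evaluated at $x_i=q^{i-1/2}$, $i\ge1$. For $k\in\mathbb{Z}\setminus\{0\}$, $s\in\mathbb{Z}$, define $$\Phi_k(\lambda,s)=\sum_{i\ge1}\big(q^{k(\lambda_i+s-i+1)}-q^{k(s-i+1)}\big)+\frac{1-q^{ks}}{1-q^k}q^k,$$ and the deformed partition function (sum over all partitions) $$Z'(s,\boldsymbol t,\bar{\boldsymbol t})=\sum_{\lambda}s_\lambda(q^{-\rho})s_{\lambda^T}(q^{-\rho})\,Q^{|\lambda|+s(s+1)/2}\exp\Big(\sum_{k\ge1}t_k\Phi_k(\lambda,s)+\sum_{k\ge1}\bar t_k\Phi_{-k}(\lambda,s)\Big).$$ Fermions: $\psi_n,\psi^*_n$ ($n\in\mathbb{Z}$) with $\psi_m\psi^*_n+\psi^*_n\psi_m=\delta_{m+n,0}$ and all other anticommutators zero. The charge-$s$ vacua are the semi-infinite wedges $\langle s|=\langle-\infty|\cdots\psi^*_{s-1}\psi^*_s$, $|s\rangle=\psi_{-s}\psi_{-s+1}\cdots|-\infty\rangle$, normalized by $\langle s|s\rangle=1$; normal ordering is $:\psi_m\psi^*_n:=\psi_m\psi^*_n-\langle0|\psi_m\psi^*_n|0\rangle$.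 Define $L_0=\sum_n n:\psi_{-n}\psi^*_n:$, $W_0=\sum_nn^2:\psi_{-n}\psi^*_n:$, $J_k=\sum_n:\psi_{-n}\psi^*_{n+k}:$. Vertex operators: $\Gamma_{\pm}(z)=\exp\big(\sum_{k\ge1}\frac{z^k}{k}J_{\pm k}\big)$, $\Gamma'_{\pm}(z)=\exp\big(-\sum_{k\ge1}\frac{(-z)^k}{k}J_{\pm k}\big)$, $\Gamma_{\pm}(q^{-\rho})=\prod_{i\ge1}\Gamma_{\pm}(q^{i-1/2})$, $\Gamma'_{\pm}(q^{-\rho})=\prod_{i\ge1}\Gamma'_{\pm}(q^{i-1/2})$. *)

theory Defs
  imports "HOL-Analysis.Analysis"
begin

text \<open>A monomial t^alpha is encoded by an exponent function alpha :: nat => nat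
  (alpha k = exponent of t_k); valid monomials have finite support and alpha 0 = 0
  (variables are indexed by k >= 1). A formal power series in t, tbar is given by its
  coefficient function F alpha beta (coefficient of t^alpha tbar^beta).\<close>

type_synonym fps2 = "(nat \<Rightarrow> nat) \<Rightarrow> (nat \<Rightarrow> nat) \<Rightarrow> complex"

definition monom :: "(nat \<Rightarrow> nat) \<Rightarrow> bool" where
  "monom \<alpha> \<longleftrightarrow> finite {k. \<alpha> k \<noteq> 0} \<and> \<alpha> 0 = 0"

definition mdeg :: "(nat \<Rightarrow> nat) \<Rightarrow> nat" where
  "mdeg \<alpha> = sum \<alpha> {k. \<alpha> k \<noteq> 0}"

definition below :: "(nat \<Rightarrow> nat) \<Rightarrow> (nat \<Rightarrow> nat) set" where
  "below \<alpha> = {\<gamma>. \<forall>k. \<gamma> k \<le> \<alpha> k}"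

definition fps_mult :: "fps2 \<Rightarrow> fps2 \<Rightarrow> fps2" where
  "fps_mult F G = (\<lambda>\<alpha> \<beta>. \<Sum>\<gamma>\<in>below \<alpha>. \<Sum>\<delta>\<in>below \<beta>.
      F \<gamma> \<delta> * G (\<lambda>k. \<alpha> k - \<gamma> k) (\<lambda>k. \<beta> k - \<delta> k))"

definition fps_one :: fps2 where
  "fps_one = (\<lambda>\<alpha> \<beta>. if (\<forall>k. \<alpha> k = 0) \<and> (\<forall>k. \<beta> k = 0) then 1 else 0)"

primrec fps_pow :: "fps2 \<Rightarrow> nat \<Rightarrow> fps2" where
  "fps_pow F 0 = fps_one"
| "fps_pow F (Suc n) = fps_mult F (fps_pow F n)"

text \<open>Exponential of a series with zero constant term: exp F = sum_n F^n / n!;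
  the coefficient of t^alpha tbar^beta only receives contributions from n <= deg.\<close>
definition fps_exp :: "fps2 \<Rightarrow> fps2" where
  "fps_exp F = (\<lambda>\<alpha> \<beta>. \<Sum>n\<le>mdeg \<alpha> + mdeg \<beta>. fps_pow F n \<alpha> \<beta> / fact n)"

definition linfps :: "(nat \<Rightarrow> complex) \<Rightarrow> (nat \<Rightarrow> complex) \<Rightarrow> fps2" where
  "linfps a b = (\<lambda>\<alpha> \<beta>.
      (\<Sum>k\<in>{k. 1 \<le> k \<and> \<alpha> = (\<lambda>i. if i = k then 1 else 0) \<and> (\<forall>i. \<beta> i = 0)}. a k)
    + (\<Sum>k\<in>{k. 1 \<le> k \<and> (\<forall>i. \<alpha> i = 0) \<and> \<beta> = (\<lambda>i. if i = k then 1 else 0)}. b k))"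

definition fps_scale :: "(nat \<Rightarrow> complex) \<Rightarrow> (nat \<Rightarrow> complex) \<Rightarrow> fps2 \<Rightarrow> fps2" where
  "fps_scale c d F = (\<lambda>\<alpha> \<beta>. (\<Prod>k\<in>{k. \<alpha> k \<noteq> 0}. c k ^ \<alpha> k) *
      (\<Prod>k\<in>{k. \<beta> k \<noteq> 0}. d k ^ \<beta> k) * F \<alpha> \<beta>)"

text \<open>A partition lambda is encoded as lam :: nat => nat with lam i = lambda_{i+1}.\<close>

definition partitions :: "(nat \<Rightarrow> nat) set" where
  "partitions = {lam. (\<forall>i. lam (Suc i) \<le> lam i) \<and> finite {i. lam i \<noteq> 0}}"

definition psize :: "(nat \<Rightarrow> nat) \<Rightarrow> nat" where
  "psize lam = sum lam {i. lam i \<noteq> 0}"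

definition pconj :: "(nat \<Rightarrow> nat) \<Rightarrow> (nat \<Rightarrow> nat)" where
  "pconj lam = (\<lambda>j. card {i. j < lam i})"

definition cells :: "(nat \<Rightarrow> nat) \<Rightarrow> (nat \<times> nat) set" where
  "cells lam = {(i, j). j < lam i}"

definition ssyt :: "(nat \<Rightarrow> nat) \<Rightarrow> (nat \<Rightarrow> nat \<Rightarrow> nat) set" where
  "ssyt lam = {T. (\<forall>i j. j < lam i \<longrightarrow> 1 \<le> T i j)
                \<and> (\<forall>i j. \<not> j < lam i \<longrightarrow> T i j = 0)
                \<and> (\<forall>i j. Suc j < lam i \<longrightarrow> T i j \<le> T i (Suc j))
                \<and> (\<forall>i j. j < lam (Suc i) \<longrightarrow> T i j < T (Suc i) j)}"

text \<open>s_lambda(q^{-rho}) = sum over SSYT T of prod_cells x_{T(c)}, x_m = q^{m-1/2} = r^{2m-1},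
  where r is the fixed square root of q.\<close>
definition schur_rho :: "complex \<Rightarrow> (nat \<Rightarrow> nat) \<Rightarrow> complex" where
  "schur_rho r lam = infsum (\<lambda>T. \<Prod>c\<in>cells lam. r ^ (2 * T (fst c) (snd c) - 1)) (ssyt lam)"

definition Phi :: "complex \<Rightarrow> int \<Rightarrow> (nat \<Rightarrow> nat) \<Rightarrow> int \<Rightarrow> complex" where
  "Phi q k lam s =
     (\<Sum>j\<in>{j. lam j \<noteq> 0}. q powi (k * (int (lam j) + s - int j)) - q powi (k * (s - int j)))
     + (1 - q powi (k * s)) / (1 - q powi k) * q powi k"

definition Zprime :: "complex \<Rightarrow> complex \<Rightarrow> complex \<Rightarrow> int \<Rightarrow> fps2" where
  "Zprime q Q r s = (\<lambda>\<alpha> \<beta>. infsum (\<lambda>lam.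
      schur_rho r lam * schur_rho r (pconj lam) * Q powi (int (psize lam) + s * (s + 1) div 2)
      * fps_exp (linfps (\<lambda>k. Phi q (int k) lam s) (\<lambda>k. Phi q (- int k) lam s)) \<alpha> \<beta>)
    partitions)"

text \<open>Basis states are Maya diagrams S (set of occupied psi-indices): the state
  psi_{a_1} psi_{a_2} ... |-infinity> with S = {a_1 < a_2 < ...}; S is bounded below and
  contains all sufficiently large integers. The vacuum |s> is S = {-s..}.
  Operators are given by their matrix elements A T S = <T|A|S>.\<close>

definition maya :: "int set \<Rightarrow> bool" where
  "maya S \<longleftrightarrow> (\<exists>a. \<forall>j\<in>S. a \<le> j) \<and> (\<exists>b. \<forall>j\<ge>b. j \<in> S)"

definition Maya :: "int set set" where
  "Maya = {S. maya S}"

definition vac :: "int \<Rightarrow> int set" where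
  "vac s = {-s..}"

type_synonym op = "int set \<Rightarrow> int set \<Rightarrow> complex"

definition idop :: op where
  "idop = (\<lambda>T S. if T = S then 1 else 0)"

definition compose :: "op \<Rightarrow> op \<Rightarrow> op" where
  "compose A B = (\<lambda>T S. infsum (\<lambda>U. A T U * B U S) Maya)"

definition fsign :: "int set \<Rightarrow> int \<Rightarrow> complex" where
  "fsign S j = (-1) ^ card {i\<in>S. i < j}"

definition psi :: "int \<Rightarrow> op" where
  "psi m = (\<lambda>T S. if m \<notin> S \<and> T = insert m S then fsign S m else 0)"

definition psis :: "int \<Rightarrow> op" where
  "psis n = (\<lambda>T S. if - n \<in> S \<and> T = S - {- n} then fsign S (- n) else 0)"

definition nord :: "int \<Rightarrow> int \<Rightarrow> op" where
  "nord m n = (\<lambda>T S. compose (psi m) (psis n) T S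
      - (if T = S then compose (psi m) (psis n) (vac 0) (vac 0) else 0))"

definition Jop :: "int \<Rightarrow> op" where
  "Jop k = (\<lambda>T S. infsum (\<lambda>n. nord (- n) (n + k) T S) UNIV)"

definition L0 :: op where
  "L0 = (\<lambda>T S. infsum (\<lambda>n. of_int n * nord (- n) n T S) UNIV)"

definition W0 :: op where
  "W0 = (\<lambda>T S. infsum (\<lambda>n. of_int (n ^ 2) * nord (- n) n T S) UNIV)"

text \<open>For an operator A that is diagonal in the basis with integer eigenvalues,
  c^A acts on the eigenvector |S> by c^{eigenvalue}. Thus q^{W_0/2} = r^{W_0} for the
  fixed square root r of q, q^{-W_0/2} = (1/r)^{W_0}, and Q^{L_0}.\<close>
definition powdiag :: "complex \<Rightarrow> op \<Rightarrow> op" where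
  "powdiag c A = (\<lambda>T S. if T = S then c powi (THE w::int. A S S = of_int w) else 0)"

primrec op_pow :: "op \<Rightarrow> nat \<Rightarrow> op" where
  "op_pow A 0 = idop"
| "op_pow A (Suc n) = compose A (op_pow A n)"

definition op_exp :: "op \<Rightarrow> op" where
  "op_exp A = (\<lambda>T S. infsum (\<lambda>n. op_pow A n T S / fact n) UNIV)"

definition Jexp :: "(nat \<Rightarrow> complex) \<Rightarrow> int \<Rightarrow> op" where
  "Jexp f e = op_exp (\<lambda>T S. infsum (\<lambda>k. f k * Jop (e * int k) T S) {1..})"

definition Gam :: "int \<Rightarrow> complex \<Rightarrow> op" where
  "Gam e z = Jexp (\<lambda>k. z ^ k / of_nat k) e"

definition Gam' :: "int \<Rightarrow> complex \<Rightarrow> op" where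
  "Gam' e z = Jexp (\<lambda>k. - ((- z) ^ k) / of_nat k) e"

primrec prod_ops :: "(nat \<Rightarrow> op) \<Rightarrow> nat \<Rightarrow> op" where
  "prod_ops G 0 = idop"
| "prod_ops G (Suc N) = compose (prod_ops G N) (G (Suc N))"

text \<open>Infinite product prod_{i>=1} G(q^{i-1/2}) (q^{i-1/2} = r^{2i-1}), as the limit of the
  matrix elements of the finite products.\<close>
definition rho_prod :: "complex \<Rightarrow> (complex \<Rightarrow> op) \<Rightarrow> op" where
  "rho_prod r G = (\<lambda>T S. lim (\<lambda>N. prod_ops (\<lambda>i. G (r ^ (2 * i - 1))) N T S))"

definition gprime :: "complex \<Rightarrow> complex \<Rightarrow> op" where
  "gprime Q r =
     compose (powdiag r W0)
    (compose (rho_prod r (Gam (-1)))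
    (compose (rho_prod r (Gam 1))
    (compose (powdiag Q L0)
    (compose (rho_prod r (Gam' (-1)))
    (compose (rho_prod r (Gam' 1))
             (powdiag (inverse r) W0))))))"

text \<open>Coefficient of t^alpha in exp(sum_{k>=1} t_k A_k) = sum_n (sum_k t_k A_k)^n / n!
  (no commutativity used): sum over all words k_1...k_n with letter multiplicities alpha.\<close>
definition exp_coeff :: "(nat \<Rightarrow> op) \<Rightarrow> (nat \<Rightarrow> nat) \<Rightarrow> op" where
  "exp_coeff A \<alpha> = (\<lambda>T S.
     (\<Sum>ks\<in>{ks. length ks = mdeg \<alpha> \<and> (\<forall>k. count_list ks k = \<alpha> k)}.
         foldr compose (map A ks) idop T S) / fact (mdeg \<alpha>))"

definition tau' :: "complex \<Rightarrow> complex \<Rightarrow> int \<Rightarrow> fps2" where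
  "tau' Q r s = (\<lambda>\<alpha> \<beta>.
     compose (compose (exp_coeff (\<lambda>k. Jop (int k)) \<alpha>) (gprime Q r))
             (exp_coeff (\<lambda>k. \<lambda>T S. - Jop (- int k) T S) \<beta>) (vac s) (vac s))"

end

theory Submission
  imports Defs "HOL-Combinatorics.Multiset_Permutations"
begin

text \<open>The whole theorem rests on one intertwining relation for the Gram matrix
  \<open>G(t, v)\<close> of \<open>\<Gamma>\<^sub>-(q\<^sup>-\<^sup>\<rho>) \<Gamma>\<^sub>+(q\<^sup>-\<^sup>\<rho>)\<close>: conjugated by \<open>q\<close> to the power \<open>W\<^sub>0 / 2\<close>, the current \<open>(-1)\<^sup>k J\<^sub>k\<close> acts on
  \<open>G(\<cdot>, v)\<close> as a scalar, the eigenvalue of the diagonal operator \<open>\<Sum>\<^sub>n q\<^sup>k\<^sup>n \<psi>\<^sub>-\<^sub>n \<psi>\<^sup>*\<^sub>n\<close> at \<open>v\<close>, regularised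
  as minus the sum over holes. That eigenvalue is \<open>\<Phi>\<^sub>k - q\<^sup>k / (1 - q\<^sup>k)\<close>, which explains the exponential
  prefactor. Particle-hole duality turns the relation into its counterpart for \<open>\<Gamma>'\<close> and \<open>\<Phi>\<^sub>-\<^sub>k\<close>.
  Moving all currents through the two Gram matrices leaves a sum over states of
  \<open>G(vac, v) Q\<^sup>|\<^sup>v\<^sup>| G'(v, vac)\<close>, and these vacuum entries are the Schur functions of a partition and of its conjugate.

  The relation itself only uses that the commutator of \<open>J\<^sub>m\<close> with a bilinear \<open>\<Sum>\<^sub>x c\<^sup>-\<^sup>x \<psi>\<^sub>x\<^sub>+\<^sub>j \<psi>\<^sup>*\<^sub>x\<close> is a multiple
  of the bilinear with shift \<open>j + m\<close>. Commuting \<open>\<Gamma>\<^sub>+(q\<^sup>-\<^sup>\<rho>)\<close> past it therefore multiplies a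
  generating series, and at \<open>c = q\<^sup>k\<close> the quotient of infinite products involved telescopes to a polynomial of
  degree \<open>k\<close> whose coefficients are palindromic up to powers of \<open>q\<^sup>k\<close>.\<close>

section \<open>Fermions on Maya diagrams\<close>

text \<open>The only genuinely infinite summation is the one over the states \<open>v\<close> at the
  position of Q^L0. J_k with k > 0 lowers the energy, which is nonnegative, so the columns of
  Gamma_+ are finite and every sum inside either Gram matrix is finite; convergence in
  \<open>v\<close> is a square summability estimate with |Q| < 1. Negative currents are never moved
  separately: the matrix of J_-k is the transpose of that of J_k, so to the right of g' they act on
  the column index as J_k, in reversed order. The bilinears met on the way pass through shift 0,
  where the usual ordering would leave a scalar in the commutator. Putting the annihilator on the
  left and using geometric weights avoids this. Constant weights at total shift 0 are the exception:
  there the Heisenberg scalar appears, and it enters only the norm estimate. The palindromic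
  symmetry is what lets Gamma_- and Gamma_+ match: crossing Gamma_- produces c_i q^(k i), undoing
  Gamma_+ requires c_(k-i). They differ by (-1)^k r^(k^2), and conjugation by q^(W_0/2) removes the
  power of r.\<close>

typedef maya_state = Maya morphisms occ mk_maya_state
  unfolding Maya_def maya_def by (rule exI[of _ "{0..}"]) auto

text \<open>Operators are functions on arbitrary vectors; row-finiteness replaces convergence of matrix products.\<close>

type_synonym fock = "maya_state \<Rightarrow> complex"

lemma maya_occ [simp]: "maya (occ t)"
  using occ[of t] by (simp add: Maya_def)

lemma occ_mk_maya_state: "maya S \<Longrightarrow> occ (mk_maya_state S) = S"
  by (simp add: mk_maya_state_inverse Maya_def)

lemma maya_state_eqI: "occ s = occ t \<Longrightarrow> s = t"
  by (simp add: occ_inject)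

lemma bij_occ: "bij_betw occ UNIV Maya"
  unfolding bij_betw_def
  by (simp add: type_definition.Rep_range[OF type_definition_maya_state] inj_on_def occ_inject)

lemma maya_bounds:
  obtains a b where "\<And>j. j \<in> occ t \<Longrightarrow> a \<le> j" "\<And>j. b \<le> j \<Longrightarrow> j \<in> occ t"
proof -
  have "maya (occ t)" by simp
  then show ?thesis unfolding maya_def using that by blast
qed

lemma maya_insert: "maya S \<Longrightarrow> maya (insert x S)"
  unfolding maya_def
proof (elim conjE exE)
  fix a b assume "\<forall>j\<in>S. a \<le> j" "\<forall>j\<ge>b. j \<in> S"
  then have "\<forall>j\<in>insert x S. min a x \<le> j" "\<forall>j\<ge>b. j \<in> insert x S" by auto
  then show "(\<exists>a. \<forall>j\<in>insert x S. a \<le> j) \<and> (\<exists>b. \<forall>j\<ge>b. j \<in> insert x S)" by blast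
qed

lemma maya_remove: "maya S \<Longrightarrow> maya (S - {x})"
  unfolding maya_def
proof (elim conjE exE)
  fix a b assume "\<forall>j\<in>S. a \<le> j" "\<forall>j\<ge>b. j \<in> S"
  then have "\<forall>j\<in>S - {x}. a \<le> j" "\<forall>j\<ge>max b (x + 1). j \<in> S - {x}" by auto
  then show "(\<exists>a. \<forall>j\<in>S - {x}. a \<le> j) \<and> (\<exists>b. \<forall>j\<ge>b. j \<in> S - {x})" by blast
qed

definition ins :: "int \<Rightarrow> maya_state \<Rightarrow> maya_state" where "ins x t = mk_maya_state (insert x (occ t))"
definition del :: "int \<Rightarrow> maya_state \<Rightarrow> maya_state" where "del x t = mk_maya_state (occ t - {x})"

lemma occ_ins [simp]: "occ (ins x t) = insert x (occ t)"
  by (simp add: ins_def occ_mk_maya_state maya_insert)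

lemma occ_del [simp]: "occ (del x t) = occ t - {x}"
  by (simp add: del_def occ_mk_maya_state maya_remove)

lemma ins_del [simp]: "x \<in> occ t \<Longrightarrow> ins x (del x t) = t"
  by (rule maya_state_eqI) auto

lemma del_ins [simp]: "x \<notin> occ t \<Longrightarrow> del x (ins x t) = t"
  by (rule maya_state_eqI) auto

lemma ins_commute: "ins x (ins y t) = ins y (ins x t)"
  by (rule maya_state_eqI) auto

lemma del_commute: "del x (del y t) = del y (del x t)"
  by (rule maya_state_eqI) auto

lemma ins_del_commute: "x \<noteq> y \<Longrightarrow> ins x (del y t) = del y (ins x t)"
  by (rule maya_state_eqI) auto

lemma finite_occ_less: "finite {i \<in> occ t. i < x}"
proof -
  obtain a b where "\<And>j. j \<in> occ t \<Longrightarrow> a \<le> j" by (rule maya_bounds[of t]) blast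
  then have "{i \<in> occ t. i < x} \<subseteq> {a..x}" by auto
  then show ?thesis by (rule finite_subset) simp
qed

lemma finite_holes_ge: "finite {i. i \<notin> occ t \<and> x \<le> i}"
proof -
  obtain a b where "\<And>j. b \<le> j \<Longrightarrow> j \<in> occ t" by (rule maya_bounds[of t]) blast
  then have "{i. i \<notin> occ t \<and> x \<le> i} \<subseteq> {x..b}"
    by (metis (no_types, lifting) atLeastAtMost_iff linorder_linear mem_Collect_eq subsetI)
  then show ?thesis by (rule finite_subset) simp
qed

abbreviation sg :: "maya_state \<Rightarrow> int \<Rightarrow> complex" where "sg t x \<equiv> fsign (occ t) x"

lemma sg_sq [simp]: "sg t x * sg t x = 1"
  by (simp add: fsign_def flip: power_add mult_2)

lemma sg_sq' [simp]: "sg t x * (sg t x * z) = z"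
  by (metis mult.assoc mult_1 sg_sq)

lemma fsign_insert:
  assumes "y \<notin> occ t"
  shows "fsign (insert y (occ t)) x = (if y < x then - sg t x else sg t x)"
proof -
  have "{i \<in> insert y (occ t). i < x} = (if y < x then insert y {i \<in> occ t. i < x} else {i \<in> occ t. i < x})"
    by auto
  then show ?thesis
    using assms by (auto simp: fsign_def finite_occ_less)
qed

lemma fsign_remove:
  assumes "y \<in> occ t"
  shows "fsign (occ t - {y}) x = (if y < x then - sg t x else sg t x)"
  using fsign_insert[of y "del y t" x] assms
  by (auto simp: insert_absorb split: if_splits)

text \<open>Vectors are read row by row: the value at \<open>t\<close> is pulled back from the only
  possible source. The sign may be taken at \<open>t\<close> instead of at the source because it
  counts only particles strictly below \<open>x\<close>.\<close>

definition create :: "int \<Rightarrow> fock \<Rightarrow> fock" where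
  "create x v = (\<lambda>t. if x \<in> occ t then sg t x * v (del x t) else 0)"

definition annih :: "int \<Rightarrow> fock \<Rightarrow> fock" where
  "annih x v = (\<lambda>t. if x \<notin> occ t then sg t x * v (ins x t) else 0)"

lemma create_create: "create x (create y v) t = - create y (create x v) t"
  by (cases "x = y") (auto simp: create_def fsign_remove del_commute)

lemma annih_annih: "annih x (annih y v) t = - annih y (annih x v) t"
  by (cases "x = y") (auto simp: annih_def fsign_insert ins_commute)

lemma create_annih: "x \<noteq> y \<Longrightarrow> create x (annih y v) t = - annih y (create x v) t"
  by (auto simp: create_def annih_def fsign_insert fsign_remove ins_del_commute)

lemma annih_create_same: "annih x (create x v) t = (if x \<notin> occ t then v t else 0)"
  by (auto simp: create_def annih_def fsign_insert)

lemma create_annih_same: "create x (annih x v) t = (if x \<in> occ t then v t else 0)"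
  by (auto simp: create_def annih_def fsign_remove)

lemma create_annih_car:
  "create x (annih y v) t = (if x = y then v t else 0) - annih y (create x v) t"
  by (auto simp: create_annih annih_create_same create_annih_same)

section \<open>Operators on arbitrary vectors with finite rows\<close>

definition rowfin :: "(fock \<Rightarrow> fock) \<Rightarrow> bool" where
  "rowfin F \<longleftrightarrow> (\<forall>t. \<exists>R K. finite R \<and> (\<forall>v. F v t = (\<Sum>u\<in>R. K u * v u)))"

definition ket :: "maya_state \<Rightarrow> fock" where "ket u = (\<lambda>t. if t = u then 1 else 0)"

lemma rowfin_lin:
  assumes "rowfin F"
  shows "F (\<lambda>t. \<Sum>i\<in>I. a i * v i t) t = (\<Sum>i\<in>I. a i * F (v i) t)"
proof -
  obtain R K where "finite R" and F: "\<And>v. F v t = (\<Sum>u\<in>R. K u * v u)"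
    using assms unfolding rowfin_def by metis
  have "(\<Sum>u\<in>R. K u * (\<Sum>i\<in>I. a i * v i u)) = (\<Sum>u\<in>R. \<Sum>i\<in>I. a i * (K u * v i u))"
    by (simp add: sum_distrib_left mult_ac)
  also have "\<dots> = (\<Sum>i\<in>I. \<Sum>u\<in>R. a i * (K u * v i u))" by (rule sum.swap)
  finally show ?thesis by (simp add: F sum_distrib_left)
qed

lemma rowfin_sum: "rowfin F \<Longrightarrow> F (\<lambda>t. \<Sum>i\<in>I. v i t) t = (\<Sum>i\<in>I. F (v i) t)"
  using rowfin_lin[of F "\<lambda>_. 1" v I t] by simp

lemma rowfin_scale: "rowfin F \<Longrightarrow> F (\<lambda>t. a * v t) t = a * F v t"
  using rowfin_lin[of F "\<lambda>_. a" "\<lambda>_. v" "{()}" t] by simp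

lemma rowfin_zero: "rowfin F \<Longrightarrow> F (\<lambda>t. 0) t = 0"
  using rowfin_scale[of F 0 "\<lambda>_. 0" t] by simp

lemma rowfin_add: "rowfin F \<Longrightarrow> F (\<lambda>t. u t + v t) t = F u t + F v t"
  using rowfin_lin[of F "\<lambda>_. 1" "\<lambda>b. if b then u else v" "{True, False}" t] by simp

lemma rowfin_minus: "rowfin F \<Longrightarrow> F (\<lambda>t. - v t) t = - F v t"
  using rowfin_scale[of F "-1" v t] by simp

lemma rowfin_diff: "rowfin F \<Longrightarrow> F (\<lambda>t. u t - v t) t = F u t - F v t"
  using rowfin_add[of F u "\<lambda>t. - v t" t] by (simp add: rowfin_minus)

text \<open>The coefficients in \<open>rowfin\<close> are existential; applying the operator to
  basis vectors recovers them, so the matrix entries are canonical.\<close>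

lemma rowfin_ket:
  assumes "rowfin F"
  shows "finite {u. F (ket u) t \<noteq> 0}"
    and "F v t = (\<Sum>u | F (ket u) t \<noteq> 0. F (ket u) t * v u)"
proof -
  obtain R K where R: "finite R" and F: "\<And>v. F v t = (\<Sum>u\<in>R. K u * v u)"
    using assms unfolding rowfin_def by metis
  have ket: "F (ket u) t = (if u \<in> R then K u else 0)" for u
    using R by (simp add: F ket_def if_distrib[of "(*) _"] cong: if_cong)
  have sub: "{u. F (ket u) t \<noteq> 0} \<subseteq> R" by (auto simp: ket)
  then show "finite {u. F (ket u) t \<noteq> 0}" using R finite_subset by blast
  show "F v t = (\<Sum>u | F (ket u) t \<noteq> 0. F (ket u) t * v u)"
    unfolding F[of v] by (rule sum.mono_neutral_cong_right[OF R sub]) (auto simp: ket)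
qed

lemma rowfin_ket_sum:
  assumes "rowfin F" "finite R" "\<And>u. u \<notin> R \<Longrightarrow> F (ket u) t * v u = 0"
  shows "F v t = (\<Sum>u\<in>R. F (ket u) t * v u)"
proof -
  have "F v t = (\<Sum>u | F (ket u) t \<noteq> 0. F (ket u) t * v u)" by (rule rowfin_ket(2)[OF assms(1)])
  also have "\<dots> = (\<Sum>u \<in> {u. F (ket u) t \<noteq> 0} \<union> R. F (ket u) t * v u)"
    by (rule sum.mono_neutral_left) (auto simp: assms(2) rowfin_ket(1)[OF assms(1)])
  also have "\<dots> = (\<Sum>u\<in>R. F (ket u) t * v u)"
    by (rule sum.mono_neutral_right) (use assms(3) in \<open>auto simp: assms(2) rowfin_ket(1)[OF assms(1)]\<close>)
  finally show ?thesis .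
qed

text \<open>The bridge to \<open>compose\<close>: a product of matrix entries summed over all
  intermediate states is the left operator applied to a column of the right one.\<close>

lemma rowfin_ket_has_sum:
  assumes "rowfin F"
  shows "((\<lambda>u. F (ket u) t * v u) has_sum F v t) UNIV"
proof -
  have "((\<lambda>u. F (ket u) t * v u) has_sum F v t) {u. F (ket u) t \<noteq> 0}"
    unfolding rowfin_ket(2)[OF assms, of v t] by (rule has_sum_finite[OF rowfin_ket(1)[OF assms]])
  then show ?thesis
    by (rule has_sum_cong_neutral[THEN iffD1, rotated -1]) auto
qed

lemma rowfin_cmp:
  assumes "rowfin F" "rowfin G"
  shows "rowfin (\<lambda>v. F (G v))"
  unfolding rowfin_def
proof
  fix t
  let ?R = "{u. F (ket u) t \<noteq> 0}"
  let ?S = "\<Union>u\<in>?R. {w. G (ket w) u \<noteq> 0}"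
  have fin: "finite ?S" using rowfin_ket(1)[OF assms(1)] rowfin_ket(1)[OF assms(2)] by blast
  have "F (G v) t = (\<Sum>w\<in>?S. (\<Sum>u\<in>?R. F (ket u) t * G (ket w) u) * v w)" for v
  proof -
    have "F (G v) t = (\<Sum>u\<in>?R. F (ket u) t * G v u)" by (rule rowfin_ket(2)[OF assms(1)])
    also have "\<dots> = (\<Sum>u\<in>?R. F (ket u) t * (\<Sum>w\<in>?S. G (ket w) u * v w))"
      by (intro sum.cong refl arg_cong2[where f="(*)"] rowfin_ket_sum[OF assms(2) fin]) auto
    also have "\<dots> = (\<Sum>u\<in>?R. \<Sum>w\<in>?S. F (ket u) t * G (ket w) u * v w)"
      by (simp add: sum_distrib_left mult_ac)
    also have "\<dots> = (\<Sum>w\<in>?S. \<Sum>u\<in>?R. F (ket u) t * G (ket w) u * v w)" by (rule sum.swap)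
    finally show ?thesis by (simp add: sum_distrib_right)
  qed
  then show "\<exists>R K. finite R \<and> (\<forall>v. F (G v) t = (\<Sum>u\<in>R. K u * v u))"
    using fin by (intro exI[of _ ?S] exI[of _ "\<lambda>w. \<Sum>u\<in>?R. F (ket u) t * G (ket w) u"]) blast
qed

text \<open>The index set may depend on the row, so infinite sums that are finite in each row, such
  as the currents, are covered.\<close>

lemma rowfin_sumI:
  assumes "\<And>t. \<exists>I. finite I \<and> (\<forall>i\<in>I. rowfin (G i)) \<and> (\<forall>v. F v t = (\<Sum>i\<in>I. a i t * G i v t))"
  shows "rowfin F"
  unfolding rowfin_def
proof
  fix t
  obtain I where I: "finite I" "\<And>i. i \<in> I \<Longrightarrow> rowfin (G i)"
    and F: "\<And>v. F v t = (\<Sum>i\<in>I. a i t * G i v t)"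
    using assms[of t] by blast
  let ?S = "\<Union>i\<in>I. {u. G i (ket u) t \<noteq> 0}"
  have fin: "finite ?S" using I rowfin_ket(1) by blast
  have "F v t = (\<Sum>u\<in>?S. (\<Sum>i\<in>I. a i t * G i (ket u) t) * v u)" for v
  proof -
    have "F v t = (\<Sum>i\<in>I. a i t * (\<Sum>u\<in>?S. G i (ket u) t * v u))"
      unfolding F by (intro sum.cong refl arg_cong2[where f="(*)"] rowfin_ket_sum[OF I(2) fin]) auto
    also have "\<dots> = (\<Sum>i\<in>I. \<Sum>u\<in>?S. a i t * G i (ket u) t * v u)"
      by (simp add: sum_distrib_left mult_ac)
    also have "\<dots> = (\<Sum>u\<in>?S. \<Sum>i\<in>I. a i t * G i (ket u) t * v u)" by (rule sum.swap)
    finally show ?thesis by (simp add: sum_distrib_right)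
  qed
  then show "\<exists>R K. finite R \<and> (\<forall>v. F v t = (\<Sum>u\<in>R. K u * v u))"
    using fin by (intro exI[of _ ?S] exI[of _ "\<lambda>u. \<Sum>i\<in>I. a i t * G i (ket u) t"]) blast
qed

lemma rowfin_single:
  assumes "\<And>v t. F v t = K t * v (f t)"
  shows "rowfin F"
  unfolding rowfin_def
proof
  fix t show "\<exists>R K. finite R \<and> (\<forall>v. F v t = (\<Sum>u\<in>R. K u * v u))"
    by (rule exI[of _ "{f t}"], rule exI[of _ "\<lambda>_. K t"]) (simp add: assms)
qed

lemma rowfin_create [simp]: "rowfin (create x)"
  by (rule rowfin_single[of _ "\<lambda>t. if x \<in> occ t then sg t x else 0" "del x"]) (simp add: create_def)

lemma rowfin_annih [simp]: "rowfin (annih x)"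
  by (rule rowfin_single[of _ "\<lambda>t. if x \<notin> occ t then sg t x else 0" "ins x"]) (simp add: annih_def)

text \<open>The moves \<open>x \<mapsto> x + k\<close> with weight \<open>w x\<close>. The annihilator stands on the left (hole ordering): for
  \<open>k = 0\<close> the sum then still converges for geometric \<open>w\<close>, and no normal-ordering constant appears.\<close>

definition hop :: "(int \<Rightarrow> complex) \<Rightarrow> int \<Rightarrow> fock \<Rightarrow> fock" where
  "hop w k v = (\<lambda>t. \<Sum>\<^sub>\<infinity>x. - w x * annih x (create (x + k) v) t)"

text \<open>A nonzero shift allows only finitely many moves in each row, whatever the weight. At
  shift 0 every hole contributes, and the holes extend to minus infinity.\<close>

definition hop_ok :: "(int \<Rightarrow> complex) \<Rightarrow> int \<Rightarrow> bool" where
  "hop_ok w k \<longleftrightarrow> k \<noteq> 0 \<or> (\<forall>M. w summable_on {..<M})"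

abbreviation current :: "int \<Rightarrow> fock \<Rightarrow> fock" where
  "current k \<equiv> hop (\<lambda>_. 1) k"

lemma finite_hops: "k \<noteq> 0 \<Longrightarrow> finite {x. x \<notin> occ t \<and> x + k \<in> occ t}"
proof -
  obtain a b where ab: "\<And>j. j \<in> occ t \<Longrightarrow> a \<le> j" "\<And>j. b \<le> j \<Longrightarrow> j \<in> occ t"
    by (rule maya_bounds[of t]) blast
  have "{x. x \<notin> occ t \<and> x + k \<in> occ t} \<subseteq> {a - k..b}"
  proof
    fix x assume "x \<in> {x. x \<notin> occ t \<and> x + k \<in> occ t}"
    then show "x \<in> {a - k..b}" using ab(1)[of "x + k"] ab(2)[of x] by (cases "b \<le> x") auto
  qed
  then show ?thesis by (rule finite_subset) simp
qed

lemma annih_create_zero: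
  "k \<noteq> 0 \<Longrightarrow> \<not> (x \<notin> occ t \<and> x + k \<in> occ t) \<Longrightarrow> annih x (create (x + k) v) t = 0"
  by (auto simp: annih_def create_def)

lemma hop_eq_sum:
  assumes "k \<noteq> 0"
  shows "hop w k v t = (\<Sum>x | x \<notin> occ t \<and> x + k \<in> occ t. - w x * annih x (create (x + k) v) t)"
  unfolding hop_def
  by (subst infsum_finite[symmetric, OF finite_hops[OF assms]], rule infsum_cong_neutral)
     (use annih_create_zero[OF assms] in auto)

lemma hop_summable:
  assumes "hop_ok w k"
  shows "(\<lambda>x. w x * annih x (create (x + k) v) t) summable_on UNIV"
proof (cases "k = 0")
  case False
  have "(\<lambda>x. w x * annih x (create (x + k) v) t) summable_on {x. x \<notin> occ t \<and> x + k \<in> occ t}"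
    by (rule summable_on_finite[OF finite_hops[OF False]])
  then show ?thesis
    by (rule summable_on_cong_neutral[THEN iffD1, rotated -1]) (use annih_create_zero[OF False] in auto)
next
  case True
  obtain b where b: "\<And>j. b \<le> j \<Longrightarrow> j \<in> occ t" by (rule maya_bounds[of t]) blast
  have "w summable_on {x. x \<notin> occ t}"
  proof (rule summable_on_subset_banach)
    show "w summable_on {..<b}" using assms True by (simp add: hop_ok_def)
    show "{x. x \<notin> occ t} \<subseteq> {..<b}"
    proof
      fix x assume "x \<in> {x. x \<notin> occ t}"
      then have "\<not> b \<le> x" using b by blast
      then show "x \<in> {..<b}" by simp
    qed
  qed
  then have "(\<lambda>x. w x * v t) summable_on {x. x \<notin> occ t}" by (rule summable_on_cmult_left)
  then show ?thesis
    by (rule summable_on_cong_neutral[THEN iffD1, rotated -1]) (auto simp: True annih_create_same)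
qed

lemma rowfin_hop [simp]: "rowfin (hop w k)"
proof (cases "k = 0")
  case False
  show ?thesis
  proof (rule rowfin_sumI[of "\<lambda>x v. annih x (create (x + k) v)" _ "\<lambda>x t. - w x"])
    fix t
    show "\<exists>I. finite I \<and> (\<forall>i\<in>I. rowfin (\<lambda>v. annih i (create (i + k) v))) \<and>
      (\<forall>v. hop w k v t = (\<Sum>i\<in>I. - w i * annih i (create (i + k) v) t))"
      by (rule exI[of _ "{x. x \<notin> occ t \<and> x + k \<in> occ t}"])
         (simp add: finite_hops[OF False] hop_eq_sum[OF False] rowfin_cmp)
  qed
next
  case True
  show ?thesis
  proof (rule rowfin_single[of _ "\<lambda>t. \<Sum>\<^sub>\<infinity>x\<in>- occ t. - w x" id])
    \<comment> \<open>At shift 0 the operator is diagonal; for an unsummable weight both sides take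
      the default value 0.\<close>
    fix v t
    have "hop w k v t = (\<Sum>\<^sub>\<infinity>x\<in>- occ t. - w x * v t)"
      unfolding hop_def True by (rule infsum_cong_neutral) (auto simp: annih_create_same)
    then show "hop w k v t = (\<Sum>\<^sub>\<infinity>x\<in>- occ t. - w x) * v (id t)"
      using infsum_cmult_left'[of "\<lambda>x. - w x" "v t" "- occ t"] by simp
  qed
qed

text \<open>The anticommutation relations cancel every summand except \<open>x = b\<close>. Both
  sums are summable, so they may be subtracted termwise.\<close>

lemma current_create:
  assumes "m \<noteq> 0"
  shows "current m (create b v) t = create b (current m v) t + create (b + m) v t"
proof -
  have ok: "hop_ok (\<lambda>_. 1) m" using assms by (simp add: hop_ok_def)
  let ?F = "\<lambda>x. - (annih x (create (x + m) (create b v)) t)"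
  let ?G = "\<lambda>x. - (create b (annih x (create (x + m) v)) t)"
  have G: "?G x = (if b \<in> occ t then sg t b else 0) * - annih x (create (x + m) v) (del b t)" for x
    by (simp add: create_def)
  have sF: "?F summable_on UNIV"
    using hop_summable[OF ok, of "create b v" t] by (simp add: summable_on_uminus)
  have sG: "?G summable_on UNIV"
    unfolding G using hop_summable[OF ok, of v "del b t"]
    by (intro summable_on_cmult_right) (simp add: summable_on_uminus)
  have J: "create b (current m v) t = infsum ?G UNIV"
    unfolding G infsum_cmult_right' by (simp add: create_def hop_def)
  have FG: "?F x - ?G x = (if x = b then create (b + m) v t else 0)" for x
  proof -
    have "annih x (create (x + m) (create b v)) t = annih x (\<lambda>t. - create b (create (x + m) v) t) t"
      by (rule arg_cong[where f="\<lambda>f. annih x f t"], rule ext, rule create_create)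
    then have "?F x = annih x (create b (create (x + m) v)) t" by (simp add: rowfin_minus)
    then show ?thesis by (simp add: create_annih_car)
  qed
  have "current m (create b v) t - create b (current m v) t = (\<Sum>\<^sub>\<infinity>x. ?F x - ?G x)"
    using infsum_add[OF sF summable_on_uminus[THEN iffD2, OF sG]] unfolding J
    by (simp add: hop_def infsum_uminus)
  also have "\<dots> = create (b + m) v t"
    unfolding FG by (subst infsum_cong_neutral[where T="{b}" and g="\<lambda>_. create (b + m) v t"]) auto
  finally show ?thesis by (simp add: algebra_simps)
qed

lemma current_annih:
  assumes "m \<noteq> 0"
  shows "current m (annih b v) t = annih b (current m v) t - annih (b - m) v t"
proof -
  have ok: "hop_ok (\<lambda>_. 1) m" using assms by (simp add: hop_ok_def)
  let ?F = "\<lambda>x. - (annih x (create (x + m) (annih b v)) t)"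
  let ?G = "\<lambda>x. - (annih b (annih x (create (x + m) v)) t)"
  have G: "?G x = (if b \<notin> occ t then sg t b else 0) * - annih x (create (x + m) v) (ins b t)" for x
    by (simp add: annih_def)
  have sF: "?F summable_on UNIV"
    using hop_summable[OF ok, of "annih b v" t] by (simp add: summable_on_uminus)
  have sG: "?G summable_on UNIV"
    unfolding G using hop_summable[OF ok, of v "ins b t"]
    by (intro summable_on_cmult_right) (simp add: summable_on_uminus)
  have J: "annih b (current m v) t = infsum ?G UNIV"
    unfolding G infsum_cmult_right' by (simp add: annih_def hop_def)
  have FG: "?F x - ?G x = (if x = b - m then - annih (b - m) v t else 0)" for x
  proof -
    have "annih x (create (x + m) (annih b v)) t
      = annih x (\<lambda>t. (if x + m = b then v t else 0) - annih b (create (x + m) v) t) t"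
      by (rule arg_cong[where f="\<lambda>f. annih x f t"], rule ext, rule create_annih_car)
    also have "\<dots> = (if x + m = b then annih x v t else 0) - annih x (annih b (create (x + m) v)) t"
      by (auto simp: rowfin_minus rowfin_diff rowfin_zero)
    finally show ?thesis by (auto simp: annih_annih[of x b])
  qed
  have "current m (annih b v) t - annih b (current m v) t = (\<Sum>\<^sub>\<infinity>x. ?F x - ?G x)"
    using infsum_add[OF sF summable_on_uminus[THEN iffD2, OF sG]] unfolding J
    by (simp add: hop_def infsum_uminus)
  also have "\<dots> = - annih (b - m) v t"
    unfolding FG by (subst infsum_cong_neutral[where T="{b - m}" and g="\<lambda>_. - annih (b - m) v t"]) auto
  finally show ?thesis by (simp add: algebra_simps)
qed

section \<open>Commutators of currents and weighted hops\<close>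

lemma hop_has_sum:
  "hop_ok w k \<Longrightarrow> ((\<lambda>x. - w x * annih x (create (x + k) v) t) has_sum hop w k v t) UNIV"
  unfolding hop_def using hop_summable[of w k v t]
  by (intro has_sum_infsum) (simp add: summable_on_uminus)

lemma hop_ok_shift:
  assumes "hop_ok w k" shows "hop_ok (\<lambda>x. w (x + m)) k"
proof -
  have "(\<lambda>x. w (x + m)) summable_on {..<M} \<longleftrightarrow> w summable_on {..<M + m}" for M
    by (rule summable_on_reindex_bij_witness[of _ "\<lambda>x. x - m" "\<lambda>x. x + m"]) auto
  then show ?thesis using assms by (auto simp: hop_ok_def)
qed

lemma hop_scale: "hop (\<lambda>x. a * w x) k v t = a * hop w k v t"
  unfolding hop_def by (subst infsum_cmult_right'[symmetric]) (simp add: mult_ac)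

lemma has_sum_finite_sum:
  fixes f :: "'a \<Rightarrow> 'b \<Rightarrow> complex"
  assumes "finite R" "\<And>u. u \<in> R \<Longrightarrow> ((f u) has_sum (s u)) A"
  shows "((\<lambda>y. \<Sum>u\<in>R. f u y) has_sum (\<Sum>u\<in>R. s u)) A"
  using assms by (induction R) (auto intro!: has_sum_add)

lemma rowfin_has_sum:
  assumes "rowfin G" "\<And>u. ((\<lambda>y. F y u) has_sum s u) A"
  shows "((\<lambda>y. G (F y) t) has_sum G s t) A"
proof -
  let ?R = "{u. G (ket u) t \<noteq> 0}"
  have "((\<lambda>y. \<Sum>u\<in>?R. G (ket u) t * F y u) has_sum (\<Sum>u\<in>?R. G (ket u) t * s u)) A"
    by (intro has_sum_finite_sum rowfin_ket(1) assms has_sum_cmult_right)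
  then show ?thesis unfolding rowfin_ket(2)[OF assms(1), symmetric] .
qed

lemma current_bilinear:
  assumes "m \<noteq> 0"
  shows "current m (annih y (create z v)) t = annih y (create z (current m v)) t
    + annih y (create (z + m) v) t - annih (y - m) (create z v) t"
proof -
  have "current m (create z v) = (\<lambda>t. create z (current m v) t + create (z + m) v t)"
    using current_create[OF assms] by blast
  then show ?thesis by (simp add: current_annih[OF assms] rowfin_add)
qed

text \<open>The current is moved past one fermion at a time, which needs no reordering and hence
  produces no scalar; reindexing one of the two new sums turns them into a difference of weights.
  Separating them requires convergence of each at shift \<open>j + m\<close>, the second
  \<open>hop_ok\<close> assumption, which constant weights violate at
  \<open>j + m = 0\<close>.\<close>

lemma current_hop:
  assumes "m \<noteq> 0" "hop_ok w j" "hop_ok w (j + m)"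
  shows "current m (hop w j v) t = hop w j (current m v) t + hop (\<lambda>x. w x - w (x + m)) (j + m) v t"
proof -
  have 1: "((\<lambda>y. current m (\<lambda>t. - w y * annih y (create (y + j) v) t) t) has_sum current m (hop w j v) t) UNIV"
    by (rule rowfin_has_sum) (use hop_has_sum[OF assms(2)] in auto)
  have F: "current m (\<lambda>t. - w y * annih y (create (y + j) v) t) t
     = - w y * annih y (create (y + j) (current m v)) t
       + (- w y * annih y (create (y + (j + m)) v) t + w y * annih (y - m) (create (y + j) v) t)" for y
  proof -
    have "current m (\<lambda>t. - w y * annih y (create (y + j) v) t) t = - w y * current m (annih y (create (y + j) v)) t"
      by (rule rowfin_scale) simp
    then show ?thesis by (simp add: current_bilinear[OF assms(1)] algebra_simps)
  qed
  have 3: "((\<lambda>y. w y * annih (y - m) (create (y + j) v) t) has_sum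
      - hop (\<lambda>x. w (x + m)) (j + m) v t) UNIV"
  proof -
    have "((\<lambda>x. w (x + m) * annih x (create (x + (j + m)) v) t) has_sum - hop (\<lambda>x. w (x + m)) (j + m) v t) UNIV"
      using has_sum_uminusI[OF hop_has_sum[OF hop_ok_shift[OF assms(3)], of m v t]] by simp
    then show ?thesis
      by (rule has_sum_reindex_bij_witness[of _ "\<lambda>y. y - m" "\<lambda>x. x + m", THEN iffD1, rotated -1])
         (auto simp: algebra_simps)
  qed
  have 2: "((\<lambda>y. - w y * annih y (create (y + j) (current m v)) t
       + (- w y * annih y (create (y + (j + m)) v) t + w y * annih (y - m) (create (y + j) v) t))
      has_sum hop w j (current m v) t + (hop w (j + m) v t + - hop (\<lambda>x. w (x + m)) (j + m) v t)) UNIV"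
    by (intro has_sum_add hop_has_sum assms 3)
  have "((\<lambda>x. - w x * annih x (create (x + (j + m)) v) t + - (- w (x + m) * annih x (create (x + (j + m)) v) t))
      has_sum hop w (j + m) v t + - hop (\<lambda>x. w (x + m)) (j + m) v t) UNIV"
    by (intro has_sum_add hop_has_sum assms has_sum_uminusI hop_ok_shift)
  then have "hop (\<lambda>x. w x - w (x + m)) (j + m) v t = hop w (j + m) v t + - hop (\<lambda>x. w (x + m)) (j + m) v t"
    unfolding hop_def[of "\<lambda>x. w x - w (x + m)"] by (intro infsumI) (simp add: algebra_simps)
  then show ?thesis
    using has_sum_unique[OF 1[unfolded F] 2] by simp
qed

lemma current_commute:
  assumes "m \<noteq> 0" "l \<noteq> 0" "l + m \<noteq> 0"
  shows "current m (current l v) t = current l (current m v) t"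
  using current_hop[of m "\<lambda>_. 1" l v t] assms hop_scale[of 0 "\<lambda>_. 0" "l + m" v t] by (simp add: hop_ok_def)

text \<open>Here the two halves of the commutator diverge separately, so they are combined for each
  \<open>y\<close> before summing. What remains counts holes at \<open>y - m\<close> minus holes at
  \<open>y\<close>.\<close>

lemma current_heisenberg:
  assumes "0 < m"
  shows "current m (current (- m) v) t = current (- m) (current m v) t + of_int m * v t"
proof -
  have ok: "hop_ok (\<lambda>_. 1) (- m)" using assms by (simp add: hop_ok_def)
  have 1: "((\<lambda>y. current m (\<lambda>t. - 1 * annih y (create (y + - m) v) t) t) has_sum current m (current (- m) v) t) UNIV"
    by (rule rowfin_has_sum) (use hop_has_sum[OF ok] in auto)
  let ?f = "\<lambda>y. if y \<notin> occ t then 1 else 0 :: complex"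
  have F: "current m (\<lambda>t. - 1 * annih y (create (y + - m) v) t) t
     = - 1 * annih y (create (y + - m) (current m v)) t + (?f (y - m) - ?f y) * v t" for y
  proof -
    have "current m (\<lambda>t. - 1 * annih y (create (y + - m) v) t) t = - 1 * current m (annih y (create (y + - m) v)) t"
      by (rule rowfin_scale) simp
    then show ?thesis using assms by (simp add: current_bilinear annih_create_same)
  qed
  obtain a b where ab: "\<And>j. j \<in> occ t \<Longrightarrow> a \<le> j" "\<And>j. b \<le> j \<Longrightarrow> j \<in> occ t"
    by (rule maya_bounds[of t]) blast
  have le: "a \<le> b" using ab by blast
  \<comment> \<open>The hole indicator is 1 far below and 0 far above, so shifting it by
    \<open>m\<close> changes its total by \<open>m\<close>.\<close>
  have 2: "((\<lambda>y. ?f (y - m) - ?f y) has_sum of_int m) UNIV"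
  proof (rule has_sum_finite_neutralI[of "{a..b + m}"])
    have "(\<Sum>y=a..b + m. ?f (y - m)) = (\<Sum>y=a - m..b. ?f y)"
      by (rule sum.reindex_bij_witness[of _ "\<lambda>y. y + m" "\<lambda>y. y - m"]) auto
    also have "\<dots> = (\<Sum>y\<in>{a - m..<a} \<union> {a..b}. ?f y)"
      by (rule sum.cong) (use assms le in auto)
    also have "\<dots> = (\<Sum>y\<in>{a - m..<a}. ?f y) + (\<Sum>y=a..b. ?f y)"
      by (rule sum.union_disjoint) auto
    also have "(\<Sum>y\<in>{a - m..<a}. ?f y) = (\<Sum>y\<in>{a - m..<a}. 1)"
      by (rule sum.cong) (use ab in force)+
    also have "(\<Sum>y=a..b. ?f y) = (\<Sum>y=a..b + m. ?f y)"
      by (rule sum.mono_neutral_left) (use assms ab in auto)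
    finally show "of_int m = (\<Sum>y=a..b + m. ?f (y - m) - ?f y)"
      using assms by (simp add: sum_subtractf)
  next
    fix y assume y: "y \<in> UNIV - {a..b + m}"
    then consider "y < a" | "b + m < y" by force
    then show "?f (y - m) - ?f y = 0"
    proof cases
      case 1 then show ?thesis using ab(1)[of y] ab(1)[of "y - m"] assms by auto
    next
      case 2 then show ?thesis using ab(2)[of y] ab(2)[of "y - m"] assms by auto
    qed
  qed auto
  have "((\<lambda>y. - 1 * annih y (create (y + - m) (current m v)) t + (?f (y - m) - ?f y) * v t)
      has_sum (current (- m) (current m v) t + of_int m * v t)) UNIV"
    by (rule has_sum_add[OF hop_has_sum[OF ok] has_sum_cmult_left[OF 2]])
  from has_sum_unique[OF 1[unfolded F] this] show ?thesis .
qed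

text \<open>The eigenvalue of \<open>\<Sum>\<^sub>a f(a) :\<psi>\<^sub>a \<psi>\<^sup>*\<^sub>-\<^sub>a:\<close>.\<close>

definition mom :: "(int \<Rightarrow> int) \<Rightarrow> maya_state \<Rightarrow> int" where
  "mom f t = (\<Sum>a | a \<in> occ t \<and> a < 0. f a) - (\<Sum>a | a \<notin> occ t \<and> 0 \<le> a. f a)"

abbreviation en :: "maya_state \<Rightarrow> int" where "en \<equiv> mom uminus"
abbreviation ch :: "maya_state \<Rightarrow> int" where "ch \<equiv> mom (\<lambda>_. 1)"

lemma mom_ins:
  assumes "x \<notin> occ t" shows "mom f (ins x t) = mom f t + f x"
proof (cases "x < 0")
  case True
  have "{a. a \<in> occ (ins x t) \<and> a < 0} = insert x {a. a \<in> occ t \<and> a < 0}"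
    "{a. a \<notin> occ (ins x t) \<and> 0 \<le> a} = {a. a \<notin> occ t \<and> 0 \<le> a}" using True by auto
  then show ?thesis using assms by (simp add: mom_def finite_occ_less)
next
  case False
  have "{a. a \<in> occ (ins x t) \<and> a < 0} = {a. a \<in> occ t \<and> a < 0}"
    "{a. a \<notin> occ t \<and> 0 \<le> a} = insert x {a. a \<notin> occ (ins x t) \<and> 0 \<le> a}" using False assms by auto
  then show ?thesis using finite_holes_ge[of "ins x t" 0] by (simp add: mom_def)
qed

lemma mom_del: "x \<in> occ t \<Longrightarrow> mom f (del x t) = mom f t - f x"
  using mom_ins[of x "del x t" f] by simp

text \<open>Particles below 0 and holes at or above 0 both raise the energy. This bounds the degrees
  in which Gamma_+ can act on a given basis state.\<close>

lemma en_nonneg: "0 \<le> en t"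
proof -
  have "0 \<le> (\<Sum>a | a \<in> occ t \<and> a < 0. - a)" "0 \<le> (\<Sum>a | a \<notin> occ t \<and> 0 \<le> a. a)"
    by (auto intro: sum_nonneg)
  then show ?thesis by (simp add: mom_def sum_negf)
qed

text \<open>Each move takes one particle from \<open>x\<close> to \<open>x + k\<close>. The grading
  is thus used without subspaces: a vector may be changed freely off the component that is
  read.\<close>

lemma hop_local:
  assumes "\<And>u. en u = en t + k \<Longrightarrow> ch u = ch t \<Longrightarrow> v u = v' u"
  shows "hop w k v t = hop w k v' t"
proof -
  have "annih x (create (x + k) v) t = annih x (create (x + k) v') t" for x
  proof (cases "x \<notin> occ t \<and> x + k \<in> occ (ins x t)")
    case True
    have "v (del (x + k) (ins x t)) = v' (del (x + k) (ins x t))"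
      by (rule assms) (use True in \<open>simp_all add: mom_ins mom_del\<close>)
    then show ?thesis by (simp add: annih_def create_def)
  qed (auto simp: annih_def create_def)
  then show ?thesis by (simp add: hop_def)
qed

section \<open>Homogeneous components of vertex operators\<close>

text \<open>The degree \<open>N\<close> component of \<open>exp (\<Sum>\<^sub>m p\<^sub>m / m J\<^sub>e\<^sub>m)\<close>, given by Newton's recursion.\<close>

fun hexp :: "int \<Rightarrow> (nat \<Rightarrow> complex) \<Rightarrow> nat \<Rightarrow> fock \<Rightarrow> fock" where
  "hexp e p 0 v = v"
| "hexp e p (Suc N) v = (\<lambda>t. (\<Sum>m\<le>N. p (Suc m) * current (e * int (Suc m)) (hexp e p (N - m) v) t) / of_nat (Suc N))"

lemma hexp_rec:
  "of_nat N * hexp e p N v t = (\<Sum>m=1..N. p m * current (e * int m) (hexp e p (N - m) v) t)"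
proof (cases N)
  case (Suc M)
  have "(\<Sum>m\<le>M. p (Suc m) * current (e * int (Suc m)) (hexp e p (M - m) v) t)
    = (\<Sum>m=1..N. p m * current (e * int m) (hexp e p (N - m) v) t)"
    by (rule sum.reindex_bij_witness[of _ "\<lambda>m. m - 1" Suc]) (auto simp: Suc)
  then show ?thesis using Suc by (simp del: of_nat_Suc)
qed simp

lemma rowfin_hexp [simp]: "rowfin (hexp e p N)"
proof (induction N rule: less_induct)
  case (less N)
  show ?case
  proof (cases N)
    case 0
    have "hexp e p 0 = (\<lambda>v. v)" by (rule ext) simp
    then show ?thesis unfolding 0 by (simp add: rowfin_single[of _ "\<lambda>_. 1" id])
  next
    case (Suc M)
    show ?thesis
    proof (rule rowfin_sumI[of "\<lambda>m v. current (e * int (Suc m)) (hexp e p (M - m) v)" _ "\<lambda>m t. p (Suc m) / of_nat (Suc M)"])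
      fix t show "\<exists>I. finite I \<and> (\<forall>m\<in>I. rowfin (\<lambda>v. current (e * int (Suc m)) (hexp e p (M - m) v))) \<and>
        (\<forall>v. hexp e p N v t = (\<Sum>m\<in>I. p (Suc m) / of_nat (Suc M) * current (e * int (Suc m)) (hexp e p (M - m) v) t))"
        by (rule exI[of _ "{..M}"]) (simp add: Suc less rowfin_cmp sum_divide_distrib)
    qed
  qed
qed

lemma hexp_local:
  assumes "\<And>u. en u = en t + e * int N \<Longrightarrow> ch u = ch t \<Longrightarrow> v u = v' u"
  shows "hexp e p N v t = hexp e p N v' t"
  using assms
proof (induction N arbitrary: t rule: less_induct)
  case (less N)
  show ?case
  proof (cases N)
    case 0 then show ?thesis using less.prems[of t] by simp
  next
    case (Suc M)
    have "current (e * int (Suc m)) (hexp e p (M - m) v) t = current (e * int (Suc m)) (hexp e p (M - m) v') t"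
      if m: "m \<le> M" for m
    proof (rule hop_local)
      fix u assume u: "en u = en t + e * int (Suc m)" "ch u = ch t"
      show "hexp e p (M - m) v u = hexp e p (M - m) v' u"
      proof (rule less.IH)
        fix x assume x: "en x = en u + e * int (M - m)" "ch x = ch u"
        show "v x = v' x"
        proof (rule less.prems)
          show "en x = en t + e * int N"
            unfolding x u Suc using m by (simp add: of_nat_diff algebra_simps)
          show "ch x = ch t" using x u by simp
        qed
      qed (use Suc in simp)
    qed
    then show ?thesis by (simp add: Suc)
  qed
qed

lemma sum_triangle:
  fixes f :: "nat \<Rightarrow> nat \<Rightarrow> 'a::comm_monoid_add"
  shows "(\<Sum>m=1..N. \<Sum>j\<le>N - m. f m j) = (\<Sum>j\<le>N. \<Sum>m=1..N - j. f m j)"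
    and "(\<Sum>m=1..N. \<Sum>j\<le>N - m. f m j) = (\<Sum>l\<le>N. \<Sum>m=1..l. f m (l - m))"
proof -
  have 1: "(\<Sum>m=1..N. \<Sum>j\<le>N - m. f m j) = (\<Sum>(m, j)\<in>Sigma {1..N} (\<lambda>m. {..N - m}). f m j)"
    by (rule sum.Sigma) auto
  also have "\<dots> = (\<Sum>(j, m)\<in>Sigma {..N} (\<lambda>j. {1..N - j}). f m j)"
    by (rule sum.reindex_bij_witness[of _ "\<lambda>(a, b). (b, a)" "\<lambda>(a, b). (b, a)"]) auto
  finally show "(\<Sum>m=1..N. \<Sum>j\<le>N - m. f m j) = (\<Sum>j\<le>N. \<Sum>m=1..N - j. f m j)"
    by (simp add: sum.Sigma)
  have "(\<Sum>(m, j)\<in>Sigma {1..N} (\<lambda>m. {..N - m}). f m j) = (\<Sum>(l, m)\<in>Sigma {..N} (\<lambda>l. {1..l}). f m (l - m))"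
    by (rule sum.reindex_bij_witness[of _ "\<lambda>(l, m). (m, l - m)" "\<lambda>(m, j). (m + j, m)"]) auto
  then show "(\<Sum>m=1..N. \<Sum>j\<le>N - m. f m j) = (\<Sum>l\<le>N. \<Sum>m=1..l. f m (l - m))"
    unfolding 1 by (simp add: sum.Sigma)
qed

text \<open>With exp (sum_m p_m kappa_m u^m / m) = sum_j g_j u^j, this is the conjugation rule Gamma
  X_i = sum_j g_j X_(i+j) Gamma in degree \<open>N\<close>. Multiplying by the degree turns both
  \<open>hexp\<close> and \<open>g\<close> into Newton recursions; the terms in which the current
  passes through carry the weight \<open>N - j\<close>, those in which it is absorbed the weight
  \<open>j\<close>. The families used later are weighted hops, single fermions, one fixed current,
  and vertex components of opposite sign.\<close>

lemma hexp_intertwine: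
  assumes X: "\<And>i. rowfin (X i)"
    and comm: "\<And>m i v t. 1 \<le> m \<Longrightarrow> current (e * int m) (X i v) t
      = X i (current (e * int m) v) t + \<kappa> m * X (i + m) v t"
    and g0: "g 0 = 1" and g: "\<And>j. of_nat j * g j = (\<Sum>m=1..j. p m * \<kappa> m * g (j - m))"
  shows "hexp e p N (X i v) t = (\<Sum>j\<le>N. g j * X (i + j) (hexp e p (N - j) v) t)"
proof (induction N arbitrary: t rule: less_induct)
  case (less N)
  show ?case
  proof (cases "N = 0")
    case True then show ?thesis by (simp add: g0)
  next
    case False
    let ?h = "\<lambda>N. hexp e p N v"
    have IH: "hexp e p (N - m) (X i v) = (\<lambda>t. \<Sum>j\<le>N - m. g j * X (i + j) (?h (N - m - j)) t)"
      if "m \<in> {1..N}" for m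
      using less.IH[of "N - m"] that False by auto
    have "of_nat N * hexp e p N (X i v) t
      = (\<Sum>m=1..N. p m * current (e * int m) (\<lambda>t. \<Sum>j\<le>N - m. g j * X (i + j) (?h (N - m - j)) t) t)"
      unfolding hexp_rec by (intro sum.cong refl) (simp add: IH)
    also have "\<dots> = (\<Sum>m=1..N. \<Sum>j\<le>N - m. p m * g j * X (i + j) (current (e * int m) (?h (N - m - j))) t
        + p m * \<kappa> m * g j * X (i + (m + j)) (?h (N - (m + j))) t)"
    proof (intro sum.cong refl)
      fix m assume m: "m \<in> {1..N}"
      have "current (e * int m) (\<lambda>t. \<Sum>j\<le>N - m. g j * X (i + j) (?h (N - m - j)) t) t
        = (\<Sum>j\<le>N - m. g j * current (e * int m) (X (i + j) (?h (N - m - j))) t)"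
        by (rule rowfin_lin) simp
      also have "\<dots> = (\<Sum>j\<le>N - m. g j * (X (i + j) (current (e * int m) (?h (N - m - j))) t
          + \<kappa> m * X (i + j + m) (?h (N - m - j)) t))"
        by (intro sum.cong refl, subst comm) (use m in auto)
      finally show "p m * current (e * int m) (\<lambda>t. \<Sum>j\<le>N - m. g j * X (i + j) (?h (N - m - j)) t) t
        = (\<Sum>j\<le>N - m. p m * g j * X (i + j) (current (e * int m) (?h (N - m - j))) t
        + p m * \<kappa> m * g j * X (i + (m + j)) (?h (N - (m + j))) t)"
        by (simp add: sum_distrib_left distrib_left mult_ac add_ac)
    qed
    also have "\<dots> = (\<Sum>m=1..N. \<Sum>j\<le>N - m. p m * g j * X (i + j) (current (e * int m) (?h (N - m - j))) t)
      + (\<Sum>m=1..N. \<Sum>j\<le>N - m. p m * \<kappa> m * g j * X (i + (m + j)) (?h (N - (m + j))) t)"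
      by (simp add: sum.distrib)
    also have "(\<Sum>m=1..N. \<Sum>j\<le>N - m. p m * g j * X (i + j) (current (e * int m) (?h (N - m - j))) t)
      = (\<Sum>j\<le>N. \<Sum>m=1..N - j. p m * g j * X (i + j) (current (e * int m) (?h (N - m - j))) t)"
      by (rule sum_triangle(1))
    also have "\<dots> = (\<Sum>j\<le>N. of_nat (N - j) * (g j * X (i + j) (?h (N - j)) t))"
    proof (rule sum.cong[OF refl])
      fix j
      have "(\<Sum>m=1..N - j. p m * X (i + j) (current (e * int m) (?h (N - j - m))) t)
        = X (i + j) (\<lambda>t. \<Sum>m=1..N - j. p m * current (e * int m) (?h (N - j - m)) t) t"
        by (rule rowfin_lin[OF X, symmetric])
      also have "\<dots> = of_nat (N - j) * X (i + j) (?h (N - j)) t"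
        unfolding hexp_rec[symmetric] by (rule rowfin_scale[OF X])
      finally have "g j * (\<Sum>m=1..N - j. p m * X (i + j) (current (e * int m) (?h (N - j - m))) t)
        = g j * (of_nat (N - j) * X (i + j) (?h (N - j)) t)" by simp
      then show "(\<Sum>m=1..N - j. p m * g j * X (i + j) (current (e * int m) (?h (N - m - j))) t)
        = of_nat (N - j) * (g j * X (i + j) (?h (N - j)) t)"
        unfolding sum_distrib_left by (simp only: diff_commute[of N j] mult_ac)
    qed
    also have "(\<Sum>m=1..N. \<Sum>j\<le>N - m. p m * \<kappa> m * g j * X (i + (m + j)) (?h (N - (m + j))) t)
      = (\<Sum>l\<le>N. \<Sum>m=1..l. p m * \<kappa> m * g (l - m) * X (i + (m + (l - m))) (?h (N - (m + (l - m)))) t)"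
      by (rule sum_triangle(2))
    also have "\<dots> = (\<Sum>l\<le>N. (\<Sum>m=1..l. p m * \<kappa> m * g (l - m)) * X (i + l) (?h (N - l)) t)"
      by (simp add: sum_distrib_right)
    also have "\<dots> = (\<Sum>l\<le>N. of_nat l * (g l * X (i + l) (?h (N - l)) t))"
      unfolding g[symmetric] by (simp add: mult_ac)
    finally have "of_nat N * hexp e p N (X i v) t
      = (\<Sum>j\<le>N. of_nat (N - j) * (g j * X (i + j) (?h (N - j)) t) + of_nat j * (g j * X (i + j) (?h (N - j)) t))"
      by (simp add: sum.distrib)
    also have "\<dots> = (\<Sum>j\<le>N. of_nat N * (g j * X (i + j) (?h (N - j)) t))"
      by (intro sum.cong refl) (simp add: of_nat_diff algebra_simps)
    finally show ?thesis using False by (simp flip: sum_distrib_left)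
  qed
qed

lemma rowfin_finite_sum:
  assumes "finite I" "\<And>i. i \<in> I \<Longrightarrow> rowfin (G i)"
  shows "rowfin (\<lambda>v t. \<Sum>i\<in>I. G i v t)"
proof (rule rowfin_sumI[of G _ "\<lambda>_ _. 1"])
  fix t show "\<exists>J. finite J \<and> (\<forall>i\<in>J. rowfin (G i)) \<and> (\<forall>v. (\<Sum>i\<in>I. G i v t) = (\<Sum>i\<in>J. 1 * G i v t))"
    using assms by (intro exI[of _ I]) simp
qed

text \<open>Constant family with \<open>\<kappa> = 0\<close>: only \<open>g 0\<close>
  survives.\<close>

lemma hexp_current:
  assumes "e \<noteq> 0" "1 \<le> l"
  shows "hexp e p N (current (e * int l) v) t = current (e * int l) (hexp e p N v) t"
proof -
  have "e * int l + e * int m \<noteq> 0" if "1 \<le> m" for m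
    using assms that by (simp flip: distrib_left)
  then have comm: "current (e * int m) (current (e * int l) v) t = current (e * int l) (current (e * int m) v) t"
    if "1 \<le> m" for m v t
    using assms that by (intro current_commute) auto
  have "hexp e p N (current (e * int l) v) t
    = (\<Sum>j\<le>N. (if j = 0 then 1 else 0) * current (e * int l) (hexp e p (N - j) v) t)"
    by (intro hexp_intertwine[where X="\<lambda>_. current (e * int l)" and \<kappa>="\<lambda>_. 0" and i=0])
       (auto simp: comm)
  then show ?thesis by (simp add: if_distrib[of "\<lambda>x. x * _"] cong: if_cong)
qed

text \<open>The degree acts as a derivation on the product, so the left side satisfies the Newton
  recursion that defines the right side.\<close>

lemma hexp_semigroup:
  assumes "e \<noteq> 0"
  shows "(\<Sum>i\<le>N. hexp e p i (hexp e p' (N - i) v) t) = hexp e (\<lambda>k. p k + p' k) N v t"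
proof (induction N arbitrary: t rule: less_induct)
  case (less N)
  let ?q = "\<lambda>k. p k + p' k" and ?h = "hexp e p" and ?h' = "hexp e p'"
  show ?case
  proof (cases "N = 0")
    case False
    have "of_nat N * (\<Sum>i\<le>N. ?h i (?h' (N - i) v) t)
      = (\<Sum>i\<le>N. of_nat i * ?h i (?h' (N - i) v) t) + (\<Sum>i\<le>N. of_nat (N - i) * ?h i (?h' (N - i) v) t)"
      by (simp add: sum_distrib_left flip: sum.distrib)
         (intro sum.cong refl, simp add: of_nat_diff algebra_simps)
    also have "(\<Sum>i\<le>N. of_nat i * ?h i (?h' (N - i) v) t)
      = (\<Sum>i\<le>N. \<Sum>m=1..i. p m * current (e * int m) (?h (i - m) (?h' (N - (m + (i - m))) v)) t)"
      by (simp add: hexp_rec)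
    also have "\<dots> = (\<Sum>m=1..N. \<Sum>j\<le>N - m. p m * current (e * int m) (?h j (?h' (N - (m + j)) v)) t)"
      by (rule sum_triangle(2)[symmetric])
    also have "(\<Sum>i\<le>N. of_nat (N - i) * ?h i (?h' (N - i) v) t)
      = (\<Sum>i\<le>N. \<Sum>m=1..N - i. p' m * current (e * int m) (?h i (?h' (N - i - m) v)) t)"
    proof (intro sum.cong refl)
      fix i
      have "of_nat (N - i) * ?h i (?h' (N - i) v) t = ?h i (\<lambda>t. of_nat (N - i) * ?h' (N - i) v t) t"
        by (rule rowfin_scale[symmetric]) simp
      also have "\<dots> = (\<Sum>m=1..N - i. p' m * ?h i (current (e * int m) (?h' (N - i - m) v)) t)"
        unfolding hexp_rec by (rule rowfin_lin) simp
      finally show "of_nat (N - i) * ?h i (?h' (N - i) v) t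
        = (\<Sum>m=1..N - i. p' m * current (e * int m) (?h i (?h' (N - i - m) v)) t)"
        by (simp add: hexp_current[OF assms])
    qed
    also have "\<dots> = (\<Sum>m=1..N. \<Sum>j\<le>N - m. p' m * current (e * int m) (?h j (?h' (N - (m + j)) v)) t)"
      by (subst sum_triangle(1)[symmetric]) (simp add: add.commute)
    also have "(\<Sum>m=1..N. \<Sum>j\<le>N - m. p m * current (e * int m) (?h j (?h' (N - (m + j)) v)) t)
        + (\<Sum>m=1..N. \<Sum>j\<le>N - m. p' m * current (e * int m) (?h j (?h' (N - (m + j)) v)) t)
      = (\<Sum>m=1..N. ?q m * (\<Sum>j\<le>N - m. current (e * int m) (?h j (?h' (N - m - j) v)) t))"
      by (simp add: sum_distrib_left distrib_right sum.distrib)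
    also have "\<dots> = (\<Sum>m=1..N. ?q m * current (e * int m) (hexp e ?q (N - m) v) t)"
    proof (intro sum.cong refl arg_cong2[where f="(*)"])
      fix m assume m: "m \<in> {1..N}"
      have "(\<lambda>t. \<Sum>j\<le>N - m. ?h j (?h' (N - m - j) v) t) = hexp e ?q (N - m) v"
        using less.IH[of "N - m"] m False by auto
      then show "(\<Sum>j\<le>N - m. current (e * int m) (?h j (?h' (N - m - j) v)) t)
        = current (e * int m) (hexp e ?q (N - m) v) t"
        by (subst rowfin_sum[symmetric]) auto
    qed
    finally show ?thesis using False unfolding hexp_rec[symmetric] by simp
  qed simp
qed

section \<open>Transposes, limits and complex conjugates of the components\<close>

lemma create_ket: "create x (ket s) t = annih x (ket t) s"
proof (cases "x \<in> occ t \<and> x \<notin> occ s \<and> del x t = s")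
  case True then show ?thesis by (auto simp: create_def annih_def ket_def fsign_remove)
next
  case False
  then have "create x (ket s) t = 0" "annih x (ket t) s = 0" by (auto simp: create_def annih_def ket_def)
  then show ?thesis by simp
qed

text \<open>Adjoints are transposes for the bilinear pairing, without complex conjugation, so
  scalars such as \<open>q\<close> stay unchanged.\<close>

lemma adjoint_cmp:
  assumes "rowfin F" "rowfin G'"
    and F: "\<And>u t. F (ket u) t = F' (ket t) u" and G: "\<And>u s. G (ket s) u = G' (ket u) s"
  shows "F (G (ket s)) t = G' (F' (ket t)) s"
proof -
  have "((\<lambda>u. F (ket u) t * G (ket s) u) has_sum F (G (ket s)) t) UNIV"
    by (rule rowfin_ket_has_sum[OF assms(1)])
  moreover have "((\<lambda>u. F (ket u) t * G (ket s) u) has_sum G' (F' (ket t)) s) UNIV"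
    using rowfin_ket_has_sum[OF assms(2), of s "F' (ket t)"] by (simp add: F G mult.commute)
  ultimately show ?thesis by (rule has_sum_unique)
qed

text \<open>Transposition swaps the two positions of a move and keeps the annihilator on the left,
  so no scalar appears; renaming the annihilated position shifts the weight.\<close>

lemma hop_adjoint: "hop w k (ket s) t = hop (\<lambda>x. w (x - k)) (- k) (ket t) s"
proof -
  have "annih x (create y (ket s)) t = annih y (create x (ket t)) s" for x y
    by (rule adjoint_cmp) (simp_all add: create_ket)
  then have "hop w k (ket s) t = (\<Sum>\<^sub>\<infinity>x. - w x * annih (x + k) (create x (ket t)) s)"
    by (simp add: hop_def)
  also have "\<dots> = hop (\<lambda>x. w (x - k)) (- k) (ket t) s"
    unfolding hop_def by (rule infsum_reindex_bij_witness[of _ "\<lambda>x. x - k" "\<lambda>x. x + k"]) auto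
  finally show ?thesis .
qed

text \<open>Transposing the recursion puts the current on the far side; it returns because
  \<open>hexp\<close> commutes with currents of its own sign.\<close>

lemma hexp_adjoint:
  assumes "e \<noteq> 0"
  shows "hexp e p N (ket s) t = hexp (- e) p N (ket t) s"
proof (induction N arbitrary: s t rule: less_induct)
  case (less N)
  show ?case
  proof (cases "N = 0")
    case False
    have "of_nat N * hexp e p N (ket s) t = (\<Sum>m=1..N. p m * hexp (- e) p (N - m) (current (- (e * int m)) (ket t)) s)"
      unfolding hexp_rec
    proof (intro sum.cong refl arg_cong2[where f="(*)"])
      fix m assume m: "m \<in> {1..N}"
      show "current (e * int m) (hexp e p (N - m) (ket s)) t
        = hexp (- e) p (N - m) (current (- (e * int m)) (ket t)) s"
      proof (rule adjoint_cmp[of "current (e * int m)" "hexp (- e) p (N - m)"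
            "current (- (e * int m))" "hexp e p (N - m)"])
        show "current (e * int m) (ket u) t = current (- (e * int m)) (ket t) u" for u t
          by (rule hop_adjoint)
        show "hexp e p (N - m) (ket s) u = hexp (- e) p (N - m) (ket u) s" for u s
          by (rule less.IH) (use m in auto)
      qed simp_all
    qed
    also have "\<dots> = of_nat N * hexp (- e) p N (ket t) s"
      unfolding hexp_rec
      by (intro sum.cong refl arg_cong2[where f="(*)"])
         (use hexp_current[of "- e" _ p _ "ket t" s] assms in auto)
    finally show ?thesis using False by simp
  qed (simp add: ket_def)
qed

lemma rowfin_tendsto:
  assumes "rowfin F" "\<And>u. (\<lambda>n. v n u) \<longlonglongrightarrow> v' u"
  shows "(\<lambda>n. F (v n) t) \<longlonglongrightarrow> F v' t"
proof -
  have "(\<lambda>n. \<Sum>u | F (ket u) t \<noteq> 0. F (ket u) t * v n u)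
      \<longlonglongrightarrow> (\<Sum>u | F (ket u) t \<noteq> 0. F (ket u) t * v' u)"
    by (intro tendsto_intros assms)
  then show ?thesis unfolding rowfin_ket(2)[OF assms(1), symmetric] .
qed

text \<open>The component of degree \<open>N\<close> is a polynomial in the first \<open>N\<close>
  parameters. This is what evaluates the infinite products at the limits of the power sums.\<close>

lemma hexp_tendsto:
  assumes "\<And>k. 1 \<le> k \<Longrightarrow> (\<lambda>n. p n k) \<longlonglongrightarrow> p' k"
  shows "(\<lambda>n. hexp e (p n) N v t) \<longlonglongrightarrow> hexp e p' N v t"
proof (induction N arbitrary: t rule: less_induct)
  case (less N)
  show ?case
  proof (cases N)
    case (Suc M)
    have "(\<lambda>n. current k (hexp e (p n) (M - m) v) t) \<longlonglongrightarrow> current k (hexp e p' (M - m) v) t" for k m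
      by (rule rowfin_tendsto[of "current k"]) (auto intro: less simp: Suc)
    then have "(\<lambda>n. (\<Sum>m\<le>M. p n (Suc m) * current (e * int (Suc m)) (hexp e (p n) (M - m) v) t) / of_nat (Suc M))
      \<longlonglongrightarrow> (\<Sum>m\<le>M. p' (Suc m) * current (e * int (Suc m)) (hexp e p' (M - m) v) t) / of_nat (Suc M)"
      by (intro tendsto_divide tendsto_sum tendsto_mult tendsto_const assms) (simp_all del: of_nat_Suc)
    then show ?thesis by (simp add: Suc del: of_nat_Suc)
  qed simp
qed

lemma cnj_hop: "cnj (hop w k v t) = hop (\<lambda>x. cnj (w x)) k (\<lambda>t. cnj (v t)) t"
proof -
  have "cnj (annih x (create y v) t) = annih x (create y (\<lambda>t. cnj (v t))) t" for x y
    by (simp add: annih_def create_def fsign_def)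
  then show ?thesis by (simp add: hop_def flip: infsum_cnj)
qed

text \<open>Together with \<open>hexp_adjoint\<close> this gives Hermitian adjoints, from which the
  norm estimate starts.\<close>

lemma cnj_hexp: "cnj (hexp e p N v t) = hexp e (\<lambda>k. cnj (p k)) N (\<lambda>t. cnj (v t)) t"
proof (induction N arbitrary: t rule: less_induct)
  case (less N)
  show ?case
  proof (cases N)
    case (Suc M)
    have "cnj (current k (hexp e p (M - m) v) t)
      = current k (hexp e (\<lambda>k. cnj (p k)) (M - m) (\<lambda>t. cnj (v t))) t" for k m
      using less[of "M - m"] by (simp add: cnj_hop Suc)
    then show ?thesis by (simp add: Suc)
  qed simp
qed

lemma cnj_ket: "(\<lambda>t. cnj (ket s t)) = ket s"
  by (auto simp: ket_def)

section \<open>Matrices of graded families\<close>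

definition homogeneous :: "int \<Rightarrow> (nat \<Rightarrow> fock \<Rightarrow> fock) \<Rightarrow> bool" where
  "homogeneous e F \<longleftrightarrow> (\<forall>N. rowfin (F N)) \<and>
    (\<forall>N s t. F N (ket s) t \<noteq> 0 \<longrightarrow> en s = en t + e * int N)"

text \<open>At most one summand is nonzero: the degree is fixed by the energies of \<open>t\<close> and \<open>s\<close>.\<close>

definition graded :: "(nat \<Rightarrow> fock \<Rightarrow> fock) \<Rightarrow> maya_state \<Rightarrow> maya_state \<Rightarrow> complex" where
  "graded F t s = (\<Sum>\<^sub>\<infinity>N. F N (ket s) t)"

lemma graded_eq:
  assumes "homogeneous e F" "e \<noteq> 0" "en s = en t + e * int N"
  shows "graded F t s = F N (ket s) t"
proof -
  have "F M (ket s) t = 0" if "M \<noteq> N" for M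
    using assms that unfolding homogeneous_def by fastforce
  then show ?thesis unfolding graded_def by (subst infsum_cong_neutral[where T="{N}" and g="\<lambda>N. F N (ket s) t"]) auto
qed

lemma graded_zero:
  assumes "homogeneous e F" "\<And>N. en s \<noteq> en t + e * int N"
  shows "graded F t s = 0"
  using assms unfolding graded_def homogeneous_def by (metis infsum_0)

lemma graded_cmp_terms:
  assumes "homogeneous e F" "homogeneous e K" "e \<noteq> 0" "en s = en t + e * int N"
  shows "graded F t u * graded K u s = (\<Sum>i\<le>N. F i (ket u) t * K (N - i) (ket s) u)"
proof (cases "\<exists>i j. en u = en t + e * int i \<and> en s = en u + e * int j")
  case True
  then obtain i j where ij: "en u = en t + e * int i" "en s = en u + e * int j" by blast
  then have "e * int N = e * int (i + j)" using assms(4) by (simp add: distrib_left)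
  then have N: "N = i + j" using assms(3) by simp
  have z: "F k (ket u) t = 0" if "k \<noteq> i" for k
    using that ij assms(1,3) unfolding homogeneous_def by fastforce
  have "(\<Sum>i\<le>N. F i (ket u) t * K (N - i) (ket s) u) = (\<Sum>k\<in>{i}. F k (ket u) t * K (N - k) (ket s) u)"
    by (rule sum.mono_neutral_right) (use z N in auto)
  then show ?thesis
    using graded_eq[OF assms(1,3) ij(1)] graded_eq[OF assms(2,3) ij(2)] N by simp
next
  case False
  then have "graded F t u = 0 \<or> graded K u s = 0"
    using graded_zero[OF assms(1), of u t] graded_zero[OF assms(2), of s u] by metis
  moreover have "F i (ket u) t * K (N - i) (ket s) u = 0" for i
    using False assms(1,2) unfolding homogeneous_def by fastforce
  then have "(\<Sum>i\<le>N. F i (ket u) t * K (N - i) (ket s) u) = 0" by (intro sum.neutral) blast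
  ultimately show ?thesis by auto
qed

text \<open>Energies fix the total degree between \<open>t\<close> and \<open>s\<close>, so the sum
  over \<open>u\<close> is the matrix product inside the single component of that degree, a
  row-finite operator.\<close>

lemma graded_cmp:
  assumes "homogeneous e F" "homogeneous e K" "e \<noteq> 0"
  defines "FK \<equiv> \<lambda>N v t. \<Sum>i\<le>N. F i (K (N - i) v) t"
  shows "((\<lambda>u. graded F t u * graded K u s) has_sum graded FK t s) UNIV" and "homogeneous e FK"
proof -
  have rf: "rowfin (F N)" "rowfin (K N)" for N using assms by (auto simp: homogeneous_def)
  have rfFK: "rowfin (FK N)" for N
    unfolding FK_def by (rule rowfin_finite_sum) (simp_all add: rowfin_cmp[OF rf(1) rf(2)])
  have hs: "((\<lambda>u. \<Sum>i\<le>N. F i (ket u) t * K (N - i) (ket s) u) has_sum FK N (ket s) t) UNIV" for N t s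
    unfolding FK_def by (rule has_sum_finite_sum) (auto intro: rowfin_ket_has_sum[OF rf(1)])
  have van: "F i (ket u) t * K (N - i) (ket s) u = 0" if "i \<le> N" "en s \<noteq> en t + e * int N" for i N u t s
  proof (rule ccontr)
    assume "F i (ket u) t * K (N - i) (ket s) u \<noteq> 0"
    then have "en u = en t + e * int i" "en s = en u + e * int (N - i)"
      using assms(1,2) unfolding homogeneous_def by auto
    then show False using that by (simp add: of_nat_diff algebra_simps)
  qed
  show hFK: "homogeneous e FK"
    unfolding homogeneous_def
  proof (intro conjI allI impI rfFK)
    fix N s t assume nz: "FK N (ket s) t \<noteq> 0"
    show "en s = en t + e * int N"
    proof (rule ccontr)
      assume "en s \<noteq> en t + e * int N"
      then have "(\<Sum>i\<le>N. F i (ket u) t * K (N - i) (ket s) u) = 0" for u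
        by (intro sum.neutral ballI van) auto
      then have "((\<lambda>_. 0) has_sum FK N (ket s) t) (UNIV :: maya_state set)" using hs[where N=N and t=t and s=s] by simp
      then show False using nz has_sum_unique[OF has_sum_0_simp] by metis
    qed
  qed
  show "((\<lambda>u. graded F t u * graded K u s) has_sum graded FK t s) UNIV"
  proof (cases "\<exists>N. en s = en t + e * int N")
    case True
    then obtain N where N: "en s = en t + e * int N" by blast
    show ?thesis
      unfolding graded_eq[OF hFK assms(3) N] graded_cmp_terms[OF assms(1-3) N] by (rule hs)
  next
    case False
    have "graded F t u * graded K u s = 0" for u
    proof (rule ccontr)
      assume "graded F t u * graded K u s \<noteq> 0"
      then obtain i j where "en u = en t + e * int i" "en s = en u + e * int j"
        using graded_zero[OF assms(1), of u t] graded_zero[OF assms(2), of s u] by (metis mult_zero_left mult_zero_right)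
      then have "en s = en t + e * int (i + j)" by (simp add: algebra_simps)
      then show False using False by blast
    qed
    moreover have "graded FK t s = 0" by (rule graded_zero[OF hFK]) (use False in blast)
    ultimately show ?thesis by (simp only: has_sum_0_simp)
  qed
qed

text \<open>The matrix of exp (sum_m p_m / m J_(e m)), with \<open>p\<close> in the role of power
  sums: \<open>e = 1\<close> gives Gamma_+ and \<open>e = -1\<close> gives Gamma_-.\<close>

definition vertex :: "int \<Rightarrow> (nat \<Rightarrow> complex) \<Rightarrow> maya_state \<Rightarrow> maya_state \<Rightarrow> complex" where
  "vertex e p = graded (hexp e p)"

lemma hexp_ket_zero:
  assumes "en s \<noteq> en t + e * int N \<or> ch s \<noteq> ch t"
  shows "hexp e p N (ket s) t = 0"
proof -
  have "hexp e p N (ket s) t = hexp e p N (\<lambda>_. 0) t"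
    by (rule hexp_local) (use assms in \<open>auto simp: ket_def\<close>)
  then show ?thesis by (simp add: rowfin_zero)
qed

lemma homogeneous_hexp: "homogeneous e (hexp e p)"
  unfolding homogeneous_def using hexp_ket_zero by (metis rowfin_hexp)

lemma vertex_eq: "e \<noteq> 0 \<Longrightarrow> en s = en t + e * int N \<Longrightarrow> vertex e p t s = hexp e p N (ket s) t"
  unfolding vertex_def by (rule graded_eq[OF homogeneous_hexp])

lemma vertex_zero_en: "(\<And>N. en s \<noteq> en t + e * int N) \<Longrightarrow> vertex e p t s = 0"
  unfolding vertex_def by (rule graded_zero[OF homogeneous_hexp])

lemma vertex_zero_ch: "ch s \<noteq> ch t \<Longrightarrow> vertex e p t s = 0"
  by (simp add: vertex_def graded_def hexp_ket_zero)

lemma vertex_semigroup: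
  assumes "e \<noteq> 0"
  shows "((\<lambda>u. vertex e p t u * vertex e p' u s) has_sum vertex e (\<lambda>k. p k + p' k) t s) UNIV"
  using graded_cmp(1)[OF homogeneous_hexp homogeneous_hexp assms, of p t p' s]
  unfolding vertex_def by (simp add: hexp_semigroup[OF assms] graded_def)

lemma vertex_adjoint: "e \<noteq> 0 \<Longrightarrow> vertex e p t s = vertex (- e) p s t"
  unfolding vertex_def graded_def by (rule infsum_cong) (rule hexp_adjoint)

lemma vertex_cong:
  assumes "\<And>k. 1 \<le> k \<Longrightarrow> p k = p' k"
  shows "vertex e p = vertex e p'"
proof -
  have "hexp e p N v t = hexp e p' N v t" for N v t
  proof (induction N arbitrary: t rule: less_induct)
    case (less N)
    show ?case
    proof (cases N)
      case (Suc M)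
      have "hexp e p (M - m) v = hexp e p' (M - m) v" for m using less Suc by auto
      then show ?thesis using assms by (simp add: Suc)
    qed simp
  qed
  then show ?thesis by (intro ext) (simp add: vertex_def graded_def)
qed

lemma vertex_tendsto:
  assumes "e \<noteq> 0" "\<And>k. 1 \<le> k \<Longrightarrow> (\<lambda>n. p n k) \<longlonglongrightarrow> p' k"
  shows "(\<lambda>n. vertex e (p n) t s) \<longlonglongrightarrow> vertex e p' t s"
proof (cases "\<exists>N. en s = en t + e * int N")
  case True
  then obtain N where N: "en s = en t + e * int N" by blast
  show ?thesis unfolding vertex_eq[OF assms(1) N] by (rule hexp_tendsto[OF assms(2)])
next
  case False
  then have "vertex e p t s = 0" for p by (intro vertex_zero_en) blast
  then show ?thesis by simp
qed

lemma vertex_id: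
  assumes "e \<noteq> 0"
  shows "vertex e (\<lambda>_. 0) t s = (if t = s then 1 else 0)"
proof -
  have 0: "hexp e (\<lambda>_. 0) N v t = 0" if "0 < N" for N v t
    using hexp_rec[of N e "\<lambda>_. 0" v t] that by simp
  show ?thesis
  proof (cases "\<exists>N. en s = en t + e * int N")
    case True
    then obtain N where N: "en s = en t + e * int N" by blast
    show ?thesis
    proof (cases "N = 0")
      case True
      then show ?thesis unfolding vertex_eq[OF assms N] by (simp add: ket_def)
    next
      case False
      then have "t \<noteq> s" using N assms by auto
      then show ?thesis unfolding vertex_eq[OF assms N] using 0[of N "ket s" t] False by simp
    qed
  next
    case False
    then have "t \<noteq> s" by (metis add.right_neutral mult_zero_right of_nat_0)
    moreover have "vertex e (\<lambda>_. 0) t s = 0" by (rule vertex_zero_en) (use False in blast)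
    ultimately show ?thesis by simp
  qed
qed

section \<open>Matrix elements of the given operators\<close>

lemma compose_occ: "compose A B (occ t) (occ s) = (\<Sum>\<^sub>\<infinity>u. A (occ t) (occ u) * B (occ u) (occ s))"
  unfolding compose_def
  by (rule infsum_reindex_bij_betw[OF bij_occ, of "\<lambda>U. A (occ t) U * B U (occ s)", symmetric])

lemma psi_occ: "psi m (occ t) (occ s) = create m (ket s) t"
proof (cases "m \<in> occ t \<and> del m t = s")
  case True
  then have "t = ins m s" "m \<notin> occ s" by auto
  then show ?thesis by (auto simp: psi_def create_def ket_def fsign_insert)
next
  case False
  then have "\<not> (m \<notin> occ s \<and> occ t = insert m (occ s))"
    by (metis del_ins insertI1 occ_ins maya_state_eqI)
  then show ?thesis using False by (auto simp: psi_def create_def ket_def)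
qed

lemma psis_occ: "psis n (occ t) (occ s) = annih (- n) (ket s) t"
proof (cases "- n \<notin> occ t \<and> ins (- n) t = s")
  case True
  then have s: "s = ins (- n) t" and n: "- n \<notin> occ t" by auto
  show ?thesis unfolding s using n by (simp add: psis_def annih_def ket_def fsign_insert)
next
  case False
  have "\<not> (- n \<in> occ s \<and> occ t = occ s - {- n})"
  proof
    assume A: "- n \<in> occ s \<and> occ t = occ s - {- n}"
    then have "t = del (- n) s" by (intro maya_state_eqI) simp
    then show False using False A by simp
  qed
  then show ?thesis using False by (auto simp: psis_def annih_def ket_def)
qed

definition vac_state :: "int \<Rightarrow> maya_state" where "vac_state s = mk_maya_state (vac s)"

lemma occ_vac_state [simp]: "occ (vac_state s) = {- s..}"
proof -
  have "maya {- s..}" unfolding maya_def by (intro conjI exI[of _ "- s"]) auto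
  then show ?thesis by (simp add: vac_state_def vac_def occ_mk_maya_state)
qed

lemma vac_eq_occ: "vac s = occ (vac_state s)"
  by (simp add: vac_def)

lemma compose_psi_psis: "compose (psi m) (psis n) (occ t) (occ s) = create m (annih (- n) (ket s)) t"
  unfolding compose_occ psi_occ psis_occ by (rule infsumI, rule rowfin_ket_has_sum) simp

lemma nord_occ:
  "nord m n (occ t) (occ s) = create m (annih (- n) (ket s)) t
    - (if t = s then create m (annih (- n) (ket (vac_state 0))) (vac_state 0) else 0)"
  unfolding nord_def vac_eq_occ compose_psi_psis by (simp add: occ_inject)

text \<open>A nonzero shift makes the two fermions anticommute and the vacuum expectation vanish, so
  hole ordering costs exactly the sign built into \<open>hop\<close>.\<close>

lemma Jop_occ:
  assumes "k \<noteq> 0" shows "Jop k (occ t) (occ s) = current k (ket s) t"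
proof -
  have z: "annih x (create (x + k) (ket u)) u = 0" for x u
  proof -
    have "del (x + k) (ins x u) \<noteq> u" if "x \<notin> occ u" using that assms
      by (metis DiffI add.right_neutral add_left_cancel insertI1 occ_del occ_ins singletonD)
    then show ?thesis by (auto simp: annih_def create_def ket_def)
  qed
  have "nord (- n) (n + k) (occ t) (occ s) = - annih (- n - k) (create (- n - k + k) (ket s)) t" for n
    using assms z[of "- n - k" "vac_state 0"] by (auto simp: nord_occ create_annih)
  then have "Jop k (occ t) (occ s) = (\<Sum>\<^sub>\<infinity>n. - annih (- n - k) (create (- n - k + k) (ket s)) t)"
    by (simp add: Jop_def)
  also have "\<dots> = current k (ket s) t"
    unfolding hop_def by (rule infsum_reindex_bij_witness[of _ "\<lambda>x. - x - k" "\<lambda>n. - n - k"]) auto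
  finally show ?thesis .
qed

text \<open>Normal ordering subtracts 1 at every position occupied in \<open>vac 0\<close>, that is
  from 0 on; particles below 0 and holes at or above 0 are what remains.\<close>

lemma diag_occ:
  "(\<Sum>\<^sub>\<infinity>n. of_int (f n) * nord (- n) n (occ t) (occ t)) = of_int (mom (\<lambda>a. f (- a)) t)"
proof -
  let ?g = "\<lambda>n. of_int (f n) * nord (- n) n (occ t) (occ t)"
  let ?A = "{a. a \<in> occ t \<and> a < 0}" and ?B = "{a. a \<notin> occ t \<and> 0 \<le> a}"
  have g: "nord a (- a) (occ t) (occ t) = (if a \<in> occ t then 1 else 0) - (if 0 \<le> a then 1 else 0)" for a
    by (auto simp: nord_occ create_annih_same ket_def)
  have "(\<Sum>\<^sub>\<infinity>n. ?g n) = (\<Sum>\<^sub>\<infinity>a. ?g (- a))"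
    by (rule infsum_reindex_bij_witness[of _ uminus uminus]) auto
  also have "\<dots> = (\<Sum>a\<in>?A \<union> ?B. ?g (- a))"
    by (rule infsumI, rule has_sum_finite_neutralI)
       (auto simp: g finite_occ_less finite_holes_ge simp del: of_int_of_nat_eq)
  also have "\<dots> = (\<Sum>a\<in>?A. ?g (- a)) + (\<Sum>a\<in>?B. ?g (- a))"
    by (rule sum.union_disjoint) (auto simp: finite_occ_less finite_holes_ge)
  also have "(\<Sum>a\<in>?A. ?g (- a)) = (\<Sum>a\<in>?A. of_int (f (- a)))"
    by (rule sum.cong) (auto simp: g)
  also have "(\<Sum>a\<in>?B. ?g (- a)) = (\<Sum>a\<in>?B. - of_int (f (- a)))"
    by (rule sum.cong) (auto simp: g)
  finally show ?thesis by (simp add: mom_def sum_negf)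
qed

lemma powdiag_occ:
  assumes "A (occ t) (occ t) = of_int w"
  shows "powdiag c A (occ t) (occ s) = (if t = s then c powi w else 0)"
proof -
  have "(THE w'. A (occ t) (occ t) = of_int w') = w" using assms by (intro the_equality) auto
  then show ?thesis by (auto simp: powdiag_def occ_inject)
qed

lemma powdiag_L0_occ: "powdiag c L0 (occ t) (occ s) = (if t = s then c powi en t else 0)"
proof (rule powdiag_occ)
  show "L0 (occ t) (occ t) = of_int (en t)" unfolding L0_def using diag_occ[of "\<lambda>n. n" t] by simp
qed

abbreviation quad :: "maya_state \<Rightarrow> int" where "quad \<equiv> mom (\<lambda>a. a ^ 2)"

lemma powdiag_W0_occ: "powdiag c W0 (occ t) (occ s) = (if t = s then c powi quad t else 0)"
proof (rule powdiag_occ)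
  show "W0 (occ t) (occ t) = of_int (quad t)" unfolding W0_def using diag_occ[of "\<lambda>n. n ^ 2" t] by simp
qed

lemma compose_diag_left:
  assumes "\<And>t s. A (occ t) (occ s) = (if t = s then a t else 0)"
  shows "compose A B (occ t) (occ s) = a t * B (occ t) (occ s)"
  unfolding compose_occ
  by (rule infsumI, rule has_sum_finite_neutralI[of "{t}"]) (auto simp: assms)

lemma compose_diag_right:
  assumes "\<And>t s. A (occ t) (occ s) = (if t = s then a t else 0)"
  shows "compose B A (occ t) (occ s) = B (occ t) (occ s) * a s"
  unfolding compose_occ
  by (rule infsumI, rule has_sum_finite_neutralI[of "{s}"]) (auto simp: assms)

section \<open>The operator exponential, degree by degree\<close>

lemma sum_triangle_swap:
  fixes f :: "nat \<Rightarrow> nat \<Rightarrow> 'a::comm_monoid_add"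
  shows "(\<Sum>k=1..N. \<Sum>l=1..N - k. f k l) = (\<Sum>l=1..N. \<Sum>k=1..N - l. f k l)"
proof -
  have "(\<Sum>(k, l)\<in>Sigma {1..N} (\<lambda>k. {1..N - k}). f k l) = (\<Sum>(l, k)\<in>Sigma {1..N} (\<lambda>l. {1..N - l}). f k l)"
    by (rule sum.reindex_bij_witness[of _ "\<lambda>(a, b). (b, a)" "\<lambda>(a, b). (b, a)"]) auto
  then show ?thesis by (simp add: sum.Sigma)
qed

text \<open>The degree \<open>N\<close> component of the n-th power of sum_k f_k J_(e k).\<close>

primrec pow_comp :: "int \<Rightarrow> (nat \<Rightarrow> complex) \<Rightarrow> nat \<Rightarrow> nat \<Rightarrow> fock \<Rightarrow> fock" where
  "pow_comp e f 0 = (\<lambda>N v t. if N = 0 then v t else 0)"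
| "pow_comp e f (Suc n) = (\<lambda>N v t. \<Sum>k=1..N. f k * current (e * int k) (pow_comp e f n (N - k) v) t)"

lemma rowfin_pow_comp [simp]: "rowfin (pow_comp e f n N)"
proof (induction n arbitrary: N)
  case 0
  show ?case by (rule rowfin_single[of _ "\<lambda>_. if N = 0 then 1 else 0" id]) simp
next
  case (Suc n)
  have "rowfin (\<lambda>v t. f k * current (e * int k) (pow_comp e f n (N - k) v) t)" for k
    by (rule rowfin_sumI[of "\<lambda>k v. current (e * int k) (pow_comp e f n (N - k) v)" _ "\<lambda>k t. f k"])
       (rule exI[of _ "{k}"], simp add: rowfin_cmp Suc)
  then show ?case by (simp add: rowfin_finite_sum)
qed

lemma pow_comp_zero: "N < n \<Longrightarrow> pow_comp e f n N v t = 0"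
proof (induction n arbitrary: N t)
  case (Suc n)
  have "pow_comp e f n (N - k) v = (\<lambda>_. 0)" if "k \<in> {1..N}" for k
    using Suc that by (intro ext Suc.IH) auto
  then show ?case by (simp add: rowfin_zero)
qed simp

text \<open>Euler's identity for the degree derivation, available because the currents of one sign commute.\<close>

lemma pow_comp_euler:
  assumes "e \<noteq> 0"
  shows "of_nat N * pow_comp e f (Suc n) N v t
    = of_nat (Suc n) * (\<Sum>k=1..N. of_nat k * f k * current (e * int k) (pow_comp e f n (N - k) v) t)"
proof (induction n arbitrary: N t)
  case 0
  have "of_nat N * (f k * current (e * int k) (pow_comp e f 0 (N - k) v) t)
    = of_nat k * f k * current (e * int k) (pow_comp e f 0 (N - k) v) t" if "k \<in> {1..N}" for k
    using that by (cases "k = N") (auto simp: rowfin_zero)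
  then show ?case unfolding pow_comp.simps(2) sum_distrib_left
    by (intro sum.cong refl) (simp del: pow_comp.simps)
next
  case (Suc n)
  let ?P = "pow_comp e f" and ?J = "\<lambda>k. current (e * int k)"
  have comm: "?J k (?J l u) t = ?J l (?J k u) t" if "1 \<le> k" "1 \<le> l" for k l u t
    using that assms by (intro current_commute) (auto simp flip: distrib_left)
  have "of_nat N * ?P (Suc (Suc n)) N v t
    = (\<Sum>k=1..N. of_nat k * f k * ?J k (?P (Suc n) (N - k) v) t + f k * (of_nat (N - k) * ?J k (?P (Suc n) (N - k) v) t))"
    unfolding pow_comp.simps(2)[of e f "Suc n"] sum_distrib_left
    by (intro sum.cong refl) (auto simp: of_nat_diff algebra_simps)
  also have "\<dots> = (\<Sum>k=1..N. of_nat k * f k * ?J k (?P (Suc n) (N - k) v) t)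
    + (\<Sum>k=1..N. f k * (of_nat (N - k) * ?J k (?P (Suc n) (N - k) v) t))" by (rule sum.distrib)
  also have "(\<Sum>k=1..N. f k * (of_nat (N - k) * ?J k (?P (Suc n) (N - k) v) t))
    = (\<Sum>k=1..N. \<Sum>l=1..N - k. of_nat (Suc n) * (f k * (of_nat l * f l * ?J l (?J k (?P n (N - l - k) v)) t)))"
  proof (intro sum.cong refl)
    fix k assume k: "k \<in> {1..N}"
    have "of_nat (N - k) * ?J k (?P (Suc n) (N - k) v) t = ?J k (\<lambda>t. of_nat (N - k) * ?P (Suc n) (N - k) v t) t"
      by (rule rowfin_scale[symmetric]) simp
    also have "\<dots> = ?J k (\<lambda>t. of_nat (Suc n) * (\<Sum>l=1..N - k. of_nat l * f l * ?J l (?P n (N - k - l) v) t)) t"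
      unfolding Suc.IH ..
    also have "\<dots> = of_nat (Suc n) * ?J k (\<lambda>t. \<Sum>l=1..N - k. of_nat l * f l * ?J l (?P n (N - k - l) v) t) t"
      by (rule rowfin_scale) simp
    also have "?J k (\<lambda>t. \<Sum>l=1..N - k. of_nat l * f l * ?J l (?P n (N - k - l) v) t) t
      = (\<Sum>l=1..N - k. of_nat l * f l * ?J k (?J l (?P n (N - k - l) v)) t)"
      by (rule rowfin_lin) simp
    also have "\<dots> = (\<Sum>l=1..N - k. of_nat l * f l * ?J l (?J k (?P n (N - l - k) v)) t)"
    proof (intro sum.cong refl)
      fix l assume "l \<in> {1..N - k}"
      then have "?J k (?J l (?P n (N - k - l) v)) t = ?J l (?J k (?P n (N - k - l) v)) t"
        using k by (intro comm) auto
      then show "of_nat l * f l * ?J k (?J l (?P n (N - k - l) v)) t = of_nat l * f l * ?J l (?J k (?P n (N - l - k) v)) t"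
        by (simp only: diff_commute[of N k l])
    qed
    finally show "f k * (of_nat (N - k) * ?J k (?P (Suc n) (N - k) v) t)
      = (\<Sum>l=1..N - k. of_nat (Suc n) * (f k * (of_nat l * f l * ?J l (?J k (?P n (N - l - k) v)) t)))"
      by (simp only: sum_distrib_left mult_ac)
  qed
  also have "\<dots> = (\<Sum>l=1..N. \<Sum>k=1..N - l. of_nat (Suc n) * (f k * (of_nat l * f l * ?J l (?J k (?P n (N - l - k) v)) t)))"
    by (rule sum_triangle_swap)
  also have "\<dots> = (\<Sum>l=1..N. of_nat (Suc n) * (of_nat l * f l * ?J l (?P (Suc n) (N - l) v) t))"
  proof (intro sum.cong refl)
    fix l
    have "?J l (?P (Suc n) (N - l) v) t = (\<Sum>k=1..N - l. f k * ?J l (?J k (?P n (N - l - k) v)) t)"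
      unfolding pow_comp.simps(2) by (rule rowfin_lin) simp
    then show "(\<Sum>k=1..N - l. of_nat (Suc n) * (f k * (of_nat l * f l * ?J l (?J k (?P n (N - l - k) v)) t)))
      = of_nat (Suc n) * (of_nat l * f l * ?J l (?P (Suc n) (N - l) v) t)"
      by (simp only: sum_distrib_left mult_ac)
  qed
  also have "\<dots> = of_nat (Suc n) * (\<Sum>l=1..N. of_nat l * f l * ?J l (?P (Suc n) (N - l) v) t)"
    by (rule sum_distrib_left[symmetric])
  finally show ?case by (simp only: of_nat_Suc distrib_right mult_1 add.commute)
qed

text \<open>Summing Euler's identity against 1 / n! shifts \<open>n\<close> by one and gives the
  Newton recursion with p_k = k f_k. Powers beyond the degree vanish, so every cut-off
  \<open>B \<ge> N\<close> gives the same value.\<close>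

lemma pow_comp_hexp:
  assumes "e \<noteq> 0" "N \<le> B"
  shows "(\<Sum>n\<le>B. pow_comp e f n N v t / fact n) = hexp e (\<lambda>k. of_nat k * f k) N v t"
  using assms(2)
proof (induction N arbitrary: t rule: less_induct)
  case (less N)
  let ?P = "pow_comp e f" and ?J = "\<lambda>k. current (e * int k)"
  show ?case
  proof (cases "N = 0")
    case True
    have "?P n 0 v t = (if n = 0 then v t else 0)" for n by (cases n) simp_all
    then have "(\<Sum>n\<le>B. ?P n 0 v t / fact n) = (\<Sum>n\<le>B. if n = 0 then v t else 0)"
      by (intro sum.cong) auto
    then show ?thesis using True by simp
  next
    case False
    then obtain C where C: "B = Suc C" using less.prems by (cases B) auto
    have "of_nat N * (\<Sum>n\<le>B. ?P n N v t / fact n) = (\<Sum>n\<le>C. of_nat N * ?P (Suc n) N v t / fact (Suc n))"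
      unfolding C sum.atMost_Suc_shift using False by (simp add: sum_distrib_left del: pow_comp.simps(2) fact_Suc)
    also have "\<dots> = (\<Sum>n\<le>C. \<Sum>k=1..N. of_nat k * f k * (1 / fact n * ?J k (?P n (N - k) v) t))"
    proof (intro sum.cong refl)
      fix n
      have "of_nat N * ?P (Suc n) N v t / fact (Suc n)
        = (\<Sum>k=1..N. of_nat k * f k * ?J k (?P n (N - k) v) t) / fact n"
        unfolding pow_comp_euler[OF assms(1)] by (simp del: of_nat_Suc)
      then show "of_nat N * ?P (Suc n) N v t / fact (Suc n)
        = (\<Sum>k=1..N. of_nat k * f k * (1 / fact n * ?J k (?P n (N - k) v) t))"
        by (simp add: sum_divide_distrib)
    qed
    also have "\<dots> = (\<Sum>k=1..N. \<Sum>n\<le>C. of_nat k * f k * (1 / fact n * ?J k (?P n (N - k) v) t))"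
      by (rule sum.swap)
    also have "\<dots> = (\<Sum>k=1..N. of_nat k * f k * ?J k (hexp e (\<lambda>k. of_nat k * f k) (N - k) v) t)"
    proof (intro sum.cong refl)
      fix k assume k: "k \<in> {1..N}"
      have "(\<lambda>t. \<Sum>n\<le>C. 1 / fact n * ?P n (N - k) v t) = hexp e (\<lambda>k. of_nat k * f k) (N - k) v"
      proof
        fix t
        have "(\<Sum>n\<le>B. ?P n (N - k) v t / fact n) = (\<Sum>n\<le>C. 1 / fact n * ?P n (N - k) v t)"
          unfolding C sum.atMost_Suc using k less.prems C by (subst pow_comp_zero) auto
        then show "(\<Sum>n\<le>C. 1 / fact n * ?P n (N - k) v t) = hexp e (\<lambda>k. of_nat k * f k) (N - k) v t"
          using less.IH[of "N - k" t] k less.prems False by simp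
      qed
      then have "?J k (hexp e (\<lambda>k. of_nat k * f k) (N - k) v) t
        = (\<Sum>n\<le>C. 1 / fact n * ?J k (?P n (N - k) v) t)"
        using rowfin_lin[of "?J k" "\<lambda>n. 1 / fact n" "\<lambda>n. ?P n (N - k) v" "{..C}" t] by simp
      then show "(\<Sum>n\<le>C. of_nat k * f k * (1 / fact n * ?J k (?P n (N - k) v) t))
        = of_nat k * f k * ?J k (hexp e (\<lambda>k. of_nat k * f k) (N - k) v) t"
        by (simp only: sum_distrib_left)
    qed
    also have "\<dots> = of_nat N * hexp e (\<lambda>k. of_nat k * f k) N v t" by (rule hexp_rec[symmetric])
    finally show ?thesis using False by simp
  qed
qed

lemma homogeneous_current:
  "homogeneous e (\<lambda>k v t. if k = 0 then 0 else f k * current (e * int k) v t)"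
  unfolding homogeneous_def
proof (intro conjI allI impI)
  fix N
  show "rowfin (\<lambda>v t. if N = 0 then 0 else f N * current (e * int N) v t)"
    by (rule rowfin_sumI[of "\<lambda>_. current (e * int N)" _ "\<lambda>_ _. if N = 0 then 0 else f N"])
       (rule exI[of _ "{0::nat}"], simp)
next
  fix N s t assume "(if N = 0 then 0 else f N * current (e * int N) (ket s) t) \<noteq> 0"
  then have "current (e * int N) (ket s) t \<noteq> 0" by (auto split: if_splits)
  moreover have "current (e * int N) (ket s) t = current (e * int N) (\<lambda>_. 0) t" if "en s \<noteq> en t + e * int N"
    by (rule hop_local) (use that in \<open>auto simp: ket_def\<close>)
  ultimately show "en s = en t + e * int N" by (auto simp: rowfin_zero)
qed

lemma op_pow_occ:
  assumes "e \<noteq> 0" and A: "\<And>t s. A (occ t) (occ s) = graded (\<lambda>k v t. if k = 0 then 0 else f k * current (e * int k) v t) t s"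
  shows "homogeneous e (pow_comp e f n)"
    and "op_pow A n (occ t) (occ s) = graded (pow_comp e f n) t s"
proof (induction n arbitrary: t s)
  case 0
  { case 1 show ?case unfolding homogeneous_def
    proof (intro conjI allI impI)
      fix N s t assume "pow_comp e f 0 N (ket s) t \<noteq> 0"
      then show "en s = en t + e * int N" by (auto simp: ket_def split: if_splits)
    qed (rule rowfin_pow_comp) }
  { case 2
    have "graded (pow_comp e f 0) t s = ket s t"
      unfolding graded_def
      by (rule infsumI, rule has_sum_finite_neutralI[of "{0}"]) auto
    then show ?case by (simp add: idop_def ket_def occ_inject) }
next
  case (Suc n)
  let ?F = "\<lambda>k v t. if k = 0 then 0 else f k * current (e * int k) v t"
  have eq: "(\<lambda>N v t. \<Sum>i\<le>N. ?F i (pow_comp e f n (N - i) v) t) = pow_comp e f (Suc n)"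
    unfolding pow_comp.simps by (intro ext sum.mono_neutral_cong_right) auto
  { case 1 show ?case using graded_cmp(2)[OF homogeneous_current Suc(1) assms(1), of f] unfolding eq . }
  { case 2 show ?case unfolding op_pow.simps compose_occ A Suc(2)
      using infsumI[OF graded_cmp(1)[OF homogeneous_current Suc(1) assms(1), of f t s]] unfolding eq . }
qed

text \<open>At most one degree connects \<open>t\<close> and \<open>s\<close>. In that degree the
  exponential series stops; if there is none, both sides vanish.\<close>

lemma Jexp_occ:
  assumes "e \<noteq> 0"
  shows "Jexp f e (occ t) (occ s) = vertex e (\<lambda>k. of_nat k * f k) t s"
proof -
  let ?A = "\<lambda>T S. \<Sum>\<^sub>\<infinity>k\<in>{1..}. f k * Jop (e * int k) T S"
  have A: "?A (occ t) (occ s) = graded (\<lambda>k v t. if k = 0 then 0 else f k * current (e * int k) v t) t s" for t s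
    unfolding graded_def by (rule infsum_cong_neutral) (auto simp: Jop_occ assms)
  note P = op_pow_occ[of e ?A f, OF assms A]
  have eq: "Jexp f e (occ t) (occ s) = (\<Sum>\<^sub>\<infinity>n. graded (pow_comp e f n) t s / fact n)"
    unfolding Jexp_def op_exp_def P(2) ..
  show ?thesis
  proof (cases "\<exists>N. en s = en t + e * int N")
    case True
    then obtain N where N: "en s = en t + e * int N" by blast
    have "(\<Sum>\<^sub>\<infinity>n. pow_comp e f n N (ket s) t / fact n) = (\<Sum>n\<le>N. pow_comp e f n N (ket s) t / fact n)"
      by (rule infsumI, rule has_sum_finite_neutralI[of "{..N}"]) (auto simp: pow_comp_zero)
    then show ?thesis
      unfolding eq graded_eq[OF P(1) assms N] vertex_eq[OF assms N] pow_comp_hexp[OF assms order_refl] .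
  next
    case False
    then have "graded (pow_comp e f n) t s = 0" for n by (intro graded_zero[OF P(1)]) blast
    moreover have "vertex e (\<lambda>k. of_nat k * f k) t s = 0" by (rule vertex_zero_en) (use False in blast)
    ultimately show ?thesis by (simp add: eq)
  qed
qed

lemma Gam_occ:
  assumes "e \<noteq> 0" shows "Gam e z (occ t) (occ s) = vertex e (\<lambda>k. z ^ k) t s"
proof -
  have "vertex e (\<lambda>k. of_nat k * (z ^ k / of_nat k)) = vertex e (\<lambda>k. z ^ k)" by (rule vertex_cong) simp
  then show ?thesis unfolding Gam_def Jexp_occ[OF assms] by simp
qed

lemma Gam'_occ:
  assumes "e \<noteq> 0" shows "Gam' e z (occ t) (occ s) = vertex e (\<lambda>k. - ((- z) ^ k)) t s"
proof -
  have "vertex e (\<lambda>k. of_nat k * (- ((- z) ^ k) / of_nat k)) = vertex e (\<lambda>k. - ((- z) ^ k))"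
    by (rule vertex_cong) simp
  then show ?thesis unfolding Gam'_def Jexp_occ[OF assms] by simp
qed

lemma prod_ops_occ:
  assumes "e \<noteq> 0" "\<And>i t s. G i (occ t) (occ s) = vertex e (P i) t s"
  shows "prod_ops G N (occ t) (occ s) = vertex e (\<lambda>k. \<Sum>i=1..N. P i k) t s"
proof (induction N arbitrary: t s)
  case 0
  then show ?case by (simp add: vertex_id[OF assms(1)] idop_def occ_inject)
next
  case (Suc N)
  show ?case unfolding prod_ops.simps compose_occ Suc assms(2)
    using infsumI[OF vertex_semigroup[OF assms(1)]] by simp
qed

lemma rho_sum_tendsto:
  fixes r :: complex
  assumes "norm r < 1" "1 \<le> k"
  shows "(\<lambda>N. \<Sum>i=1..N. (r ^ (2 * i - 1)) ^ k) \<longlonglongrightarrow> r ^ k / (1 - r ^ (2 * k))"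
proof -
  have lt: "norm (r ^ (2 * k)) < 1" using assms by (simp add: norm_power power_less_one_iff)
  have "(\<lambda>i. r ^ k * (r ^ (2 * k)) ^ i) sums (r ^ k * (1 / (1 - r ^ (2 * k))))"
    by (intro sums_mult geometric_sums lt)
  moreover have "(\<Sum>i=1..N. (r ^ (2 * i - 1)) ^ k) = (\<Sum>i<N. r ^ k * (r ^ (2 * k)) ^ i)" for N
  proof -
    have "(\<Sum>i=1..N. (r ^ (2 * i - 1)) ^ k) = (\<Sum>i<N. (r ^ (2 * i + 1)) ^ k)"
      by (simp add: sum.atLeast1_atMost_eq)
    then show ?thesis by (simp add: power_mult_distrib mult_ac flip: power_mult)
  qed
  ultimately show ?thesis by (simp add: sums_def)
qed

lemma rho_Gam_occ:
  assumes "norm r < 1" "e \<noteq> 0"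
  shows "rho_prod r (Gam e) (occ t) (occ s) = vertex e (\<lambda>k. r ^ k / (1 - r ^ (2 * k))) t s"
proof -
  have "prod_ops (\<lambda>i. Gam e (r ^ (2 * i - 1))) N (occ t) (occ s)
     = vertex e (\<lambda>k. \<Sum>i=1..N. (r ^ (2 * i - 1)) ^ k) t s" for N
    by (rule prod_ops_occ[OF assms(2) Gam_occ[OF assms(2)]])
  then show ?thesis
    unfolding rho_prod_def by (simp only:) (intro limI vertex_tendsto assms rho_sum_tendsto)
qed

text \<open>The factor \<open>- ((-1) ^ k)\<close> is the involution omega on power sums, which
  exchanges a partition with its conjugate.\<close>

lemma rho_Gam'_occ:
  assumes "norm r < 1" "e \<noteq> 0"
  shows "rho_prod r (Gam' e) (occ t) (occ s) = vertex e (\<lambda>k. - ((-1) ^ k) * (r ^ k / (1 - r ^ (2 * k)))) t s"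
proof -
  have "prod_ops (\<lambda>i. Gam' e (r ^ (2 * i - 1))) N (occ t) (occ s)
     = vertex e (\<lambda>k. \<Sum>i=1..N. - ((- (r ^ (2 * i - 1))) ^ k)) t s" for N
    by (rule prod_ops_occ[OF assms(2) Gam'_occ[OF assms(2)]])
  moreover have "(\<Sum>i=1..N. - ((- (r ^ (2 * i - 1))) ^ k)) = - ((-1) ^ k) * (\<Sum>i=1..N. (r ^ (2 * i - 1)) ^ k)" for N k
    by (simp add: sum_distrib_left power_minus[of "r ^ _"] sum_negf)
  ultimately show ?thesis
    unfolding rho_prod_def
    by (simp only:) (intro limI vertex_tendsto assms tendsto_mult tendsto_const rho_sum_tendsto)
qed

section \<open>The intertwining relation\<close>

definition qprod :: "(nat \<Rightarrow> complex) \<Rightarrow> nat \<Rightarrow> complex poly" where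
  "qprod a k = (\<Prod>i=1..k. [:1, - a i:])"

lemma qprod_Suc: "qprod a (Suc k) = [:1, - a (Suc k):] * qprod a k"
  by (simp add: qprod_def mult.commute)

text \<open>Newton's identities, the logarithmic derivative of prod_i (1 - a_i u), proved by adding
  one factor at a time.\<close>

lemma qprod_newton:
  "of_nat j * coeff (qprod a k) j = (\<Sum>m=1..j. - (\<Sum>i=1..k. a i ^ m) * coeff (qprod a k) (j - m))"
proof (induction k arbitrary: j)
  case 0
  have "of_nat j * coeff (1 :: complex poly) j = 0" by (cases j) (auto simp: coeff_pCons one_pCons)
  then show ?case by (simp add: qprod_def)
next
  case (Suc k)
  let ?g = "coeff (qprod a k)" and ?b = "a (Suc k)" and ?S = "\<lambda>m. \<Sum>i=1..k. a i ^ m"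
  let ?h = "coeff (qprod a (Suc k))"
  have h0: "?h 0 = ?g 0" and hS: "?h (Suc n) = ?g (Suc n) - ?b * ?g n" for n
    by (simp_all add: qprod_Suc)
  show ?case
  proof (cases j)
    case (Suc n)
    have split: "(\<Sum>m=1..Suc n. F m * ?h (Suc n - m))
      = (\<Sum>m=1..Suc n. F m * ?g (Suc n - m)) - ?b * (\<Sum>m=1..n. F m * ?g (n - m))" for F :: "nat \<Rightarrow> complex"
    proof -
      have "(\<Sum>m=1..n. F m * ?h (Suc n - m)) = (\<Sum>m=1..n. F m * ?g (Suc n - m) - ?b * (F m * ?g (n - m)))"
        by (intro sum.cong refl) (simp add: hS Suc_diff_le algebra_simps)
      then show ?thesis by (simp add: h0 sum_subtractf sum_distrib_left)
    qed
    \<comment> \<open>The new factor 1 - b u cancels the geometric tail in the powers of b, leaving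
      a single term.\<close>
    have shift: "(\<Sum>m=1..Suc n. ?b ^ m * ?g (Suc n - m)) = ?b * ?g n + ?b * (\<Sum>m=1..n. ?b ^ m * ?g (n - m))"
    proof -
      have "(\<Sum>m=1..Suc n. ?b ^ m * ?g (Suc n - m)) = (\<Sum>m=0..n. ?b ^ Suc m * ?g (n - m))"
        by (rule sum.reindex_bij_witness[of _ Suc "\<lambda>m. m - 1"]) auto
      then show ?thesis by (simp add: sum.atLeast_Suc_atMost sum_distrib_left mult_ac)
    qed
    have S: "(\<Sum>m=1..j. ?S m * ?g (j - m)) = - (of_nat j * ?g j)" for j
      using Suc.IH[of j] by (simp add: sum_negf)
    have "(\<Sum>m=1..Suc n. (?S m + ?b ^ m) * ?h (Suc n - m))
      = (\<Sum>m=1..Suc n. ?S m * ?h (Suc n - m)) + (\<Sum>m=1..Suc n. ?b ^ m * ?h (Suc n - m))"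
      by (simp only: distrib_right sum.distrib)
    also have "\<dots> = - (of_nat (Suc n) * ?g (Suc n)) + ?b * (of_nat n * ?g n) + ?b * ?g n"
      unfolding split S shift by (simp add: algebra_simps)
    also have "\<dots> = - (of_nat (Suc n) * ?h (Suc n))" by (simp add: hS algebra_simps)
    finally have "of_nat (Suc n) * ?h (Suc n) = (\<Sum>m=1..Suc n. - ((?S m + ?b ^ m) * ?h (Suc n - m)))"
      by (simp only: sum_negf minus_minus)
    also have "\<dots> = (\<Sum>m=1..Suc n. - (\<Sum>i=1..Suc k. a i ^ m) * ?h (Suc n - m))"
      by (intro sum.cong refl) (simp add: algebra_simps)
    finally show ?thesis unfolding Suc .
  qed simp
qed

locale rho =
  fixes q r :: complex
  assumes q0: "0 < norm q" and q1: "norm q < 1" and rq: "r ^ 2 = q"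
begin

lemma r_nz: "r \<noteq> 0" and q_nz: "q \<noteq> 0"
  using q0 rq by auto

lemma norm_r: "norm r < 1"
proof -
  have "norm r ^ 2 < 1 ^ 2" using q1 rq by (simp flip: norm_power)
  then show ?thesis using power_less_imp_less_base[of "norm r" 2 1] by simp
qed

lemma q_pow_neq1: "1 \<le> m \<Longrightarrow> q ^ m \<noteq> 1"
proof
  assume "1 \<le> m" "q ^ m = 1"
  then have "norm q ^ m = 1" by (metis norm_one norm_power)
  then show False using q0 q1 \<open>1 \<le> m\<close> power_less_one_iff[of "norm q" m] by simp
qed

text \<open>The m-th power sum of the variables r^(2 i - 1), a geometric series.\<close>

definition power_sum :: "nat \<Rightarrow> complex" where "power_sum m = r ^ m / (1 - q ^ m)"

text \<open>The exponent is the mode number: a particle at \<open>x\<close> belongs to psi_x, which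
  is psi_-n with \<open>n = - x\<close>.\<close>

definition wt :: "nat \<Rightarrow> int \<Rightarrow> complex" where "wt k x = (q ^ k) powi (- x)"

text \<open>The coefficients of \<open>exp (\<Sum>\<^sub>m p\<^sub>m (1 - q\<^sup>-\<^sup>k\<^sup>m) u\<^sup>m / m)\<close> at the power sums of the variables \<open>q\<^sup>-\<^sup>\<rho>\<close>.\<close>

definition gauss_coeff :: "nat \<Rightarrow> nat \<Rightarrow> complex" where
  "gauss_coeff k j = coeff (qprod (\<lambda>i. r * inverse q ^ i) k) j"

lemma gauss_coeff_0: "gauss_coeff k 0 = 1"
  unfolding gauss_coeff_def by (induction k) (simp_all add: qprod_Suc, simp add: qprod_def)

text \<open>With p_m = r^m / (1 - q^m), the product p_m (1 - q^(-k m)) is minus the finite geometric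
  sum of (r q^-i)^m over i = 1, ..., k. This is the origin of the k numbers in
  \<open>gauss_coeff\<close>.\<close>

lemma gauss_coeff_newton:
  "of_nat j * gauss_coeff k j = (\<Sum>m=1..j. power_sum m * (1 - (q ^ k) powi (- int m)) * gauss_coeff k (j - m))"
proof -
  have P: "power_sum m * (1 - (q ^ k) powi (- int m)) = - (\<Sum>i=1..k. (r * inverse q ^ i) ^ m)" if "1 \<le> m" for m
  proof -
    have "(\<Sum>i=1..k. (r * inverse q ^ i) ^ m) = r ^ m * (\<Sum>i=1..k. inverse (q ^ m) ^ i)"
      by (simp add: sum_distrib_left power_mult_distrib power_inverse mult.commute flip: power_mult)
    also have "(\<Sum>i=1..k. inverse (q ^ m) ^ i) = (inverse (q ^ m) ^ k - 1) / (1 - q ^ m)"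
    proof -
      have "(\<Sum>i=1..k. inverse (q ^ m) ^ i) * (1 - q ^ m) = inverse (q ^ m) ^ k - 1"
      proof (induction k)
        case (Suc k)
        have "inverse (q ^ m) ^ Suc k * q ^ m = inverse (q ^ m) ^ k" using q_nz by simp
        then have "inverse (q ^ m) ^ Suc k * (1 - q ^ m) = inverse (q ^ m) ^ Suc k - inverse (q ^ m) ^ k"
          by (simp only: right_diff_distrib mult_1_right)
        moreover have "(\<Sum>i=1..Suc k. inverse (q ^ m) ^ i) = (\<Sum>i=1..k. inverse (q ^ m) ^ i) + inverse (q ^ m) ^ Suc k"
          by simp
        ultimately show ?case using Suc by (simp only: distrib_right) simp
      qed simp
      then show ?thesis using q_pow_neq1[OF that] by (simp add: eq_divide_eq)
    qed
    also have "inverse (q ^ m) ^ k = (q ^ k) powi (- int m)"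
      by (simp add: power_int_minus power_inverse mult.commute flip: power_mult)
    finally show ?thesis by (simp add: power_sum_def divide_simps) (simp add: algebra_simps)
  qed
  show ?thesis unfolding gauss_coeff_def qprod_newton
    by (intro sum.cong refl arg_cong2[where f="(*)"] P[symmetric]) simp
qed

lemma degree_qprod: "(\<And>i. 1 \<le> i \<Longrightarrow> a i \<noteq> 0) \<Longrightarrow> degree (qprod a k) = k"
  unfolding qprod_def by (subst degree_prod_sum_eq) auto

lemma gauss_coeff_zero: "k < j \<Longrightarrow> gauss_coeff k j = 0"
  unfolding gauss_coeff_def using r_nz q_nz by (intro coeff_eq_0) (simp add: degree_qprod)

text \<open>Rescaling u by q^k turns the i-th factor into 1 - r q^(k-i) u. Since r^2 = q, the
  numbers r q^(k-i) and r q^-(k+1-i) are inverse to each other, so the rescaled polynomial is the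
  reflected one up to a constant.\<close>

lemma gauss_coeff_palindromic:
  assumes "j \<le> k"
  shows "gauss_coeff k j * (q ^ k) ^ j = (- 1) ^ k * r ^ (k ^ 2) * gauss_coeff k (k - j)"
proof -
  let ?a = "\<lambda>i. r * inverse q ^ i" and ?b = "\<lambda>i. - (r * q ^ (k - i))"
  let ?P = "qprod ?a k"
  have deg: "degree ?P = k" using r_nz q_nz by (intro degree_qprod) auto
  have rfl: "reflect_poly ?P = (\<Prod>i=1..k. [:- ?a i, 1:])"
    unfolding qprod_def reflect_poly_prod
    by (rule prod.cong) (use r_nz q_nz in \<open>simp_all add: reflect_poly_def cCons_def\<close>)
  \<comment> \<open>As r q^i = r^(2 i + 1), the exponents are the first k odd numbers, with sum
    k^2.\<close>
  have b: "(\<Prod>i=1..k. ?b i) = (- 1) ^ k * r ^ (k ^ 2)"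
  proof -
    have "(\<Prod>i=1..k. ?b i) = (\<Prod>i<k. - (r * q ^ i))"
      by (rule prod.reindex_bij_witness[of _ "\<lambda>i. k - i" "\<lambda>i. k - i"]) auto
    also have "\<dots> = (- 1) ^ k * r ^ (k ^ 2)"
    proof (induction k)
      case (Suc k)
      have "(Suc k)\<^sup>2 = k\<^sup>2 + 1 + 2 * k" by (simp add: power2_eq_square)
      then have "r ^ ((Suc k)\<^sup>2) = r ^ (k\<^sup>2) * r * q ^ k" by (simp only: power_add power_one_right power_mult rq)
      then show ?case using Suc by simp
    qed simp
    finally show ?thesis .
  qed
  have "pcompose ?P [:0, q ^ k:] = (\<Prod>i=1..k. [:1, ?b i:])"
    unfolding qprod_def pcompose_prod
  proof (intro prod.cong refl)
    fix i assume "i \<in> {1..k}"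
    then have "inverse q ^ i * q ^ k = q ^ (k - i)"
      using q_nz by (simp add: power_diff field_simps)
    then show "pcompose [:1, - ?a i:] [:0, q ^ k:] = [:1, ?b i:]"
      by (simp add: pcompose_pCons mult.commute mult.left_commute)
  qed
  also have "\<dots> = (\<Prod>i=1..k. smult (?b i) [:- ?a (k + 1 - i), 1:])"
  proof (intro prod.cong refl)
    fix i assume i: "i \<in> {1..k}"
    have "r * q ^ (k - i) * (r * inverse q ^ (k + 1 - i)) = r ^ 2 * (q ^ (k - i) * inverse q ^ Suc (k - i))"
      using i by (simp add: power2_eq_square Suc_diff_le)
    also have "\<dots> = 1" using q_nz by (simp add: rq power_inverse field_simps)
    finally show "[:1, ?b i:] = smult (?b i) [:- ?a (k + 1 - i), 1:]" by simp
  qed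
  also have "\<dots> = smult (\<Prod>i=1..k. ?b i) (\<Prod>i=1..k. [:- ?a (k + 1 - i), 1:])"
    by (rule prod_smult)
  also have "(\<Prod>i=1..k. [:- ?a (k + 1 - i), 1:]) = reflect_poly ?P"
    unfolding rfl by (rule prod.reindex_bij_witness[of _ "\<lambda>i. k + 1 - i" "\<lambda>i. k + 1 - i"]) auto
  finally have "coeff (pcompose ?P [:0, q ^ k:]) j = coeff (smult ((- 1) ^ k * r ^ (k ^ 2)) (reflect_poly ?P)) j"
    unfolding b by simp
  then show ?thesis
    using assms unfolding gauss_coeff_def coeff_pcompose_linear by (simp add: coeff_reflect_poly deg mult.commute)
qed

lemma wt_ok: "1 \<le> k \<Longrightarrow> hop_ok (wt k) j"
  unfolding hop_ok_def
proof (intro disjI2 allI)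
  fix M :: int assume "1 \<le> k"
  then have "norm (q ^ k) < 1" using q0 q1 by (simp add: norm_power power_less_one_iff)
  then have "(\<lambda>n. (q ^ k) ^ n) summable_on UNIV"
    by (simp add: summable_on_UNIV_nonneg_real_iff norm_power norm_summable_imp_summable_on summable_geometric)
  then have "(\<lambda>n::nat. (q ^ k) powi (1 - M) * (q ^ k) ^ n) summable_on UNIV" by (rule summable_on_cmult_right)
  moreover have "wt k summable_on {..<M} \<longleftrightarrow> (\<lambda>n::nat. (q ^ k) powi (1 - M) * (q ^ k) ^ n) summable_on UNIV"
  proof (rule summable_on_reindex_bij_witness[of _ "\<lambda>n. M - 1 - int n" "\<lambda>x. nat (M - 1 - x)"])
    fix x :: int assume "x \<in> {..<M}"
    then have "(q ^ k) powi (1 - M) * (q ^ k) powi int (nat (M - 1 - x)) = wt k x"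
      unfolding wt_def using q_nz by (subst power_int_add[symmetric]) auto
    then show "(q ^ k) powi (1 - M) * (q ^ k) ^ nat (M - 1 - x) = wt k x" by (simp only: power_int_of_nat)
  qed auto
  ultimately show "wt k summable_on {..<M}" by simp
qed

lemma wt_shift: "wt k (x + m) = (q ^ k) powi (- m) * wt k x"
proof -
  have "- (x + m) = - m + - x" by simp
  then show ?thesis unfolding wt_def using power_int_add[of "q ^ k" "- m" "- x"] q_nz by (simp only:) simp
qed

lemma current_wt:
  assumes "1 \<le> k" "1 \<le> m"
  shows "current (int m) (hop (wt k) j v) t
    = hop (wt k) j (current (int m) v) t + (1 - (q ^ k) powi (- int m)) * hop (wt k) (j + int m) v t"
proof -
  have "(\<lambda>x. wt k x - wt k (x + int m)) = (\<lambda>x. (1 - (q ^ k) powi (- int m)) * wt k x)"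
    by (simp add: wt_shift algebra_simps)
  then show ?thesis
    using current_hop[OF _ wt_ok wt_ok, of "int m" k j v t] assms by (simp add: hop_scale)
qed

lemma hexp_wt:
  assumes "1 \<le> k"
  shows "hexp 1 power_sum N (hop (wt k) j v) t = (\<Sum>i\<le>N. gauss_coeff k i * hop (wt k) (j + int i) (hexp 1 power_sum (N - i) v) t)"
proof -
  have "hexp 1 power_sum N (hop (wt k) (j + int 0) v) t
    = (\<Sum>i\<le>N. gauss_coeff k i * hop (wt k) (j + int (0 + i)) (hexp 1 power_sum (N - i) v) t)"
    by (rule hexp_intertwine[where X="\<lambda>i. hop (wt k) (j + int i)"
          and \<kappa>="\<lambda>m. 1 - (q ^ k) powi (- int m)", OF _ _ gauss_coeff_0 gauss_coeff_newton])
       (simp_all add: current_wt[OF assms] add.assoc)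
  then show ?thesis by simp
qed

text \<open>Gamma_+ E_j = sum_i c_i E_(j+i) Gamma_+ as matrices, where E_j is the weighted hop.
  Energies select one degree \<open>N\<close>, in which \<open>i\<close> runs up to
  \<open>N\<close>; the bound becomes \<open>k\<close> because the coefficients vanish beyond
  \<open>k\<close> and the entries of Gamma_+ beyond \<open>N\<close>.\<close>

lemma hop_vertex:
  assumes "1 \<le> k"
  shows "((\<lambda>u'. vertex 1 power_sum u u' * hop (wt k) j (ket v) u')
    has_sum (\<Sum>i\<le>k. gauss_coeff k i * hop (wt k) (j + int i) (\<lambda>u. vertex 1 power_sum u v) u)) UNIV"
proof -
  define x where "x = hop (wt k) j (ket v)"
  have x0: "x u' = 0" if "en v \<noteq> en u' + j" for u'
  proof -
    have "x u' = hop (wt k) j (\<lambda>_. 0) u'"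
      unfolding x_def by (rule hop_local) (use that in \<open>auto simp: ket_def\<close>)
    then show ?thesis by (simp add: rowfin_zero)
  qed
  show ?thesis
  proof (cases "0 \<le> en v - j - en u")
    \<comment> \<open>Both sides vanish: the entries of Gamma_+ would need a negative
      degree.\<close>
    case False
    have "vertex 1 power_sum u u' * x u' = 0" for u'
      using False x0[of u'] vertex_zero_en[of u' u 1 power_sum] by (cases "en v = en u' + j") auto
    moreover have "hop (wt k) (j + int i) (\<lambda>u. vertex 1 power_sum u v) u = hop (wt k) (j + int i) (\<lambda>_. 0) u" for i
      by (rule hop_local, rule vertex_zero_en) (use False in auto)
    ultimately show ?thesis unfolding x_def[symmetric]
      by (simp only: rowfin_zero[OF rowfin_hop] mult_zero_right sum.neutral_const has_sum_0_simp)
  next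
    case True
    then obtain N where N: "en v = en u + j + int N" using nonneg_int_cases[OF True] by (metis add.commute diff_add_cancel diff_diff_eq)
    have "((\<lambda>u'. hexp 1 power_sum N (ket u') u * x u') has_sum hexp 1 power_sum N x u) UNIV"
      by (rule rowfin_ket_has_sum) simp
    moreover have "hexp 1 power_sum N (ket u') u * x u' = vertex 1 power_sum u u' * x u'" for u'
      using x0[of u'] N vertex_eq[of 1 u' u N power_sum] by (cases "en v = en u' + j") auto
    moreover have "hexp 1 power_sum N x u = (\<Sum>i\<le>k. gauss_coeff k i * hop (wt k) (j + int i) (\<lambda>u. vertex 1 power_sum u v) u)"
    proof -
      have "hexp 1 power_sum N x u = (\<Sum>i\<le>N. gauss_coeff k i * hop (wt k) (j + int i) (\<lambda>u. vertex 1 power_sum u v) u)"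
        unfolding x_def hexp_wt[OF assms]
      proof (intro sum.cong refl arg_cong2[where f="(*)"] hop_local)
        fix i u1 assume "i \<in> {..N}" "en u1 = en u + (j + int i)" "ch u1 = ch u"
        then show "hexp 1 power_sum (N - i) (ket v) u1 = vertex 1 power_sum u1 v"
          using N by (intro vertex_eq[symmetric]) (auto simp: of_nat_diff)
      qed
      also have "\<dots> = (\<Sum>i\<le>max N k. gauss_coeff k i * hop (wt k) (j + int i) (\<lambda>u. vertex 1 power_sum u v) u)"
      proof (rule sum.mono_neutral_left)
        show "\<forall>i\<in>{..max N k} - {..N}. gauss_coeff k i * hop (wt k) (j + int i) (\<lambda>u. vertex 1 power_sum u v) u = 0"
        proof
          fix i assume i: "i \<in> {..max N k} - {..N}"
          have "hop (wt k) (j + int i) (\<lambda>u. vertex 1 power_sum u v) u = hop (wt k) (j + int i) (\<lambda>_. 0) u"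
            by (rule hop_local, rule vertex_zero_en) (use i N in auto)
          then show "gauss_coeff k i * hop (wt k) (j + int i) (\<lambda>u. vertex 1 power_sum u v) u = 0" by (simp add: rowfin_zero)
        qed
      qed auto
      also have "\<dots> = (\<Sum>i\<le>k. gauss_coeff k i * hop (wt k) (j + int i) (\<lambda>u. vertex 1 power_sum u v) u)"
        by (rule sum.mono_neutral_right) (auto simp: gauss_coeff_zero)
      finally show ?thesis .
    qed
    ultimately show ?thesis unfolding x_def by simp
  qed
qed

end

text \<open>A column of Gamma_+ involves finitely many degrees, since energies are nonnegative, and
  in each degree it is a row of the transpose, which is row-finite.\<close>

lemma finite_vertex: "finite {u. vertex 1 p u t \<noteq> 0}"
proof (rule finite_subset)
  show "{u. vertex 1 p u t \<noteq> 0} \<subseteq> (\<Union>N\<in>{..nat (en t)}. {u. hexp (-1) p N (ket u) t \<noteq> 0})"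
  proof
    fix u assume "u \<in> {u. vertex 1 p u t \<noteq> 0}"
    then have u: "vertex 1 p u t \<noteq> 0" by simp
    then obtain N where N: "en t = en u + 1 * int N" using vertex_zero_en[of t u 1 p] by blast
    then have "hexp (-1) p N (ket u) t \<noteq> 0" using u vertex_eq[OF _ N, of p] hexp_adjoint[of 1 p N t u] by simp
    moreover have "N \<le> nat (en t)" using N en_nonneg[of u] by linarith
    ultimately show "u \<in> (\<Union>N\<in>{..nat (en t)}. {u. hexp (-1) p N (ket u) t \<noteq> 0})" by blast
  qed
  show "finite (\<Union>N\<in>{..nat (en t)}. {u. hexp (-1) p N (ket u) t \<noteq> 0})"
    by (intro finite_UN_I rowfin_ket(1)) auto
qed

text \<open>Gamma_- is the transpose of Gamma_+, so this is the entry of Gamma_- Gamma_+ at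
  \<open>t\<close> and \<open>v\<close>.\<close>

definition gram :: "(nat \<Rightarrow> complex) \<Rightarrow> maya_state \<Rightarrow> maya_state \<Rightarrow> complex" where
  "gram p t v = (\<Sum>\<^sub>\<infinity>u. vertex 1 p u t * vertex 1 p u v)"

lemma gram_eq: "finite S \<Longrightarrow> {u. vertex 1 p u t \<noteq> 0} \<subseteq> S \<or> {u. vertex 1 p u v \<noteq> 0} \<subseteq> S \<Longrightarrow>
   gram p t v = (\<Sum>u\<in>S. vertex 1 p u t * vertex 1 p u v)"
  unfolding gram_def by (rule infsumI, rule has_sum_finite_neutralI) auto

lemma gram_sym: "gram p t v = gram p v t"
  by (simp add: gram_def mult.commute)

context rho
begin

text \<open>The eigenvalue of \<open>\<Sum>\<^sub>n q\<^sup>k\<^sup>n \<psi>\<^sub>-\<^sub>n \<psi>\<^sup>*\<^sub>n\<close> with the divergent sum over particles replaced by minus the sum over holes.\<close>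

definition hole_sum :: "nat \<Rightarrow> maya_state \<Rightarrow> complex" where
  "hole_sum k t = (\<Sum>\<^sub>\<infinity>x\<in>- occ t. - wt k x)"

lemma hop_zero: "hop (wt k) 0 v t = hole_sum k t * v t"
proof -
  have "hop (wt k) 0 v t = (\<Sum>\<^sub>\<infinity>x\<in>- occ t. - wt k x * v t)"
    unfolding hop_def by (rule infsum_cong_neutral) (auto simp: annih_create_same)
  then show ?thesis unfolding hole_sum_def infsum_cmult_left' .
qed

lemma hop_wt_adjoint: "hop (wt k) j (ket s) t = (q ^ k) powi j * hop (wt k) (- j) (ket t) s"
proof -
  have "(\<lambda>x. wt k (x - j)) = (\<lambda>x. (q ^ k) powi j * wt k x)"
    using wt_shift[of k _ "- j"] by simp
  then show ?thesis using hop_adjoint[of "wt k" j s t] by (simp add: hop_scale)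
qed

text \<open>The case \<open>j = 0\<close> of \<open>hop_vertex\<close>: the hop is then diagonal, so
  the sum over intermediate states collapses to \<open>v\<close>.\<close>

lemma vertex_eigen:
  assumes "1 \<le> k"
  shows "hole_sum k v * vertex 1 power_sum u v = (\<Sum>i\<le>k. gauss_coeff k i * hop (wt k) (int i) (\<lambda>u. vertex 1 power_sum u v) u)"
proof (rule has_sum_unique)
  show "((\<lambda>u'. vertex 1 power_sum u u' * hop (wt k) 0 (ket v) u') has_sum hole_sum k v * vertex 1 power_sum u v) UNIV"
    by (rule has_sum_finite_neutralI[of "{v}"]) (auto simp: hop_zero ket_def)
  show "((\<lambda>u'. vertex 1 power_sum u u' * hop (wt k) 0 (ket v) u')
    has_sum (\<Sum>i\<le>k. gauss_coeff k i * hop (wt k) (int i) (\<lambda>u. vertex 1 power_sum u v) u)) UNIV"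
    using hop_vertex[OF assms, of u 0 v] by simp
qed

text \<open>The hop acts on the second index of the Gamma_+ entry, that is, on Gamma_-. Transposing
  it gives E_-k to the right of Gamma_+, at the cost of (q^k)^k.\<close>

lemma hop_row:
  assumes "1 \<le> k"
  shows "hop (wt k) (int k) (\<lambda>t. vertex 1 power_sum u t) t
    = (q ^ k) ^ k * (\<Sum>i\<le>k. gauss_coeff k i * hop (wt k) (- int (k - i)) (\<lambda>u. vertex 1 power_sum u t) u)"
proof -
  have "((\<lambda>u'. hop (wt k) (int k) (ket u') t * vertex 1 power_sum u u') has_sum hop (wt k) (int k) (\<lambda>t. vertex 1 power_sum u t) t) UNIV"
    by (rule rowfin_ket_has_sum) simp
  moreover have "hop (wt k) (int k) (ket u') t * vertex 1 power_sum u u'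
    = (q ^ k) ^ k * (vertex 1 power_sum u u' * hop (wt k) (- int k) (ket t) u')" for u'
    by (subst hop_wt_adjoint) simp
  moreover have "((\<lambda>u'. (q ^ k) ^ k * (vertex 1 power_sum u u' * hop (wt k) (- int k) (ket t) u'))
     has_sum (q ^ k) ^ k * (\<Sum>i\<le>k. gauss_coeff k i * hop (wt k) (- int k + int i) (\<lambda>u. vertex 1 power_sum u t) u)) UNIV"
    by (intro has_sum_cmult_right hop_vertex assms)
  ultimately have "hop (wt k) (int k) (\<lambda>t. vertex 1 power_sum u t) t
    = (q ^ k) ^ k * (\<Sum>i\<le>k. gauss_coeff k i * hop (wt k) (- int k + int i) (\<lambda>u. vertex 1 power_sum u t) u)"
    using has_sum_unique by simp blast
  also have "(\<Sum>i\<le>k. gauss_coeff k i * hop (wt k) (- int k + int i) (\<lambda>u. vertex 1 power_sum u t) u)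
     = (\<Sum>i\<le>k. gauss_coeff k i * hop (wt k) (- int (k - i)) (\<lambda>u. vertex 1 power_sum u t) u)"
    by (intro sum.cong refl) (auto simp: of_nat_diff)
  finally show ?thesis .
qed

text \<open>Transposition of the geometric hop under the bilinear pairing; the finite supports make
  the double sum finite.\<close>

lemma pair_hop:
  assumes S: "finite S" "\<And>u. u \<notin> S \<Longrightarrow> f u = 0" and T: "finite T" "\<And>u. u \<notin> T \<Longrightarrow> g u = 0"
  shows "(\<Sum>u\<in>T. hop (wt k) (- j) f u * g u) = (q ^ k) powi (- j) * (\<Sum>u\<in>S. f u * hop (wt k) j g u)"
proof -
  have "(\<Sum>u\<in>T. hop (wt k) (- j) f u * g u) = (\<Sum>u\<in>T. (\<Sum>u'\<in>S. hop (wt k) (- j) (ket u') u * f u') * g u)"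
    by (intro sum.cong refl arg_cong2[where f="(*)"] rowfin_ket_sum) (use S in auto)
  also have "\<dots> = (\<Sum>u\<in>T. \<Sum>u'\<in>S. (q ^ k) powi (- j) * f u' * (hop (wt k) j (ket u) u' * g u))"
    by (simp add: sum_distrib_right sum_distrib_left hop_wt_adjoint[of k "- j"] mult_ac)
  also have "\<dots> = (\<Sum>u'\<in>S. \<Sum>u\<in>T. (q ^ k) powi (- j) * f u' * (hop (wt k) j (ket u) u' * g u))"
    by (rule sum.swap)
  also have "\<dots> = (\<Sum>u'\<in>S. (q ^ k) powi (- j) * f u' * hop (wt k) j g u')"
    unfolding sum_distrib_left[symmetric]
    by (intro sum.cong refl arg_cong2[where f="(*)"] rowfin_ket_sum[symmetric]) (use T in auto)
  finally show ?thesis by (simp add: sum_distrib_left mult_ac)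
qed

text \<open>Crossing Gamma_- costs (q^k)^k, and throwing E_-(k-i) onto the other factor of the
  pairing returns (q^k)^-(k-i). What is left is c_i q^(k i), which the palindromic symmetry converts
  to c_(k-i); the sum is then the one in \<open>vertex_eigen\<close>, whose value is the scalar at
  \<open>v\<close>.\<close>

lemma hop_gram:
  assumes k: "1 \<le> k"
  shows "hop (wt k) (int k) (\<lambda>t. gram power_sum t v) t = (- 1) ^ k * r ^ (k ^ 2) * hole_sum k v * gram power_sum t v"
proof -
  let ?T = "{u. vertex 1 power_sum u v \<noteq> 0}" and ?S = "{u. vertex 1 power_sum u t \<noteq> 0}"
  let ?f = "\<lambda>u. vertex 1 power_sum u t" and ?g = "\<lambda>u. vertex 1 power_sum u v" and ?c = "q ^ k"
  have "hop (wt k) (int k) (\<lambda>t. gram power_sum t v) t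
    = hop (wt k) (int k) (\<lambda>t. \<Sum>u\<in>?T. ?g u * vertex 1 power_sum u t) t"
    by (rule arg_cong[where f="\<lambda>h. hop (wt k) (int k) h t"], rule ext)
       (subst gram_eq[OF finite_vertex disjI2[OF order_refl]], simp add: mult.commute)
  also have "\<dots> = (\<Sum>u\<in>?T. ?g u * hop (wt k) (int k) (\<lambda>t. vertex 1 power_sum u t) t)"
    by (rule rowfin_lin) simp
  also have "\<dots> = (\<Sum>u\<in>?T. \<Sum>i\<le>k. gauss_coeff k i * ?c ^ k * (hop (wt k) (- int (k - i)) ?f u * ?g u))"
    unfolding hop_row[OF k] by (simp add: sum_distrib_left mult_ac)
  also have "\<dots> = (\<Sum>i\<le>k. \<Sum>u\<in>?T. gauss_coeff k i * ?c ^ k * (hop (wt k) (- int (k - i)) ?f u * ?g u))"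
    by (rule sum.swap)
  also have "\<dots> = (\<Sum>i\<le>k. (- 1) ^ k * r ^ (k ^ 2) * gauss_coeff k (k - i) * (\<Sum>u\<in>?S. ?f u * hop (wt k) (int (k - i)) ?g u))"
  proof (intro sum.cong refl)
    fix i assume i: "i \<in> {..k}"
    have "?c ^ k * ?c powi (- int (k - i)) = ?c ^ i"
      using i q_nz by (simp add: of_nat_diff power_int_diff power_int_minus field_simps)
    then have "gauss_coeff k i * ?c ^ k * ?c powi (- int (k - i)) = (- 1) ^ k * r ^ (k ^ 2) * gauss_coeff k (k - i)"
      using gauss_coeff_palindromic[of i k] i by (simp add: mult.assoc)
    then show "(\<Sum>u\<in>?T. gauss_coeff k i * ?c ^ k * (hop (wt k) (- int (k - i)) ?f u * ?g u))
      = (- 1) ^ k * r ^ (k ^ 2) * gauss_coeff k (k - i) * (\<Sum>u\<in>?S. ?f u * hop (wt k) (int (k - i)) ?g u)"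
      unfolding sum_distrib_left[symmetric]
      by (subst pair_hop[of ?S]) (auto simp: finite_vertex mult.assoc[symmetric])
  qed
  also have "\<dots> = (\<Sum>i\<le>k. (- 1) ^ k * r ^ (k ^ 2) * gauss_coeff k i * (\<Sum>u\<in>?S. ?f u * hop (wt k) (int i) ?g u))"
    by (rule sum.reindex_bij_witness[of _ "\<lambda>i. k - i" "\<lambda>i. k - i"]) auto
  also have "\<dots> = (- 1) ^ k * r ^ (k ^ 2) * (\<Sum>i\<le>k. \<Sum>u\<in>?S. ?f u * (gauss_coeff k i * hop (wt k) (int i) ?g u))"
    by (simp add: sum_distrib_left mult_ac)
  also have "(\<Sum>i\<le>k. \<Sum>u\<in>?S. ?f u * (gauss_coeff k i * hop (wt k) (int i) ?g u))
     = (\<Sum>u\<in>?S. ?f u * (\<Sum>i\<le>k. gauss_coeff k i * hop (wt k) (int i) ?g u))"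
    unfolding sum_distrib_left by (rule sum.swap)
  also have "\<dots> = hole_sum k v * (\<Sum>u\<in>?S. ?f u * ?g u)"
    unfolding vertex_eigen[OF k, symmetric] by (simp add: sum_distrib_left mult_ac)
  also have "(\<Sum>u\<in>?S. ?f u * ?g u) = gram power_sum t v"
    by (rule gram_eq[symmetric, OF finite_vertex disjI1[OF order_refl]])
  finally show ?thesis by (simp add: mult_ac)
qed

text \<open>The source of the move from x to x + k has its quadratic charge lower by (x + k)^2 - x^2
  = k^2 + 2 k x, and r^(-2 k x) is the weight q^(-k x).\<close>

lemma current_quad:
  "current (int k) (\<lambda>u. r powi quad u * y u) t = r powi (quad t - int (k ^ 2)) * hop (wt k) (int k) y t"
proof -
  have A: "annih x (create (x + int k) (\<lambda>u. r powi quad u * y u)) t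
    = r powi (quad t - int (k ^ 2)) * (wt k x * annih x (create (x + int k) y) t)" for x
  proof (cases "x \<notin> occ t \<and> x + int k \<in> occ (ins x t)")
    case True
    have "quad (del (x + int k) (ins x t)) = quad t - int (k ^ 2) + - (2 * int k * x)"
      using True by (simp add: mom_del mom_ins power2_eq_square algebra_simps)
    moreover have "r powi (- (2 * int k * x)) = wt k x"
    proof -
      have "q ^ k = r powi int (2 * k)" unfolding power_int_of_nat by (simp only: power_mult rq)
      then have "wt k x = r powi (int (2 * k) * (- x))" unfolding wt_def by (simp only: power_int_mult)
      then show ?thesis by (simp add: mult.assoc)
    qed
    ultimately have "r powi quad (del (x + int k) (ins x t)) = r powi (quad t - int (k ^ 2)) * wt k x"
      using power_int_add[of r "quad t - int (k\<^sup>2)" "- (2 * int k * x)"] r_nz by (simp only: simp_thms)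
    then show ?thesis using True by (simp add: annih_def create_def)
  qed (auto simp: annih_def create_def)
  show ?thesis unfolding hop_def infsum_cmult_right'[symmetric] A by (rule infsum_cong) simp
qed

text \<open>The r^(-k^2) of the conjugation by q^(W_0/2) cancels the r^(k^2) of the palindromic
  symmetry; only (-1)^k survives.\<close>

lemma current_gram:
  assumes "1 \<le> k"
  shows "current (int k) (\<lambda>u. r powi quad u * gram power_sum u v) t
    = (- 1) ^ k * hole_sum k v * (r powi quad t * gram power_sum t v)"
proof -
  have "r powi (quad t - int (k ^ 2)) * r ^ (k ^ 2) = r powi quad t"
    using r_nz by (simp add: power_int_diff del: of_nat_power)
  then have "a * (r powi (quad t - int (k ^ 2)) * r ^ (k ^ 2)) = a * r powi quad t" for a by simp
  then show ?thesis unfolding current_quad hop_gram[OF assms]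
    by (simp only: mult.left_commute mult.commute mult.assoc)
qed

end

section \<open>Particle-hole duality\<close>

text \<open>Reflection about -1/2 combined with the exchange of particles and holes; this centre
  takes the vacuum of charge \<open>s\<close> to that of charge \<open>- s\<close>.\<close>

definition dual :: "maya_state \<Rightarrow> maya_state" where "dual t = mk_maya_state {y. - 1 - y \<notin> occ t}"

lemma occ_dual [simp]: "occ (dual t) = {y. - 1 - y \<notin> occ t}"
proof -
  obtain a b where ab: "\<And>j. j \<in> occ t \<Longrightarrow> a \<le> j" "\<And>j. b \<le> j \<Longrightarrow> j \<in> occ t"
    by (rule maya_bounds[of t]) blast
  have "- b \<le> y" if "- 1 - y \<notin> occ t" for y
    using ab(2)[of "- 1 - y"] that by linarith
  moreover have "- 1 - y \<notin> occ t" if "- a \<le> y" for y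
    using ab(1)[of "- 1 - y"] that by linarith
  ultimately have "maya {y. - 1 - y \<notin> occ t}" unfolding maya_def by blast
  then show ?thesis by (simp add: dual_def occ_mk_maya_state)
qed

lemma dual_dual [simp]: "dual (dual t) = t"
  by (rule maya_state_eqI) simp

lemma dual_vac_state: "dual (vac_state s) = vac_state (- s)"
  by (rule maya_state_eqI) auto

lemma mom_dual: "mom f (dual t) = - mom (\<lambda>a. f (- 1 - a)) t"
proof -
  have "(\<Sum>a | a \<in> occ (dual t) \<and> a < 0. f a) = (\<Sum>a | a \<notin> occ t \<and> 0 \<le> a. f (- 1 - a))"
    by (rule sum.reindex_bij_witness[of _ "\<lambda>a. - 1 - a" "\<lambda>a. - 1 - a"]) auto
  moreover have "(\<Sum>a | a \<notin> occ (dual t) \<and> 0 \<le> a. f a) = (\<Sum>a | a \<in> occ t \<and> a < 0. f (- 1 - a))"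
    by (rule sum.reindex_bij_witness[of _ "\<lambda>a. - 1 - a" "\<lambda>a. - 1 - a"]) auto
  ultimately show ?thesis by (simp add: mom_def)
qed

text \<open>Counts particles below \<open>x\<close> and holes from \<open>x\<close> on. Raising
  \<open>x\<close> by one changes exactly one of the two counts, by one, so the sign alternates
  whatever \<open>t\<close> is; this makes signs at distant positions comparable.\<close>

definition parity_sign :: "maya_state \<Rightarrow> int \<Rightarrow> complex" where
  "parity_sign t x = sg t x * (- 1) ^ card {i. i \<notin> occ t \<and> x \<le> i}"

lemma parity_sign_Suc: "parity_sign t (x + 1) = - parity_sign t x"
proof (cases "x \<in> occ t")
  case True
  have "{i \<in> occ t. i < x + 1} = insert x {i \<in> occ t. i < x}"
    "{i. i \<notin> occ t \<and> x \<le> i} = {i. i \<notin> occ t \<and> x + 1 \<le> i}"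
    using True by (auto simp: le_less)
  then show ?thesis by (simp add: parity_sign_def fsign_def finite_occ_less)
next
  case False
  have "{i \<in> occ t. i < x + 1} = {i \<in> occ t. i < x}"
    "{i. i \<notin> occ t \<and> x \<le> i} = insert x {i. i \<notin> occ t \<and> x + 1 \<le> i}"
    using False by (auto simp: le_less)
  then show ?thesis by (simp add: parity_sign_def fsign_def finite_holes_ge)
qed

lemma parity_sign_add: "parity_sign t (x + int n) = (- 1) ^ n * parity_sign t x"
proof (induction n)
  case (Suc n)
  have "parity_sign t (x + int (Suc n)) = parity_sign t ((x + int n) + 1)" by (simp add: add_ac)
  then show ?case by (simp add: parity_sign_Suc Suc)
qed simp

lemma parity_sign_mult: "parity_sign t x * parity_sign t y = (- 1) ^ nat \<bar>x - y\<bar>"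
proof -
  have sq: "parity_sign t z * parity_sign t z = 1" for z by (simp add: parity_sign_def mult_ac flip: power_add mult_2)
  have "parity_sign t x * parity_sign t y = (- 1) ^ nat \<bar>x - y\<bar>" if "x \<le> y" for x y
    using parity_sign_add[of t x "nat (y - x)"] that sq[of x] by (simp add: mult_ac)
  from this[of x y] this[of y x] show ?thesis
    by (cases "x \<le> y") (auto simp: mult.commute abs_minus_commute)
qed

text \<open>The dual sign counts holes strictly above \<open>x\<close>. When \<open>x\<close> is
  itself a hole, \<open>parity_sign\<close> counts it and the dual sign does not, hence the
  minus.\<close>

lemma sg_dual: "sg t x * sg (dual t) (- 1 - x) = (if x \<in> occ t then parity_sign t x else - parity_sign t x)"
proof -
  have "card {i \<in> occ (dual t). i < - 1 - x} = card {i. i \<notin> occ t \<and> x < i}"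
    by (rule bij_betw_same_card[of "\<lambda>i. - 1 - i"])
       (rule bij_betw_byWitness[of _ "\<lambda>i. - 1 - i"], auto)
  then have *: "sg (dual t) (- 1 - x) = (- 1) ^ card {i. i \<notin> occ t \<and> x < i}" by (simp add: fsign_def)
  show ?thesis
  proof (cases "x \<in> occ t")
    case True
    have "{i. i \<notin> occ t \<and> x < i} = {i. i \<notin> occ t \<and> x \<le> i}" using True by (auto simp: le_less)
    then show ?thesis using True * by (simp add: parity_sign_def)
  next
    case False
    have "{i. i \<notin> occ t \<and> x \<le> i} = insert x {i. i \<notin> occ t \<and> x < i}" using False by (auto simp: le_less)
    moreover have "finite {i. i \<notin> occ t \<and> x < i}"
      by (rule finite_subset[OF _ finite_holes_ge[of t x]]) auto
    ultimately show ?thesis using False * by (simp add: parity_sign_def)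
  qed
qed

text \<open>A particle moving from \<open>x\<close> to \<open>x + k\<close> is a hole moving back,
  hence in the dual a particle moving from \<open>- 1 - x - k\<close> to \<open>- 1 - x\<close>: the
  same shift. The four signs combine to two values of \<open>parity_sign\<close> at distance |k| and
  one minus sign for the vacated position.\<close>

lemma current_dual:
  assumes "k \<noteq> 0"
  shows "current k (\<lambda>t. v (dual t)) t = - ((- 1) ^ nat \<bar>k\<bar>) * current k v (dual t)"
proof -
  have 1: "annih x (create (x + k) (\<lambda>t. v (dual t))) t
    = - ((- 1) ^ nat \<bar>k\<bar>) * annih (- 1 - x - k) (create (- 1 - x - k + k) v) (dual t)" for x
  proof (cases "x \<notin> occ t \<and> x + k \<in> occ t")
    case False
    then have "\<not> (- 1 - x - k \<notin> occ (dual t) \<and> - 1 - x - k + k \<in> occ (dual t))" by (auto simp: algebra_simps)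
    then show ?thesis using annih_create_zero[OF assms False] annih_create_zero[OF assms, of "- 1 - x - k" "dual t"] by simp
  next
    case True
    have shift: "dual (del (x + k) (ins x t)) = del (- 1 - x) (ins (- 1 - x - k) (dual t))"
      by (rule maya_state_eqI) (use assms in auto)
    let ?a = "sg t x" and ?b = "sg t (x + k)" and ?a' = "sg (dual t) (- 1 - x)" and ?b' = "sg (dual t) (- 1 - (x + k))"
    have "(?a * ?a') * (?b * ?b') = (- parity_sign t x) * parity_sign t (x + k)" unfolding sg_dual using True by simp
    also have "\<dots> = - ((- 1) ^ nat \<bar>k\<bar>)" by (simp add: parity_sign_mult)
    finally have F: "?a * ?b * (?a' * ?b') = - ((- 1) ^ nat \<bar>k\<bar>)" by (simp only: mult_ac)
    \<comment> \<open>Signs square to 1, so multiplying by the dual pair moves it to the other side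
      of \<open>F\<close>.\<close>
    have "(?a' * ?b') * (?a' * ?b') = (?a' * ?a') * (?b' * ?b')" by (simp only: mult_ac)
    then have "?a * ?b = ?a * ?b * ((?a' * ?b') * (?a' * ?b'))" by (simp only: sg_sq mult_1_right)
    also have "\<dots> = ?a * ?b * (?a' * ?b') * (?a' * ?b')" by (rule mult.assoc[symmetric])
    finally have ab: "?a * ?b = - ((- 1) ^ nat \<bar>k\<bar>) * (?a' * ?b')" unfolding F .
    have x: "x \<notin> occ t" "x + k \<in> occ t" "x + k \<in> occ (ins x t)" "- 1 - x - k \<notin> occ (dual t)"
      "- 1 - x \<in> occ (ins (- 1 - x - k) (dual t))"
      using True by (auto simp: algebra_simps)
    have L: "annih x (create (x + k) (\<lambda>t. v (dual t))) t
      = (if 0 < k then -1 else 1) * (?a * ?b) * v (del (- 1 - x) (ins (- 1 - x - k) (dual t)))"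
      using x by (simp add: annih_def create_def shift fsign_insert)
    have R: "annih (- 1 - x - k) (create (- 1 - x) v) (dual t)
      = (if 0 < k then -1 else 1) * (?a' * ?b') * v (del (- 1 - x) (ins (- 1 - x - k) (dual t)))"
      using x by (simp add: annih_def create_def fsign_insert diff_diff_eq mult_ac del: occ_dual)
    show ?thesis using L R unfolding ab by simp
  qed
  have "current k (\<lambda>t. v (dual t)) t = - ((- 1) ^ nat \<bar>k\<bar>) *
     (\<Sum>\<^sub>\<infinity>x. - 1 * annih (- 1 - x - k) (create (- 1 - x - k + k) v) (dual t))"
    unfolding hop_def 1 infsum_cmult_right'[symmetric] by (rule infsum_cong) simp
  also have "(\<Sum>\<^sub>\<infinity>x. - 1 * annih (- 1 - x - k) (create (- 1 - x - k + k) v) (dual t)) = current k v (dual t)"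
    unfolding hop_def by (rule infsum_reindex_bij_witness[of _ "\<lambda>y. - 1 - y - k" "\<lambda>x. - 1 - x - k"]) auto
  finally show ?thesis .
qed

lemma hexp_dual:
  assumes "e = 1 \<or> e = -1"
  shows "hexp e p N (\<lambda>t. v (dual t)) t = hexp e (\<lambda>m. - ((- 1) ^ m) * p m) N v (dual t)"
proof (induction N arbitrary: t rule: less_induct)
  case (less N)
  let ?p = "\<lambda>m. - ((- 1) ^ m) * p m"
  show ?case
  proof (cases "N = 0")
    case False
    have "of_nat N * hexp e p N (\<lambda>t. v (dual t)) t = of_nat N * hexp e ?p N v (dual t)"
      unfolding hexp_rec
    proof (intro sum.cong refl)
      fix m assume m: "m \<in> {1..N}"
      have "hexp e p (N - m) (\<lambda>t. v (dual t)) = (\<lambda>t. hexp e ?p (N - m) v (dual t))"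
        by (intro ext less) (use m in auto)
      then have "current (e * int m) (hexp e p (N - m) (\<lambda>t. v (dual t))) t
        = - ((- 1) ^ nat \<bar>e * int m\<bar>) * current (e * int m) (hexp e ?p (N - m) v) (dual t)"
        using assms m by (simp only:) (rule current_dual, auto)
      moreover have "nat \<bar>e * int m\<bar> = m" using assms by (auto simp: abs_mult)
      ultimately show "p m * current (e * int m) (hexp e p (N - m) (\<lambda>t. v (dual t))) t
        = ?p m * current (e * int m) (hexp e ?p (N - m) v) (dual t)" by simp
    qed
    then show ?thesis using False by simp
  qed simp
qed

text \<open>Duality produces exactly the sign that distinguishes Gamma' from Gamma.\<close>

lemma vertex_dual:
  assumes "e = 1 \<or> e = -1"
  shows "vertex e (\<lambda>m. - ((- 1) ^ m) * p m) t s = vertex e p (dual t) (dual s)"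
proof -
  have "ket s = (\<lambda>t. ket (dual s) (dual t))" by (auto simp: ket_def fun_eq_iff) (metis dual_dual)
  then have "hexp e (\<lambda>m. - ((- 1) ^ m) * p m) N (ket s) t
    = hexp e (\<lambda>m. - ((- 1) ^ m) * (- ((- 1) ^ m) * p m)) N (ket (dual s)) (dual t)" for N
    using hexp_dual[OF assms] by metis
  then show ?thesis unfolding vertex_def graded_def by (simp flip: power_add mult_2 mult.assoc)
qed

lemma gram_dual: "gram (\<lambda>m. - ((- 1) ^ m) * p m) t v = gram p (dual t) (dual v)"
  unfolding gram_def
  by (rule infsum_reindex_bij_witness[of _ dual dual]) (simp_all only: vertex_dual dual_dual UNIV_I simp_thms)

section \<open>Square summability of vertex operators\<close>

text \<open>The coefficients of exp (sum_m a_m u^m / m).\<close>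

fun newton :: "(nat \<Rightarrow> 'a::field_char_0) \<Rightarrow> nat \<Rightarrow> 'a" where
  "newton a 0 = 1"
| "newton a (Suc n) = (\<Sum>m\<le>n. a (Suc m) * newton a (n - m)) / of_nat (Suc n)"

lemma newton_rec: "of_nat j * newton a j = (\<Sum>m=1..j. a m * newton a (j - m))"
proof (cases j)
  case (Suc n)
  have "(\<Sum>m\<le>n. a (Suc m) * newton a (n - m)) = (\<Sum>m=1..j. a m * newton a (j - m))"
    by (rule sum.reindex_bij_witness[of _ "\<lambda>m. m - 1" Suc]) (auto simp: Suc)
  then show ?thesis unfolding Suc by (simp del: of_nat_Suc)
qed simp

text \<open>The intertwined family has J_m at index 0 and the identity at index \<open>m\<close>.
  The Heisenberg relation shifts the first to the second with \<open>\<kappa> m = - m\<close>, so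
  only \<open>g 0 = 1\<close> and \<open>g m = - p m\<close> enter.\<close>

lemma current_hexp_opposite:
  assumes "1 \<le> m"
  shows "current (int m) (hexp (-1) p N v) t
    = hexp (-1) p N (current (int m) v) t + (if m \<le> N then p m * hexp (-1) p (N - m) v t else 0)"
proof -
  define X where "X i = (if i = 0 then current (int m) else if i = m then (\<lambda>v. v) else (\<lambda>_ _. 0))" for i
  define \<kappa> where "\<kappa> j = (if j = m then - of_nat m else 0 :: complex)" for j
  define g where "g = newton (\<lambda>l. p l * \<kappa> l)"
  have gm: "g m = - p m"
  proof -
    have "of_nat m * g m = (\<Sum>l=1..m. p l * \<kappa> l * g (m - l))" unfolding g_def by (rule newton_rec)
    also have "\<dots> = (\<Sum>l\<in>{m}. p l * \<kappa> l * g (m - l))"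
      by (rule sum.mono_neutral_right) (use assms in \<open>auto simp: \<kappa>_def\<close>)
    also have "\<dots> = of_nat m * - p m" by (simp add: \<kappa>_def g_def)
    finally show ?thesis using assms by (metis mult_left_cancel not_one_le_zero of_nat_eq_0_iff)
  qed
  have "hexp (-1) p N (X 0 v) t = (\<Sum>j\<le>N. g j * X (0 + j) (hexp (-1) p (N - j) v) t)"
  proof (rule hexp_intertwine[where \<kappa>=\<kappa>])
    show "rowfin (X i)" for i
      by (auto simp: X_def intro: rowfin_single[of _ "\<lambda>_. 1" id] rowfin_single[of _ "\<lambda>_. 0" id])
    show "current (- 1 * int j) (X i v) t = X i (current (- 1 * int j) v) t + \<kappa> j * X (i + j) v t"
      if "1 \<le> j" for j i v t
    proof (cases "i = 0")
      case True
      show ?thesis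
      proof (cases "j = m")
        case True
        then show ?thesis using \<open>i = 0\<close> that current_heisenberg[of "int m" v t] by (simp add: X_def \<kappa>_def)
      next
        case False
        then show ?thesis using \<open>i = 0\<close> that assms by (simp add: X_def \<kappa>_def current_commute)
      qed
    next
      case False
      then show ?thesis using assms that by (auto simp: X_def \<kappa>_def rowfin_zero)
    qed
    show "of_nat j * g j = (\<Sum>m=1..j. p m * \<kappa> m * g (j - m))" for j
      unfolding g_def by (rule newton_rec)
  qed (simp add: g_def)
  also have "\<dots> = (\<Sum>j\<in>{0, m} \<inter> {..N}. g j * X (0 + j) (hexp (-1) p (N - j) v) t)"
    by (rule sum.mono_neutral_right) (auto simp: X_def)
  also have "\<dots> = current (int m) (hexp (-1) p N v) t - (if m \<le> N then p m * hexp (-1) p (N - m) v t else 0)"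
    using assms gm by (auto simp: X_def Int_insert_left g_def)
  finally show ?thesis by (simp add: X_def)
qed

text \<open>Normal ordering of Gamma_+ Gamma_- in components: the exchange costs the Cauchy factor
  exp (sum_m p_m p'_m / m), distributed over the degrees.\<close>

lemma hexp_hexp:
  "hexp 1 p N (hexp (-1) p' M v) t
    = (\<Sum>i\<le>N. newton (\<lambda>m. p m * p' m) i * (if i \<le> M then hexp (-1) p' (M - i) (hexp 1 p (N - i) v) t else 0))"
proof -
  define X where "X i = (if i \<le> M then hexp (-1) p' (M - i) else (\<lambda>_ _. 0))" for i
  have "hexp 1 p N (X 0 v) t = (\<Sum>i\<le>N. newton (\<lambda>m. p m * p' m) i * X (0 + i) (hexp 1 p (N - i) v) t)"
  proof (rule hexp_intertwine[where \<kappa>=p'])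
    show "rowfin (X i)" for i
      by (auto simp: X_def intro: rowfin_single[of _ "\<lambda>_. 0" id])
    show "current (1 * int m) (X i v) t = X i (current (1 * int m) v) t + p' m * X (i + m) v t"
      if "1 \<le> m" for m i v t
      using that by (auto simp: X_def current_hexp_opposite rowfin_zero add.commute)
  qed (rule newton.simps newton_rec)+
  then show ?thesis by (simp add: X_def if_distrib[of "\<lambda>f. f _ t"] cong: if_cong)
qed

text \<open>For constant input the series is (1 - u)^-C, whose coefficients have a two-term
  recursion.\<close>

lemma newton_const_rec: "of_nat (Suc i) * newton (\<lambda>_. C) (Suc i) = (C + of_nat i) * newton (\<lambda>_. C) i"
proof -
  let ?d = "newton (\<lambda>_. C)"
  have S: "of_nat j * ?d j = C * (\<Sum>m<j. ?d m)" for j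
  proof -
    have "(\<Sum>m=1..j. C * ?d (j - m)) = (\<Sum>m<j. C * ?d m)"
      by (rule sum.reindex_bij_witness[of _ "\<lambda>m. j - m" "\<lambda>m. j - m"]) auto
    then show ?thesis unfolding newton_rec by (simp add: sum_distrib_left)
  qed
  show ?thesis unfolding S by (simp add: S[symmetric] distrib_left distrib_right)
qed

lemma newton_const_nonneg: "0 \<le> (C::real) \<Longrightarrow> 0 \<le> newton (\<lambda>_. C) i"
proof (induction i)
  case (Suc i)
  have "0 \<le> of_nat (Suc i) * newton (\<lambda>_. C) (Suc i)" unfolding newton_const_rec using Suc by simp
  then show ?case by (simp add: zero_le_mult_iff del: newton.simps)
qed simp

lemma newton_const_summable:
  assumes "0 \<le> (C::real)" "0 \<le> x" "x < 1"
  shows "summable (\<lambda>i. newton (\<lambda>_. C) i * x ^ i)"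
proof -
  \<comment> \<open>From this index on, the ratio x (C + n) / (n + 1) is at most the midpoint (1 +
    x) / 2 of x and 1.\<close>
  define N where "N = nat \<lceil>2 * C / (1 - x)\<rceil>"
  have le: "x * (C + real n) \<le> (1 + x) / 2 * real (Suc n)" if "N \<le> n" for n
  proof -
    have "2 * C / (1 - x) \<le> real n" using that unfolding N_def by linarith
    then have "2 * C \<le> real n * (1 - x)" using assms by (simp add: divide_le_eq)
    moreover have "x * C \<le> C" using assms by (simp add: mult_left_le_one_le)
    ultimately show ?thesis using assms by (simp add: algebra_simps)
  qed
  show ?thesis
  proof (rule summable_ratio_test[of "(1 + x) / 2" N])
    fix n assume n: "N \<le> n"
    let ?d = "newton (\<lambda>_. C)"
    have "real (Suc n) * (?d (Suc n) * x ^ Suc n) = (x * (C + real n)) * (?d n * x ^ n)"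
      using newton_const_rec[of n C] by (simp del: newton.simps of_nat_Suc add: mult.assoc[symmetric])
    also have "\<dots> \<le> (1 + x) / 2 * real (Suc n) * (?d n * x ^ n)"
      by (intro mult_right_mono le n) (use newton_const_nonneg[OF assms(1)] assms in auto)
    finally have "real (Suc n) * (?d (Suc n) * x ^ Suc n) \<le> real (Suc n) * ((1 + x) / 2 * (?d n * x ^ n))"
      by (simp only: mult_ac)
    then have "?d (Suc n) * x ^ Suc n \<le> (1 + x) / 2 * (?d n * x ^ n)"
      by (simp only: mult_le_cancel_left_pos of_nat_0_less_iff zero_less_Suc)
    moreover have "0 \<le> ?d m * x ^ m" for m using newton_const_nonneg[OF assms(1)] assms by simp
    ultimately show "norm (?d (Suc n) * x ^ Suc n) \<le> (1 + x) / 2 * norm (?d n * x ^ n)"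
      by (simp only: real_norm_def abs_of_nonneg)
  qed (use assms in simp)
qed

lemma newton_norm_le:
  fixes a :: "nat \<Rightarrow> complex"
  assumes "\<And>m. 1 \<le> m \<Longrightarrow> norm (a m) \<le> C"
  shows "norm (newton a i) \<le> newton (\<lambda>_. C) i"
proof (induction i rule: less_induct)
  case (less i)
  have C: "0 \<le> C" using assms[of 1] norm_ge_zero order_trans by blast
  show ?case
  proof (cases "i = 0")
    case False
    have "of_nat i * norm (newton a i) = norm (\<Sum>m=1..i. a m * newton a (i - m))"
      unfolding newton_rec[symmetric] by (simp add: norm_mult)
    also have "\<dots> \<le> (\<Sum>m=1..i. C * newton (\<lambda>_. C) (i - m))"
      by (rule sum_norm_le) (use less assms C in \<open>auto simp: norm_mult intro!: mult_mono\<close>)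
    also have "\<dots> = of_nat i * newton (\<lambda>_. C) i" by (rule newton_rec[symmetric])
    finally show ?thesis using False by simp
  qed simp
qed

text \<open>Summing \<open>|\<Gamma>\<^sub>+(u, v)|\<^sup>2\<close> over \<open>v\<close> of fixed energy gives a diagonal entry of \<open>\<Gamma>\<^sub>+ \<Gamma>\<^sub>-\<close>; after normal ordering only
  finitely many degrees of \<open>\<Gamma>\<^sub>- \<Gamma>\<^sub>+\<close> contribute, so the growth is that of the scalar Cauchy factor.\<close>

lemma vertex_square_summable:
  fixes p :: "nat \<Rightarrow> complex"
  assumes p: "\<And>m. 1 \<le> m \<Longrightarrow> norm (p m) ^ 2 \<le> C" and x: "0 \<le> x" "x < 1"
  shows "(\<lambda>v. norm (vertex 1 p u v) ^ 2 * x ^ nat (en v)) summable_on UNIV"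
proof -
  let ?c = "newton (\<lambda>m. p m * cnj (p m))" and ?d = "newton (\<lambda>_. C)"
  let ?h = "\<lambda>N v. norm (hexp 1 p N (ket v) u) ^ 2"
  \<comment> \<open>After normal ordering, the diagonal entry at \<open>u\<close> splits into Cauchy
    coefficients, bounded by \<open>?d\<close>, and these entries, which vanish beyond the energy of
    \<open>u\<close>.\<close>
  define D where "D j = norm (hexp (-1) (\<lambda>m. cnj (p m)) j (hexp 1 p j (ket u)) u)" for j
  define S where "S = (\<Sum>i. ?d i * x ^ i)"
  define E where "E = (\<Sum>j\<le>nat (en u). D j)"
  have C0: "0 \<le> C" using p[of 1] by (meson dual_order.trans le_refl zero_le_power2)
  have cd: "norm (?c i) \<le> ?d i" for i
    by (rule newton_norm_le) (use p in \<open>auto simp: norm_mult power2_eq_square\<close>)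
  have D0: "D j = 0" if "nat (en u) < j" for j
  proof -
    have "hexp 1 p j (ket u) w = 0" for w
      by (rule hexp_ket_zero) (use that en_nonneg[of w] in linarith)
    then have "hexp 1 p j (ket u) = (\<lambda>_. 0)" by blast
    then show ?thesis unfolding D_def by (simp add: rowfin_zero)
  qed
  \<comment> \<open>The sum is the diagonal entry of the degree \<open>N\<close> component times its
    Hermitian adjoint, which has conjugated parameters and the opposite sign.\<close>
  have T: "((\<lambda>v. of_real (?h N v)) has_sum (\<Sum>i\<le>N. ?c i * hexp (-1) (\<lambda>m. cnj (p m)) (N - i) (hexp 1 p (N - i) (ket u)) u)) UNIV" for N
  proof -
    have "((\<lambda>v. hexp 1 p N (ket v) u * hexp (-1) (\<lambda>m. cnj (p m)) N (ket u) v)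
      has_sum hexp 1 p N (hexp (-1) (\<lambda>m. cnj (p m)) N (ket u)) u) UNIV"
      by (rule rowfin_ket_has_sum) simp
    moreover have "hexp (-1) (\<lambda>m. cnj (p m)) N (ket u) v = cnj (hexp 1 p N (ket v) u)" for v
      using hexp_adjoint[of "-1" "\<lambda>m. cnj (p m)" N u v] by (simp add: cnj_hexp cnj_ket)
    moreover have "of_real (?h N v) = hexp 1 p N (ket v) u * cnj (hexp 1 p N (ket v) u)" for v
      by (rule complex_norm_square)
    ultimately show ?thesis by (simp add: hexp_hexp cong: if_cong)
  qed
  have F: "(\<Sum>v\<in>F. ?h N v) \<le> (\<Sum>i\<le>N. ?d i * D (N - i))" if "finite F" for F N
  proof -
    have s: "((\<lambda>v. ?h N v) has_sum Re (\<Sum>i\<le>N. ?c i * hexp (-1) (\<lambda>m. cnj (p m)) (N - i) (hexp 1 p (N - i) (ket u)) u)) UNIV"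
      using has_sum_Re[OF T[of N]] by simp
    have "(\<Sum>v\<in>F. ?h N v) \<le> Re (\<Sum>i\<le>N. ?c i * hexp (-1) (\<lambda>m. cnj (p m)) (N - i) (hexp 1 p (N - i) (ket u)) u)"
      by (rule has_sum_mono_neutral[OF has_sum_finite[OF that] s]) auto
    also have "\<dots> \<le> norm (\<Sum>i\<le>N. ?c i * hexp (-1) (\<lambda>m. cnj (p m)) (N - i) (hexp 1 p (N - i) (ket u)) u)"
      by (rule complex_Re_le_cmod)
    also have "\<dots> \<le> (\<Sum>i\<le>N. ?d i * D (N - i))"
      by (rule sum_norm_le) (auto simp: norm_mult D_def intro!: mult_right_mono cd)
    finally show ?thesis .
  qed
  show ?thesis
  proof (rule nonneg_bdd_above_summable_on)
    show "bdd_above (sum (\<lambda>v. norm (vertex 1 p u v) ^ 2 * x ^ nat (en v)) ` {F. F \<subseteq> UNIV \<and> finite F})"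
    proof (rule bdd_aboveI2)
      fix F :: "maya_state set" assume "F \<in> {F. F \<subseteq> UNIV \<and> finite F}"
      then have fin: "finite F" by simp
      \<comment> \<open>At least every energy in \<open>F\<close>, hence at least every degree that
        occurs.\<close>
      define M where "M = (\<Sum>v\<in>F. nat (en v))"
      have M: "nat (en v) \<le> M" if "v \<in> F" for v unfolding M_def using fin that by (rule member_le_sum[rotated 2]) simp
      have "(\<Sum>v\<in>F. norm (vertex 1 p u v) ^ 2 * x ^ nat (en v)) \<le> (\<Sum>v\<in>F. \<Sum>N\<le>M. ?h N v * x ^ N)"
      proof (rule sum_mono)
        fix v assume v: "v \<in> F"
        show "norm (vertex 1 p u v) ^ 2 * x ^ nat (en v) \<le> (\<Sum>N\<le>M. ?h N v * x ^ N)"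
        proof (cases "\<exists>N. en v = en u + 1 * int N")
          case True
          then obtain N where N: "en v = en u + 1 * int N" by blast
          have "N \<le> nat (en v)" using N en_nonneg[of u] by linarith
          then have "N \<le> M" and "x ^ nat (en v) \<le> x ^ N" using M[OF v] x by (auto intro: power_decreasing)
          then have "norm (vertex 1 p u v) ^ 2 * x ^ nat (en v) \<le> ?h N v * x ^ N"
            unfolding vertex_eq[OF one_neq_zero N] by (intro mult_left_mono) auto
          also have "\<dots> \<le> (\<Sum>N\<le>M. ?h N v * x ^ N)"
            by (rule member_le_sum) (use \<open>N \<le> M\<close> x in auto)
          finally show ?thesis .
        next
          case False
          then have "vertex 1 p u v = 0" by (intro vertex_zero_en) blast
          then show ?thesis using x by (simp add: sum_nonneg)
        qed
      qed
      also have "\<dots> = (\<Sum>N\<le>M. (\<Sum>v\<in>F. ?h N v) * x ^ N)"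
        by (subst sum.swap) (simp add: sum_distrib_right)
      also have "\<dots> \<le> (\<Sum>N\<le>M. (\<Sum>i\<le>N. ?d i * D (N - i)) * x ^ N)"
        by (intro sum_mono mult_right_mono F fin) (use x in auto)
      also have "\<dots> = (\<Sum>N\<le>M. \<Sum>i\<le>N. (?d i * x ^ i) * (D (N - i) * x ^ (N - i)))"
        unfolding sum_distrib_right
      proof (intro sum.cong refl)
        fix N i :: nat assume "i \<in> {..N}"
        then have "x ^ N = x ^ i * x ^ (N - i)" by (simp flip: power_add)
        then show "?d i * D (N - i) * x ^ N = (?d i * x ^ i) * (D (N - i) * x ^ (N - i))" by (simp only: mult_ac)
      qed
      also have "\<dots> = (\<Sum>(N, i)\<in>Sigma {..M} (\<lambda>N. {..N}). (?d i * x ^ i) * (D (N - i) * x ^ (N - i)))"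
        by (rule sum.Sigma) auto
      also have "\<dots> = (\<Sum>(i, j)\<in>{(i, j). i + j \<le> M}. (?d i * x ^ i) * (D j * x ^ j))"
        by (rule sum.reindex_bij_witness[of _ "\<lambda>(i, j). (i + j, i)" "\<lambda>(N, i). (i, N - i)"]) auto
      also have "\<dots> \<le> (\<Sum>(i, j)\<in>{..M} \<times> {..M}. (?d i * x ^ i) * (D j * x ^ j))"
        by (rule sum_mono2) (use newton_const_nonneg[OF C0] x in \<open>auto simp: D_def\<close>)
      also have "\<dots> = (\<Sum>i\<le>M. ?d i * x ^ i) * (\<Sum>j\<le>M. D j * x ^ j)"
        by (simp add: sum_product sum.cartesian_product)
      also have "\<dots> \<le> S * E"
      proof (rule mult_mono)
        show "(\<Sum>i\<le>M. ?d i * x ^ i) \<le> S"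
          unfolding S_def using newton_const_nonneg[OF C0] x
          by (intro sum_le_suminf newton_const_summable C0) auto
        show "0 \<le> S" unfolding S_def using newton_const_nonneg[OF C0] x
          by (intro suminf_nonneg newton_const_summable C0) auto
        have "(\<Sum>j\<le>M. D j * x ^ j) \<le> (\<Sum>j\<le>M. D j)"
          by (intro sum_mono) (use x in \<open>auto simp: D_def intro!: mult_left_le power_le_one\<close>)
        also have "\<dots> \<le> (\<Sum>j\<le>max M (nat (en u)). D j)"
          by (rule sum_mono2) (auto simp: D_def)
        also have "\<dots> = E" unfolding E_def
          by (rule sum.mono_neutral_right) (auto intro: D0)
        finally show "(\<Sum>j\<le>M. D j * x ^ j) \<le> E" .
        show "0 \<le> (\<Sum>j\<le>M. D j * x ^ j)" using x by (auto simp: D_def intro!: sum_nonneg)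
      qed
      finally show "(\<Sum>v\<in>F. norm (vertex 1 p u v) ^ 2 * x ^ nat (en v)) \<le> S * E" .
    qed
  qed (use x in auto)
qed

text \<open>From ab \<le> a^2 + b^2 and square summability at x = |Q|; this is where |Q| < 1
  enters.\<close>

lemma vertex_pair_summable:
  fixes p p' :: "nat \<Rightarrow> complex"
  assumes "\<And>m. 1 \<le> m \<Longrightarrow> norm (p m) ^ 2 \<le> C" "\<And>m. 1 \<le> m \<Longrightarrow> norm (p' m) ^ 2 \<le> C" "norm Q < 1"
  shows "(\<lambda>v. vertex 1 p u v * Q powi en v * vertex 1 p' w v) summable_on UNIV"
proof (rule abs_summable_summable, rule summable_on_comparison_test)
  let ?a = "\<lambda>v. norm (vertex 1 p u v)" and ?b = "\<lambda>v. norm (vertex 1 p' w v)"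
  show "(\<lambda>v. ?a v ^ 2 * norm Q ^ nat (en v) + ?b v ^ 2 * norm Q ^ nat (en v)) summable_on UNIV"
    by (intro summable_on_add vertex_square_summable) (use assms in auto)
  fix v
  have "?a v * ?b v \<le> ?a v ^ 2 + ?b v ^ 2"
    using sum_squares_bound[of "?a v" "?b v"] mult_nonneg_nonneg[OF norm_ge_zero norm_ge_zero, of "vertex 1 p u v" "vertex 1 p' w v"]
    by linarith
  then have "?a v * ?b v * norm Q ^ nat (en v) \<le> (?a v ^ 2 + ?b v ^ 2) * norm Q ^ nat (en v)"
    by (rule mult_right_mono) simp
  moreover have "norm (vertex 1 p u v * Q powi en v * vertex 1 p' w v) = ?a v * ?b v * norm Q ^ nat (en v)"
    using en_nonneg[of v] by (simp add: norm_mult norm_power power_int_def)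
  ultimately show "norm (vertex 1 p u v * Q powi en v * vertex 1 p' w v)
    \<le> ?a v ^ 2 * norm Q ^ nat (en v) + ?b v ^ 2 * norm Q ^ nat (en v)"
    by (simp only: distrib_right)
qed simp

section \<open>Horizontal strips\<close>

lemma annih_ket: "annih b (ket v) = (\<lambda>t. (if b \<in> occ v then sg v b else 0) * ket (del b v) t)"
  by (rule ext) (simp add: create_ket[symmetric], auto simp: create_ket[symmetric] create_def ket_def)

text \<open>Gamma_+(z) annih_b = (annih_b - z annih_(b-1)) Gamma_+(z), read off in entries: the
  commutator of J_m with an annihilator is minus a shift, and exp (- sum_m z^m u^m / m) = 1 - z
  u.\<close>

lemma vertex_annih:
  fixes z :: complex
  defines "V \<equiv> vertex 1 (\<lambda>m. z ^ m)"
  shows "(if b \<in> occ v then sg v b * V u (del b v) else 0)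
    = (if b \<notin> occ u then sg u b * V (ins b u) v else 0)
      - z * (if b - 1 \<notin> occ u then sg u (b - 1) * V (ins (b - 1) u) v else 0)"
proof -
  let ?p = "\<lambda>m. z ^ m :: complex"
  define g where "g j = (if j = 0 then 1 else if j = 1 then - z else 0)" for j :: nat
  have g: "of_nat j * g j = (\<Sum>m=1..j. ?p m * - 1 * g (j - m))" for j
  proof (cases "j \<le> 1")
    case True then show ?thesis by (cases j) (auto simp: g_def)
  next
    case False
    then obtain i where j: "j = Suc (Suc i)" by (metis One_nat_def not_less_eq_eq old.nat.exhaust le0)
    have "(\<Sum>m=1..j. ?p m * - 1 * g (j - m)) = (\<Sum>m\<in>{Suc i, j}. ?p m * - 1 * g (j - m))"
      by (rule sum.mono_neutral_right) (auto simp: g_def j)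
    then show ?thesis by (simp add: j g_def)
  qed
  have I: "hexp 1 ?p N (annih b w) u = annih b (hexp 1 ?p N w) u
      - z * (if 1 \<le> N then annih (b - 1) (hexp 1 ?p (N - 1) w) u else 0)" for N w
  proof -
    have "hexp 1 ?p N (annih (b - int 0) w) u = (\<Sum>j\<le>N. g j * annih (b - int (0 + j)) (hexp 1 ?p (N - j) w) u)"
      by (rule hexp_intertwine[where X="\<lambda>i. annih (b - int i)" and \<kappa>="\<lambda>_. - 1", OF _ _ _ g])
         (simp_all add: current_annih g_def algebra_simps)
    also have "\<dots> = (\<Sum>j\<in>{0, 1} \<inter> {..N}. g j * annih (b - int (0 + j)) (hexp 1 ?p (N - j) w) u)"
      by (rule sum.mono_neutral_right) (auto simp: g_def)
    finally show ?thesis by (auto simp: Int_insert_left g_def)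
  qed
  let ?A = "\<lambda>x w. if x \<notin> occ u then sg u x * w (ins x u) else 0"
  show ?thesis
  proof (cases "0 \<le> en v + b - en u")
    case False
    have "V u (del b v) = 0" if "b \<in> occ v"
      unfolding V_def by (rule vertex_zero_en) (use that False in \<open>simp add: mom_del\<close>)
    moreover have "V (ins b u) v = 0" if "b \<notin> occ u"
      unfolding V_def by (rule vertex_zero_en) (use that False in \<open>simp add: mom_ins\<close>)
    moreover have "V (ins (b - 1) u) v = 0" if "b - 1 \<notin> occ u"
      unfolding V_def by (rule vertex_zero_en) (use that False in \<open>simp add: mom_ins\<close>)
    ultimately show ?thesis by auto
  next
    case True
    then obtain N where N: "en v + b - en u = int N" using nonneg_int_cases by blast
    have 1: "hexp 1 ?p N (annih b (ket v)) u = (if b \<in> occ v then sg v b * V u (del b v) else 0)"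
      unfolding annih_ket V_def
      by (subst rowfin_scale) (use N in \<open>auto simp: mom_del vertex_eq[of 1 "del b v" u N]\<close>)
    have 2: "annih b (hexp 1 ?p N (ket v)) u = (if b \<notin> occ u then sg u b * V (ins b u) v else 0)"
      unfolding V_def using N by (auto simp: annih_def mom_ins vertex_eq[of 1 v "ins b u" N])
    have 3: "(if 1 \<le> N then annih (b - 1) (hexp 1 ?p (N - 1) (ket v)) u else 0)
       = (if b - 1 \<notin> occ u then sg u (b - 1) * V (ins (b - 1) u) v else 0)"
    proof (cases "1 \<le> N")
      case True
      then show ?thesis
        unfolding V_def using N by (auto simp: annih_def mom_ins of_nat_diff vertex_eq[of 1 v "ins (b - 1) u" "N - 1"])
    next
      case False
      have "V (ins (b - 1) u) v = 0" if "b - 1 \<notin> occ u"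
        unfolding V_def by (rule vertex_zero_en) (use that N False in \<open>simp add: mom_ins\<close>)
      then show ?thesis using False by auto
    qed
    show ?thesis using I[of N "ket v"] unfolding 1 2 3 .
  qed
qed

definition list_state :: "int \<Rightarrow> int list \<Rightarrow> maya_state" where "list_state M vs = mk_maya_state (set vs \<union> {M..})"

lemma occ_list_state [simp]: "occ (list_state M vs) = set vs \<union> {M..}"
proof -
  have "maya (set vs \<union> {M..})" unfolding maya_def
  proof (intro conjI)
    show "\<exists>a. \<forall>j\<in>set vs \<union> {M..}. a \<le> j"
      by (rule exI[of _ "Min (insert M (set vs))"]) (auto simp: Min_le_iff)
  qed auto
  then show ?thesis by (simp add: list_state_def occ_mk_maya_state)
qed

text \<open>The weight of a horizontal strip in terms of particle positions: \<open>v\<^sub>1 \<le> u\<^sub>1 < v\<^sub>2 \<le> u\<^sub>2 < \<dots>\<close>.\<close>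

fun strip :: "complex \<Rightarrow> int list \<Rightarrow> int list \<Rightarrow> complex" where
  "strip z [] [] = 1"
| "strip z [t] (b # us) = (if t \<le> b then z ^ nat (b - t) else 0)"
| "strip z (t # t' # ts) (b # us) = (if t \<le> b \<and> b < t' then z ^ nat (b - t) * strip z (t' # ts) us else 0)"
| "strip z _ _ = 0"

text \<open>The recursion of \<open>vertex_annih\<close> in the lowest position \<open>b\<close> of
  the left state. Only the two lowest particles of \<open>vs\<close> matter, so the cases are the
  places of \<open>b\<close> relative to them.\<close>

lemma strip_rec:
  assumes "sorted_wrt (<) vs" "\<And>x. x \<in> set us \<Longrightarrow> b < x" "length vs = Suc (length us)"
  shows "strip z vs (b # us) = z * strip z vs ((b - 1) # us)
    + (if b \<in> set vs then (- 1) ^ card {i \<in> set vs. i < b} * strip z (remove1 b vs) us else 0)"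
proof -
  obtain t ts where vs: "vs = t # ts" using assms(3) by (cases vs) auto
  have pw: "z * z ^ nat (b - 1 - t) = z ^ nat (b - t)" if "t < b"
  proof -
    have "nat (b - t) = Suc (nat (b - 1 - t))" using that by linarith
    then show ?thesis by simp
  qed
  show ?thesis
  proof (cases ts)
    case Nil
    then have us: "us = []" using assms(3) vs by simp
    consider "b < t" | "b = t" | "t < b" by linarith
    moreover have "{i. i = t \<and> i < t} = {}" by auto
    ultimately show ?thesis unfolding vs Nil us by cases (use pw in \<open>auto simp del: Collect_empty_eq\<close>)
  next
    case (Cons t' ts')
    then obtain b' us' where us: "us = b' # us'" using assms(3) vs by (cases us) auto
    have tt: "t < t'" "\<And>x. x \<in> set ts' \<Longrightarrow> t' < x" and bb: "b < b'" using assms vs Cons us by auto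
    consider "b < t" | "b = t" | "t < b" "b < t'" | "b = t'" | "t' < b" by linarith
    then show ?thesis
    proof cases
      case 1
      then have "b \<notin> set vs" using tt vs Cons by force
      then show ?thesis using 1 by (simp add: vs Cons)
    next
      case 2
      have "{i. (i = t \<or> i = t' \<or> i \<in> set ts') \<and> i < t} = {}" using tt by force
      then have c: "card {i. (i = t \<or> i = t' \<or> i \<in> set ts') \<and> i < t} = 0" by (simp only: card.empty)
      show ?thesis using 2 tt by (simp add: vs Cons c)
    next
      case 3
      then have "b \<notin> set vs" using tt vs Cons by force
      then show ?thesis using 3 tt pw by (simp add: vs Cons mult.assoc[symmetric])
    next
      \<comment> \<open>The interlacing fails at \<open>b = t'\<close>, so the left side is 0; the
        one particle below \<open>b\<close> gives a minus sign, and the two terms on the right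
        cancel.\<close>
      case 4
      have "{i \<in> set vs. i < b} = {t}" using 4 tt vs Cons by force
      moreover have "z * (z ^ nat (t' - 1 - t) * strip z (t' # ts') us) = strip z (t # ts') us"
      proof -
        have e: "z ^ nat (t' - t) * z ^ nat (b' - t') = z ^ nat (b' - t)"
          using tt bb 4 by (simp flip: power_add nat_add_distrib)
        have "z * (z ^ nat (t' - 1 - t) * strip z (t' # ts') us) = z ^ nat (t' - t) * strip z (t' # ts') us"
          using pw 4 tt by (simp flip: mult.assoc)
        also have "\<dots> = strip z (t # ts') us"
          unfolding us using bb 4 tt e by (cases ts') (auto simp flip: mult.assoc)
        finally show ?thesis .
      qed
      ultimately show ?thesis using 4 tt by (simp add: vs Cons)
    next
      case 5
      then have "remove1 b vs = t # t' # remove1 b ts'" using tt vs Cons by auto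
      then show ?thesis using 5 tt bb by (simp add: vs Cons us)
    qed
  qed
qed

text \<open>Induction on the number of particles below \<open>M\<close>. For a fixed number, the
  lowest position of the left state is raised step by step from \<open>t - 1\<close>, where both
  sides vanish, and \<open>rec\<close> agrees with \<open>strip_rec\<close>.\<close>

lemma vertex_strip:
  assumes "sorted_wrt (<) vs" "\<And>x. x \<in> set vs \<Longrightarrow> x < M" "sorted_wrt (<) us" "\<And>x. x \<in> set us \<Longrightarrow> x < M"
    "length vs = length us"
  shows "vertex 1 (\<lambda>m. z ^ m) (list_state M us) (list_state M vs) = strip z vs us"
  using assms
proof (induction us arbitrary: vs)
  case Nil
  then show ?case using vertex_eq[of 1 "list_state M []" "list_state M []" 0 "\<lambda>m. z ^ m"] by (simp add: ket_def)
next
  case (Cons b0 us)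
  let ?V = "vertex 1 (\<lambda>m. z ^ m)" and ?v = "list_state M vs"
  obtain t ts where vs: "vs = t # ts" using Cons.prems(5) by (cases vs) auto
  have tmin: "t \<le> x" if "x \<in> occ ?v" for x
    using that Cons.prems(1,2) unfolding vs by force
  have sg1: "sg (list_state M us) b = 1" "b \<notin> occ (list_state M us)" "ins b (list_state M us) = list_state M (b # us)" if "b \<le> b0" for b
  proof -
    have lt: "\<not> x < b" "b \<noteq> x" if "x \<in> set us \<union> {M..}" for x
      using that \<open>b \<le> b0\<close> Cons.prems(3) Cons.prems(4)[of b0] by auto
    then have "{i \<in> occ (list_state M us). i < b} = {}" by auto
    then show "sg (list_state M us) b = 1" by (simp only: fsign_def card.empty power_0)
    show "b \<notin> occ (list_state M us)" using lt by auto
    show "ins b (list_state M us) = list_state M (b # us)" by (rule maya_state_eqI) auto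
  qed
  have rec: "?V (list_state M (b # us)) ?v = z * ?V (list_state M ((b - 1) # us)) ?v
     + (if b \<in> occ ?v then sg ?v b * ?V (list_state M us) (del b ?v) else 0)" if "b \<le> b0" for b
    using vertex_annih[where b=b and v="?v" and u="list_state M us" and z=z] that
    by (simp add: sg1 del: occ_list_state)
  \<comment> \<open>Below the lowest particle \<open>t\<close> of the right state, each step down
    only splits off a factor \<open>z\<close>; after enough steps the left state has more energy
    than the right one and the entry vanishes.\<close>
  have low: "?V (list_state M (b # us)) ?v = 0" if "b < t" "b \<le> b0" for b
  proof -
    have "?V (list_state M (b # us)) ?v = z ^ n * ?V (list_state M ((b - int n) # us)) ?v" for n
    proof (induction n)
      case (Suc n)
      have "b - int n \<notin> occ ?v" using tmin[of "b - int n"] that by auto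
      then have "?V (list_state M ((b - int n) # us)) ?v = z * ?V (list_state M ((b - int (Suc n)) # us)) ?v"
        using rec[of "b - int n"] that by (simp add: algebra_simps del: occ_list_state)
      then show ?case using Suc by simp
    qed simp
    note eq = this[of "nat (en ?v - en (list_state M us) + b + 1)"]
    let ?n = "nat (en ?v - en (list_state M us) + b + 1)"
    have "en (list_state M ((b - int ?n) # us)) = en (list_state M us) - (b - int ?n)"
      using sg1[of "b - int ?n"] that mom_ins[of "b - int ?n" "list_state M us" uminus] by simp
    then have "en ?v < en (list_state M ((b - int ?n) # us))" by linarith
    then have "?V (list_state M ((b - int ?n) # us)) ?v = 0" by (intro vertex_zero_en) simp
    then show ?thesis using eq by simp
  qed
  have "b \<le> b0 \<Longrightarrow> ?V (list_state M (b # us)) ?v = strip z vs (b # us)" if "t - 1 \<le> b" for b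
    using that
  proof (induction b rule: int_ge_induct)
    case base
    have "strip z vs ((t - 1) # us) = 0" unfolding vs by (cases ts) auto
    then show ?case using low base by simp
  next
    case (step b)
    have bM: "b + 1 < M" using step.prems Cons.prems(4)[of b0] by simp
    have us': "x \<in> set us \<Longrightarrow> b + 1 < x" for x using step.prems Cons.prems(3) by auto
    have mem: "b + 1 \<in> occ ?v \<longleftrightarrow> b + 1 \<in> set vs" using bM by auto
    have sg': "sg ?v (b + 1) = (- 1) ^ card {i \<in> set vs. i < b + 1}"
    proof -
      have "{i \<in> occ ?v. i < b + 1} = {i \<in> set vs. i < b + 1}" using bM by auto
      then show ?thesis by (simp add: fsign_def del: occ_list_state)
    qed
    have IH: "?V (list_state M us) (del (b + 1) ?v) = strip z (remove1 (b + 1) vs) us" if "b + 1 \<in> set vs"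
    proof -
      have dist: "distinct vs" using Cons.prems(1) by (simp add: strict_sorted_iff)
      have "del (b + 1) ?v = list_state M (remove1 (b + 1) vs)"
        by (rule maya_state_eqI) (use bM dist in auto)
      moreover have "sorted_wrt (<) (remove1 (b + 1) vs)"
        using Cons.prems(1) by (simp add: strict_sorted_iff sorted_remove1)
      moreover have "x < M" if "x \<in> set (remove1 (b + 1) vs)" for x
        using that Cons.prems(2) set_remove1_subset by fastforce
      ultimately show ?thesis
        using Cons.IH[of "remove1 (b + 1) vs"] Cons.prems that by (simp add: length_remove1)
    qed
    have "?V (list_state M ((b + 1) # us)) ?v = z * ?V (list_state M (b # us)) ?v
      + (if b + 1 \<in> set vs then (- 1) ^ card {i \<in> set vs. i < b + 1} * strip z (remove1 (b + 1) vs) us else 0)"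
      using rec[OF step.prems] mem sg' IH by (simp del: occ_list_state)
    also have "?V (list_state M (b # us)) ?v = strip z vs (b # us)" using step by simp
    finally show ?case using strip_rec[of vs us "b + 1" z] Cons.prems(1,5) us' by simp
  qed
  moreover have "?V (list_state M (b0 # us)) ?v = strip z vs (b0 # us)" if "\<not> t - 1 \<le> b0"
  proof -
    have "strip z vs (b0 # us) = 0" unfolding vs using that by (cases ts) auto
    then show ?thesis using low[of b0] that by simp
  qed
  ultimately show ?case by blast
qed

text \<open>Closed form of the recursive weight: exponents add up, and the conditions become
  interlacing.\<close>

lemma strip_map:
  assumes "a \<le> n"
  shows "strip z (map f [a..<n]) (map g [a..<n])
    = (if \<forall>i\<in>{a..<n}. f i \<le> g i \<and> (Suc i < n \<longrightarrow> g i < f (Suc i)) then z ^ nat (\<Sum>i=a..<n. g i - f i) else 0)"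
  using assms
proof (induction a rule: inc_induct)
  case (step a)
  show ?case
  proof (cases "Suc a = n")
    case True
    then show ?thesis using step by (auto simp: upt_rec[of a n])
  next
    case False
    then have lt: "Suc a < n" using step by simp
    have l: "[a..<n] = a # Suc a # [Suc (Suc a)..<n]" "[Suc a..<n] = Suc a # [Suc (Suc a)..<n]"
      using lt by (simp_all add: upt_rec)
    let ?P = "\<lambda>i. f i \<le> g i \<and> (Suc i < n \<longrightarrow> g i < f (Suc i))"
    have "strip z (map f [a..<n]) (map g [a..<n])
      = (if f a \<le> g a \<and> g a < f (Suc a) then z ^ nat (g a - f a) * strip z (map f [Suc a..<n]) (map g [Suc a..<n]) else 0)"
      unfolding l by simp
    also have "\<dots> = (if ?P a \<and> (\<forall>i\<in>{Suc a..<n}. ?P i)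
      then z ^ nat (g a - f a) * z ^ nat (\<Sum>i=Suc a..<n. g i - f i) else 0)"
      unfolding step.IH using lt by auto
    also have "(?P a \<and> (\<forall>i\<in>{Suc a..<n}. ?P i)) \<longleftrightarrow> (\<forall>i\<in>{a..<n}. ?P i)"
    proof -
      have ins: "{a..<n} = insert a {Suc a..<n}" using lt by auto
      show ?thesis unfolding ins by blast
    qed
    finally have F: "strip z (map f [a..<n]) (map g [a..<n])
      = (if \<forall>i\<in>{a..<n}. ?P i then z ^ nat (g a - f a) * z ^ nat (\<Sum>i=Suc a..<n. g i - f i) else 0)" .
    have G: "z ^ nat (g a - f a) * z ^ nat (\<Sum>i=Suc a..<n. g i - f i) = z ^ nat (\<Sum>i=a..<n. g i - f i)"
      if "\<forall>i\<in>{a..<n}. ?P i"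
    proof -
      have "(\<Sum>i=a..<n. g i - f i) = (g a - f a) + (\<Sum>i=Suc a..<n. g i - f i)"
        using step by (simp add: sum.atLeast_Suc_lessThan)
      moreover have "0 \<le> (\<Sum>i=Suc a..<n. g i - f i)" "0 \<le> g a - f a" using that step by (auto intro!: sum_nonneg)
      ultimately show ?thesis by (simp add: nat_add_distrib power_add)
    qed
    show ?thesis unfolding F by (rule if_cong[OF refl G refl])
  qed
qed simp

section \<open>Partitions and states of fixed charge\<close>

text \<open>Rows are numbered from 0 and the vacuum occupies the positions \<open>i - s\<close>;
  lengthening row \<open>i\<close> pushes its particle down, which raises the energy.\<close>

definition part_state :: "(nat \<Rightarrow> nat) \<Rightarrow> int \<Rightarrow> maya_state" where
  "part_state lam s = mk_maya_state (range (\<lambda>i. int i - s - int (lam i)))"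

lemma partition_antimono: "lam \<in> partitions \<Longrightarrow> i \<le> j \<Longrightarrow> lam j \<le> lam i"
  unfolding partitions_def by (auto intro: lift_Suc_antimono_le)

lemma partition_bound:
  assumes "lam \<in> partitions" obtains n where "\<forall>i\<ge>n. lam i = 0"
proof -
  have "finite {i. lam i \<noteq> 0}" using assms by (simp add: partitions_def)
  then obtain m where m: "\<forall>i\<in>{i. lam i \<noteq> 0}. i \<le> m" unfolding finite_nat_set_iff_bounded_le by blast
  show thesis
  proof (rule that[of "Suc m"], intro allI impI)
    fix i assume "Suc m \<le> i"
    then have "\<not> i \<le> m" by simp
    then show "lam i = 0" using m by blast
  qed
qed

definition parts :: "(nat \<Rightarrow> nat) \<Rightarrow> int \<Rightarrow> nat \<Rightarrow> int list" where
  "parts lam s n = map (\<lambda>i. int i - s - int (lam i)) [0..<n]"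

lemma parts_props:
  assumes "lam \<in> partitions"
  shows "sorted_wrt (<) (parts lam s n)" "x \<in> set (parts lam s n) \<Longrightarrow> x < int n - s" "length (parts lam s n) = n"
  using partition_antimono[OF assms]
  by (auto simp: parts_def sorted_wrt_iff_nth_less) (smt (verit) less_imp_le_nat of_nat_less_iff of_nat_mono)

lemma range_parts:
  assumes "\<forall>i\<ge>n. lam i = 0"
  shows "range (\<lambda>i. int i - s - int (lam i)) = set (parts lam s n) \<union> {int n - s..}"
proof -
  have "UNIV = {0..<n} \<union> {n..}" by auto
  then have "range (\<lambda>i. int i - s - int (lam i)) = (\<lambda>i. int i - s - int (lam i)) ` {0..<n} \<union> (\<lambda>i. int i - s) ` {n..}"
    using assms by (metis (no_types, lifting) atLeast_iff image_Un image_cong of_nat_0 diff_zero)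
  also have "(\<lambda>i. int i - s) ` {n..} = {int n - s..}"
  proof (intro equalityI subsetI)
    fix x assume "x \<in> {int n - s..}"
    then show "x \<in> (\<lambda>i. int i - s) ` {n..}" by (intro image_eqI[of _ _ "nat (x + s)"]) auto
  qed auto
  finally show ?thesis by (simp add: parts_def)
qed

lemma part_state_list_state:
  assumes "\<forall>i\<ge>n. lam i = 0"
  shows "part_state lam s = list_state (int n - s) (parts lam s n)"
  unfolding part_state_def list_state_def range_parts[OF assms] ..

lemma occ_part_state: "lam \<in> partitions \<Longrightarrow> occ (part_state lam s) = range (\<lambda>i. int i - s - int (lam i))"
proof -
  assume "lam \<in> partitions"
  then obtain n where n: "\<forall>i\<ge>n. lam i = 0" using partition_bound by metis
  show ?thesis unfolding part_state_list_state[OF n] occ_list_state range_parts[OF n] ..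
qed

lemma mom_list_state:
  assumes "sorted_wrt (<) vs" "\<And>x. x \<in> set vs \<Longrightarrow> x < M" "0 \<le> M"
  shows "mom f (list_state M vs) = sum_list (map f vs) - (\<Sum>a\<in>{0..<M}. f a)"
proof -
  have dist: "distinct vs" using assms(1) by (simp add: strict_sorted_iff)
  let ?B = "{a \<in> set vs. 0 \<le> a}" and ?A = "{a \<in> set vs. a < 0}"
  have "{a. a \<in> occ (list_state M vs) \<and> a < 0} = ?A" using assms(3) by auto
  moreover have "{a. a \<notin> occ (list_state M vs) \<and> 0 \<le> a} = {0..<M} - ?B" by auto
  moreover have "(\<Sum>a\<in>{0..<M} - ?B. f a) = (\<Sum>a\<in>{0..<M}. f a) - (\<Sum>a\<in>?B. f a)"
    by (rule sum_diff) (use assms(2) in auto)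
  moreover have "sum_list (map f vs) = (\<Sum>a\<in>?A \<union> ?B. f a)"
    unfolding sum_list_distinct_conv_sum_set[OF dist] by (rule sum.cong) auto
  moreover have "\<dots> = (\<Sum>a\<in>?A. f a) + (\<Sum>a\<in>?B. f a)" by (rule sum.union_disjoint) auto
  ultimately show ?thesis by (simp add: mom_def)
qed

lemma partition_bound_ge:
  assumes "lam \<in> partitions" obtains n where "\<forall>i\<ge>n. lam i = 0" "s \<le> int n" "m \<le> n"
proof -
  obtain n0 where "\<forall>i\<ge>n0. lam i = 0" using partition_bound[OF assms] by blast
  then show thesis by (intro that[of "max m (max n0 (nat s))"]) auto
qed

lemma psize_sum: "\<forall>i\<ge>n. lam i = 0 \<Longrightarrow> psize lam = (\<Sum>i<n. lam i)"
proof -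
  assume n: "\<forall>i\<ge>n. lam i = 0"
  have "{i. lam i \<noteq> 0} \<subseteq> {..<n}"
  proof
    fix i assume "i \<in> {i. lam i \<noteq> 0}"
    then show "i \<in> {..<n}" using n by (cases "n \<le> i") auto
  qed
  then show ?thesis unfolding psize_def by (intro sum.mono_neutral_left) auto
qed

lemma mom_part_state:
  assumes "lam \<in> partitions" "\<forall>i\<ge>n. lam i = 0" "s \<le> int n"
  shows "mom f (part_state lam s) = (\<Sum>i<n. f (int i - s - int (lam i))) - (\<Sum>a\<in>{0..<int n - s}. f a)"
proof -
  have "sum_list (map f (parts lam s n)) = (\<Sum>i<n. f (int i - s - int (lam i)))"
    by (simp add: parts_def sum_list_distinct_conv_sum_set atLeast0LessThan comp_def)
  then show ?thesis
    unfolding part_state_list_state[OF assms(2)] using mom_list_state[OF parts_props(1)[OF assms(1), of s n] parts_props(2)[OF assms(1), where s=s and n=n], of f] assms(3) by simp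
qed

lemma ch_part_state: "lam \<in> partitions \<Longrightarrow> ch (part_state lam s) = s"
proof -
  assume l: "lam \<in> partitions"
  obtain n where n: "\<forall>i\<ge>n. lam i = 0" "s \<le> int n" using partition_bound_ge[OF l] by metis
  show ?thesis using mom_part_state[OF l n, of "\<lambda>_. 1"] n by simp
qed

lemma en_part_state: "lam \<in> partitions \<Longrightarrow> en (part_state lam s) = int (psize lam) + s * (s + 1) div 2"
proof -
  assume l: "lam \<in> partitions"
  obtain n where n: "\<forall>i\<ge>n. lam i = 0" "s \<le> int n" using partition_bound_ge[OF l] by metis
  define m where "m = nat (int n - s)"
  have g: "2 * (\<Sum>i<k. int i) = int k * (int k - 1)" for k by (induction k) (auto simp: algebra_simps)
  have "(\<Sum>a\<in>{0..<int n - s}. - a) = (\<Sum>i<m. - int i)"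
    by (rule sum.reindex_bij_witness[of _ int nat]) (auto simp: m_def)
  then have a: "2 * (\<Sum>a\<in>{0..<int n - s}. - a) = - ((int n - s) * (int n - s - 1))"
    using g[of m] n by (simp add: sum_negf m_def)
  have "(\<Sum>i<n. - (int i - s - int (lam i))) = int n * s - (\<Sum>i<n. int i) + int (psize lam)"
    unfolding psize_sum[OF n(1)] by (simp add: sum.distrib sum_subtractf algebra_simps)
  then have "2 * (\<Sum>i<n. - (int i - s - int (lam i))) = 2 * int n * s - int n * (int n - 1) + 2 * int (psize lam)"
    using g[of n] by simp
  then have "2 * en (part_state lam s) = 2 * int (psize lam) + s * (s + 1)"
    using mom_part_state[OF l n, of uminus] a by (simp add: algebra_simps)
  then have "en (part_state lam s) = (2 * int (psize lam) + s * (s + 1)) div 2" by simp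
  then show ?thesis by simp
qed

lemma part_state_inj:
  assumes "lam \<in> partitions" "mu \<in> partitions" "part_state lam s = part_state mu s" shows "lam = mu"
proof
  fix i
  obtain n where n: "\<forall>i\<ge>n. lam i = 0" using partition_bound[OF assms(1)] by metis
  obtain n' where n': "\<forall>i\<ge>n'. mu i = 0" using partition_bound[OF assms(2)] by metis
  define m where "m = max n (max n' (Suc i))"
  have eq: "set (parts lam s m) \<union> {int m - s..} = set (parts mu s m) \<union> {int m - s..}"
    using assms(3) range_parts[of m lam s] range_parts[of m mu s] occ_part_state[OF assms(1), of s] occ_part_state[OF assms(2), of s] n n'
    by (simp add: m_def)
  have "set (parts lam s m) = set (parts mu s m)"
  proof -
    have "set (parts l s m) = (set (parts l s m) \<union> {int m - s..}) \<inter> {..<int m - s}" if "l \<in> partitions" for l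
      using parts_props(2)[OF that, of _ s m] by force
    then show ?thesis using eq assms by metis
  qed
  then have "parts lam s m = parts mu s m"
    by (intro strict_sorted_equal parts_props(1) assms) auto
  then have "parts lam s m ! i = parts mu s m ! i" by simp
  then show "lam i = mu i" by (simp add: parts_def m_def)
qed

lemma sorted_int_gap:
  fixes vs :: "int list"
  assumes "sorted_wrt (<) vs" "i + d < length vs" shows "vs ! i + int d \<le> vs ! (i + d)"
  using assms(2)
proof (induction d)
  case (Suc d)
  have "vs ! (i + d) < vs ! (i + Suc d)" using assms(1) Suc.prems by (simp add: sorted_wrt_iff_nth_less)
  then show ?case using Suc by simp
qed simp

text \<open>By the charge, exactly \<open>M + s\<close> particles lie below a large
  \<open>M\<close>; the row lengths are their displacements from the vacuum positions.\<close>

lemma part_state_surj: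
  assumes "ch v = s" obtains lam where "lam \<in> partitions" "v = part_state lam s"
proof -
  obtain a b where ab: "\<And>j. j \<in> occ v \<Longrightarrow> a \<le> j" "\<And>j. b \<le> j \<Longrightarrow> j \<in> occ v"
    by (rule maya_bounds[of v]) blast
  define M where "M = max b 0"
  define vs where "vs = sorted_list_of_set {x \<in> occ v. x < M}"
  have set: "set vs = {x \<in> occ v. x < M}" unfolding vs_def by (simp add: finite_occ_less)
  have srt: "sorted_wrt (<) vs" unfolding vs_def by simp
  have v: "v = list_state M vs" by (rule maya_state_eqI) (use ab(2) in \<open>auto simp: set M_def\<close>)
  have lt: "x < M" if "x \<in> set vs" for x using that set by simp
  have "ch v = int (length vs) - M"
    unfolding v using mom_list_state[OF srt lt, of "\<lambda>_. 1"] by (simp add: M_def sum_list_triv)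
  then have n: "int (length vs) = M + s" using assms by simp
  let ?n = "length vs"
  define lam where "lam i = (if i < ?n then nat (int i - s - vs ! i) else 0)" for i
  \<comment> \<open>Distinct integers below \<open>M\<close>, counted down from the last one, cannot
    exceed the vacuum positions, so \<open>nat\<close> truncates nothing.\<close>
  have le: "vs ! i \<le> int i - s" if "i < ?n" for i
  proof -
    have "vs ! i + int (?n - 1 - i) \<le> vs ! (i + (?n - 1 - i))" by (rule sorted_int_gap[OF srt]) (use that in simp)
    moreover have "vs ! (i + (?n - 1 - i)) < M" by (rule lt) (use that in \<open>auto intro: nth_mem\<close>)
    ultimately show ?thesis using n that by (simp add: of_nat_diff)
  qed
  have "lam (Suc i) \<le> lam i" for i
    using le[of i] le[of "Suc i"] sorted_int_gap[OF srt, of i 1] by (auto simp: lam_def)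
  moreover have "finite {i. lam i \<noteq> 0}" by (rule finite_subset[of _ "{..<?n}"]) (auto simp: lam_def)
  ultimately have part: "lam \<in> partitions" by (simp add: partitions_def)
  have "parts lam s ?n = vs"
    by (rule nth_equalityI) (use le in \<open>auto simp: parts_def lam_def\<close>)
  moreover have "int ?n - s = M" using n by simp
  ultimately have "v = part_state lam s" unfolding v by (subst part_state_list_state[of ?n]) (auto simp: lam_def)
  then show thesis using that part by blast
qed

lemma zero_partition: "(\<lambda>_. 0) \<in> partitions"
  by (simp add: partitions_def)

lemma part_state_zero: "part_state (\<lambda>_. 0) s = vac_state s"
proof (rule maya_state_eqI)
  have "range (\<lambda>i. int i - s) = {- s..}"
  proof (intro equalityI subsetI)
    fix x assume "x \<in> {- s..}"
    then show "x \<in> range (\<lambda>i. int i - s)" by (intro image_eqI[of _ _ "nat (x + s)"]) auto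
  qed auto
  then show "occ (part_state (\<lambda>_. 0) s) = occ (vac_state s)" using occ_part_state[OF zero_partition] by simp
qed

lemma bij_part_state: "bij_betw (\<lambda>lam. part_state lam s) partitions {v. ch v = s}"
  unfolding bij_betw_def
proof (intro conjI)
  show "inj_on (\<lambda>lam. part_state lam s) partitions" by (auto intro: inj_onI part_state_inj)
  show "(\<lambda>lam. part_state lam s) ` partitions = {v. ch v = s}"
    using ch_part_state part_state_surj by (auto simp: image_iff) metis
qed

section \<open>Interlacing partitions and conjugation\<close>

definition hstrip :: "(nat \<Rightarrow> nat) \<Rightarrow> (nat \<Rightarrow> nat) set" where
  "hstrip lam = {mu. \<forall>i. mu i \<le> lam i \<and> lam (Suc i) \<le> mu i}"

lemma hstrip_partitions: "lam \<in> partitions \<Longrightarrow> mu \<in> hstrip lam \<Longrightarrow> mu \<in> partitions"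
proof -
  assume l: "lam \<in> partitions" and m: "mu \<in> hstrip lam"
  have "{i. mu i \<noteq> 0} \<subseteq> {i. lam i \<noteq> 0}" using m by (auto simp: hstrip_def) (metis le_zero_eq neq0_conv)
  moreover have "mu (Suc i) \<le> mu i" for i
  proof -
    have "mu (Suc i) \<le> lam (Suc i)" "lam (Suc i) \<le> mu i" using m by (auto simp: hstrip_def)
    then show ?thesis by (rule le_trans)
  qed
  ultimately show ?thesis using l by (auto simp: partitions_def intro: finite_subset)
qed

text \<open>The one-variable skew Schur function. Strict interlacing of positions is weak
  interlacing of parts, because consecutive vacuum positions differ by 1.\<close>

lemma vertex_hstrip:
  assumes "lam \<in> partitions" "mu \<in> partitions"
  shows "vertex 1 (\<lambda>m. z ^ m) (part_state mu s) (part_state lam s)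
    = (if mu \<in> hstrip lam then z ^ (psize lam - psize mu) else 0)"
proof -
  obtain n0 where n0: "\<forall>i\<ge>n0. lam i = 0" using partition_bound[OF assms(1)] by metis
  obtain n where n: "\<forall>i\<ge>n. mu i = 0" "n0 \<le> n" using partition_bound_ge[OF assms(2)] by metis
  have nl: "\<forall>i\<ge>n. lam i = 0" using n0 n(2) by simp
  let ?f = "\<lambda>i. int i - s - int (lam i)" and ?g = "\<lambda>i. int i - s - int (mu i)"
  have "vertex 1 (\<lambda>m. z ^ m) (part_state mu s) (part_state lam s) = strip z (parts lam s n) (parts mu s n)"
    unfolding part_state_list_state[OF nl] part_state_list_state[OF n(1)]
    by (rule vertex_strip) (use parts_props[OF assms(1), where s=s and n=n] parts_props[OF assms(2), where s=s and n=n] in auto)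
  also have "\<dots> = (if \<forall>i\<in>{0..<n}. ?f i \<le> ?g i \<and> (Suc i < n \<longrightarrow> ?g i < ?f (Suc i)) then z ^ nat (\<Sum>i=0..<n. ?g i - ?f i) else 0)"
    unfolding parts_def by (rule strip_map) simp
  also have "(\<forall>i\<in>{0..<n}. ?f i \<le> ?g i \<and> (Suc i < n \<longrightarrow> ?g i < ?f (Suc i))) \<longleftrightarrow> mu \<in> hstrip lam"
  proof -
    have "mu i \<le> lam i \<and> lam (Suc i) \<le> mu i" if H: "\<forall>i\<in>{0..<n}. ?f i \<le> ?g i \<and> (Suc i < n \<longrightarrow> ?g i < ?f (Suc i))" for i
    proof (cases "i < n")
      case True then show ?thesis using bspec[OF H, of i] nl by (cases "Suc i < n") auto
    next
      case False then show ?thesis using n nl by simp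
    qed
    moreover have "?f i \<le> ?g i \<and> (Suc i < n \<longrightarrow> ?g i < ?f (Suc i))" if "mu \<in> hstrip lam" for i
    proof -
      have "mu i \<le> lam i" "lam (Suc i) \<le> mu i" using that by (auto simp: hstrip_def)
      then show ?thesis by simp
    qed
    ultimately show ?thesis unfolding hstrip_def by blast
  qed
  also have "z ^ nat (\<Sum>i=0..<n. ?g i - ?f i) = z ^ (psize lam - psize mu)"
  proof -
    have "(\<Sum>i=0..<n. ?g i - ?f i) = int (psize lam) - int (psize mu)"
      unfolding psize_sum[OF nl] psize_sum[OF n(1)]
      by (simp add: sum_subtractf atLeast0LessThan)
    then show ?thesis by (simp add: nat_diff_distrib')
  qed
  finally show ?thesis .
qed

text \<open>Since \<open>i < pconj lam j\<close> iff \<open>j < lam i\<close>, the particles and the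
  reflected positions of the conjugate never meet; that they fill everything follows by counting the
  particles below a hole.\<close>

lemma dual_part_state:
  assumes "lam \<in> partitions" shows "pconj lam \<in> partitions" and "dual (part_state lam s) = part_state (pconj lam) (- s)"
proof -
  have fin: "finite {i. j < lam i}" for j
    by (rule finite_subset[of _ "{i. lam i \<noteq> 0}"]) (use assms in \<open>auto simp: partitions_def\<close>)
  have lt: "i < pconj lam j \<longleftrightarrow> j < lam i" for i j
  proof
    assume "j < lam i"
    then have "{..i} \<subseteq> {i. j < lam i}" using partition_antimono[OF assms] by (auto intro: less_le_trans)
    then have "card {..i} \<le> card {i. j < lam i}" by (rule card_mono[OF fin])
    then show "i < pconj lam j" by (simp add: pconj_def)
  next
    assume i: "i < pconj lam j"
    show "j < lam i"
    proof (rule ccontr)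
      assume "\<not> j < lam i"
      then have "{i. j < lam i} \<subseteq> {..<i}" using partition_antimono[OF assms, of i] by (metis lessThan_iff linorder_not_le mem_Collect_eq order.trans subsetI leD)
      then have "card {i. j < lam i} \<le> i" using card_mono[of "{..<i}"] by simp
      then show False using i by (simp add: pconj_def)
    qed
  qed
  show part: "pconj lam \<in> partitions"
    unfolding partitions_def
  proof (intro CollectI conjI allI)
    fix j show "pconj lam (Suc j) \<le> pconj lam j"
      unfolding pconj_def by (rule card_mono[OF fin]) auto
    have "{j. pconj lam j \<noteq> 0} \<subseteq> {..<lam 0}" using lt[of 0] by auto
    then show "finite {j. pconj lam j \<noteq> 0}" by (rule finite_subset) simp
  qed
  show "dual (part_state lam s) = part_state (pconj lam) (- s)"
  proof (rule maya_state_eqI)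
    have disj: "- 1 - (int j + s - int (pconj lam j)) \<noteq> int i - s - int (lam i)" for i j :: nat
    proof (cases "j < lam i")
      case True then have "i < pconj lam j" using lt by simp
      then show ?thesis using True by linarith
    next
      case False then have "\<not> i < pconj lam j" using lt by simp
      then show ?thesis using False by linarith
    qed
    have cover: "\<exists>j. y = int j + s - int (pconj lam j)" if y: "\<And>i. - 1 - y \<noteq> int i - s - int (lam i)" for y
    proof -
      \<comment> \<open>\<open>- 1 - y\<close> is a hole; \<open>i\<close> counts the particles
        below it, and the later \<open>j\<close> is the row of the conjugate that produces
        \<open>y\<close>.\<close>
      define i where "i = (LEAST i. - 1 - y < int i - s - int (lam i))"
      obtain n where n: "\<forall>i\<ge>n. lam i = 0" using partition_bound[OF assms] by metis
      have "- 1 - y < int (max n (nat (s - y))) - s - int (lam (max n (nat (s - y))))" using n by simp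
      then have i: "- 1 - y < int i - s - int (lam i)" unfolding i_def by (rule LeastI)
      define j where "j = nat (int i + y - s)"
      have j: "int j = int i + y - s" unfolding j_def using i by simp
      have a: "\<not> j < lam i" using i j by linarith
      have b: "j < lam i'" if "i' < i" for i'
      proof -
        have "\<not> - 1 - y < int i' - s - int (lam i')" using that not_less_Least unfolding i_def by blast
        then have i': "int i' - s - int (lam i') < - 1 - y" using y[of i'] by linarith
        show ?thesis
        proof (cases "Suc i' = i")
          case True then show ?thesis using i' j by linarith
        next
          case False
          then have "i' \<le> i - 1" "i - 1 < i" using that by auto
          have "\<not> - 1 - y < int (i - 1) - s - int (lam (i - 1))" using \<open>i - 1 < i\<close> not_less_Least unfolding i_def by blast
          then have "int (i - 1) - s - int (lam (i - 1)) < - 1 - y" using y[of "i - 1"] by linarith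
          moreover have "lam (i - 1) \<le> lam i'" by (rule partition_antimono[OF assms \<open>i' \<le> i - 1\<close>])
          ultimately show ?thesis using j that by (simp add: of_nat_diff)
        qed
      qed
      have "pconj lam j = i"
      proof -
        have "\<not> i < pconj lam j" using a lt by simp
        moreover have "\<not> pconj lam j < i" using b[of "pconj lam j"] lt[of "pconj lam j" j] by auto
        ultimately show ?thesis by simp
      qed
      then show ?thesis using j by (intro exI[of _ j]) simp
    qed
    show "occ (dual (part_state lam s)) = occ (part_state (pconj lam) (- s))"
      unfolding occ_dual occ_part_state[OF assms] occ_part_state[OF part] minus_minus diff_minus_eq_add
    proof (intro equalityI subsetI)
      fix y assume "y \<in> {y. - 1 - y \<notin> range (\<lambda>i. int i - s - int (lam i))}"
      then have "\<exists>j. y = int j + s - int (pconj lam j)" by (intro cover) blast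
      then show "y \<in> range (\<lambda>j. int j + s - int (pconj lam j))" by blast
    next
      fix y assume "y \<in> range (\<lambda>j. int j + s - int (pconj lam j))"
      then show "y \<in> {y. - 1 - y \<notin> range (\<lambda>i. int i - s - int (lam i))}" using disj by blast
    qed
  qed
qed

section \<open>Schur functions\<close>

lemma finite_below:
  assumes "finite {k. \<alpha> k \<noteq> 0}" shows "finite (below \<alpha>)"
proof (rule finite_subset)
  let ?A = "{k. \<alpha> k \<noteq> 0}" and ?B = "{..Max (insert 0 (\<alpha> ` {k. \<alpha> k \<noteq> 0}))}"
  show "below \<alpha> \<subseteq> {f. \<forall>x. (x \<in> ?A \<longrightarrow> f x \<in> ?B) \<and> (x \<notin> ?A \<longrightarrow> f x = 0)}"
  proof (intro subsetI CollectI allI conjI impI)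
    fix f x assume f: "f \<in> below \<alpha>"
    then have le: "f x \<le> \<alpha> x" by (simp add: below_def)
    { assume "x \<in> ?A"
      then have "\<alpha> x \<le> Max (insert 0 (\<alpha> ` ?A))" using assms by (intro Max_ge) auto
      then show "f x \<in> ?B" using le by simp }
    { assume "x \<notin> ?A" then show "f x = 0" using le by simp }
  qed
  show "finite {f. \<forall>x. (x \<in> ?A \<longrightarrow> f x \<in> ?B) \<and> (x \<notin> ?A \<longrightarrow> f x = 0)}"
    by (rule finite_set_of_finite_funs) (use assms in auto)
qed

lemma partition_finite: "lam \<in> partitions \<Longrightarrow> finite {i. lam i \<noteq> 0}"
  by (simp add: partitions_def)

lemma finite_hstrip: "lam \<in> partitions \<Longrightarrow> finite (hstrip lam)"
  by (rule finite_subset[OF _ finite_below[OF partition_finite]]) (auto simp: hstrip_def below_def)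

lemma cells_finite_card:
  assumes "finite {i. lam i \<noteq> 0}"
  shows "finite (cells lam)" "card (cells lam) = psize lam"
proof -
  have eq: "cells lam = Sigma {i. lam i \<noteq> 0} (\<lambda>i. {..<lam i})" by (auto simp: cells_def)
  show "finite (cells lam)" unfolding eq using assms by (intro finite_SigmaI) auto
  show "card (cells lam) = psize lam" unfolding eq using assms by (subst card_SigmaI) (auto simp: psize_def)
qed

section \<open>Semistandard tableaux, one largest entry at a time\<close>

definition ssyt_le :: "nat \<Rightarrow> (nat \<Rightarrow> nat) \<Rightarrow> (nat \<Rightarrow> nat \<Rightarrow> nat) set" where
  "ssyt_le N lam = {T \<in> ssyt lam. \<forall>i j. T i j \<le> N}"

definition tab_wt :: "(nat \<Rightarrow> complex) \<Rightarrow> (nat \<Rightarrow> nat) \<Rightarrow> (nat \<Rightarrow> nat \<Rightarrow> nat) \<Rightarrow> complex" where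
  "tab_wt x lam T = (\<Prod>c\<in>cells lam. x (T (fst c) (snd c)))"

definition extend :: "(nat \<Rightarrow> nat) \<Rightarrow> nat \<Rightarrow> (nat \<Rightarrow> nat) \<times> (nat \<Rightarrow> nat \<Rightarrow> nat) \<Rightarrow> (nat \<Rightarrow> nat \<Rightarrow> nat)" where
  "extend lam N = (\<lambda>(mu, T) i j. if j < mu i then T i j else if j < lam i then Suc N else 0)"

text \<open>The inverse of \<open>extend\<close>. Row lengths are given as cardinalities, which is
  faithful because rows increase weakly.\<close>

definition restrict_tab :: "(nat \<Rightarrow> nat) \<Rightarrow> nat \<Rightarrow> (nat \<Rightarrow> nat \<Rightarrow> nat) \<Rightarrow> (nat \<Rightarrow> nat) \<times> (nat \<Rightarrow> nat \<Rightarrow> nat)" where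
  "restrict_tab lam N T = ((\<lambda>i. card {j. j < lam i \<and> T i j \<le> N}), (\<lambda>i j. if T i j \<le> N then T i j else 0))"

lemma ssyt_row:
  assumes "T \<in> ssyt lam" "j \<le> j'" "j' < lam i" shows "T i j \<le> T i j'"
  using assms(2,3)
proof (induction j' rule: dec_induct)
  case (step m)
  have "T i m \<le> T i (Suc m)" using assms(1) step by (auto simp: ssyt_def)
  then show ?case using step by simp
qed simp

lemma down_closed_card:
  assumes "finite A" "\<And>i j::nat. j \<in> A \<Longrightarrow> i \<le> j \<Longrightarrow> i \<in> A"
  shows "j \<in> A \<longleftrightarrow> j < card A"
proof
  assume "j \<in> A"
  then have "{..j} \<subseteq> A" using assms(2) by auto
  from card_mono[OF assms(1) this] show "j < card A" by simp
next
  assume j: "j < card A"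
  show "j \<in> A"
  proof (rule ccontr)
    assume "j \<notin> A"
    then have "i < j" if "i \<in> A" for i using assms(2)[OF that, of j] by (cases "j \<le> i") auto
    then have "A \<subseteq> {..<j}" by auto
    from card_mono[OF _ this] show False using j by simp
  qed
qed

lemma restrict_tab_mem:
  assumes "T \<in> ssyt lam"
  shows "j < fst (restrict_tab lam N T) i \<longleftrightarrow> j < lam i \<and> T i j \<le> N"
proof -
  let ?A = "{j. j < lam i \<and> T i j \<le> N}"
  have "j \<in> ?A \<longleftrightarrow> j < card ?A"
  proof (rule down_closed_card)
    show "finite ?A" by (rule finite_subset[of _ "{..<lam i}"]) auto
    fix k l assume "l \<in> ?A" "k \<le> l"
    then show "k \<in> ?A" using ssyt_row[OF assms, of k l i] by auto
  qed
  then show ?thesis by (simp add: restrict_tab_def)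
qed

text \<open>Columns increase strictly, so the cells with entry \<open>Suc N\<close> form a
  horizontal strip; the rest is a tableau of interlacing shape with entries at most
  \<open>N\<close>.\<close>

lemma bij_extend:
  assumes lam: "lam \<in> partitions"
  shows "bij_betw (extend lam N) (Sigma (hstrip lam) (ssyt_le N)) (ssyt_le (Suc N) lam)"
proof (rule bij_betw_byWitness[of _ "restrict_tab lam N"])
  show "extend lam N ` Sigma (hstrip lam) (ssyt_le N) \<subseteq> ssyt_le (Suc N) lam"
  proof (intro subsetI, elim imageE SigmaE, clarify)
    fix mu T assume mu: "mu \<in> hstrip lam" and T: "T \<in> ssyt_le N mu"
    have m: "mu i \<le> lam i" "lam (Suc i) \<le> mu i" for i using mu by (auto simp: hstrip_def)
    have T1: "1 \<le> T i j" if "j < mu i" for i j using T that by (auto simp: ssyt_le_def ssyt_def)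
    have T2: "T i j \<le> T i (Suc j)" if "Suc j < mu i" for i j using T that by (auto simp: ssyt_le_def ssyt_def)
    have T3: "T i j < T (Suc i) j" if "j < mu (Suc i)" for i j using T that by (auto simp: ssyt_le_def ssyt_def)
    have T4: "T i j \<le> N" for i j using T by (auto simp: ssyt_le_def)
    show "extend lam N (mu, T) \<in> ssyt_le (Suc N) lam"
      unfolding ssyt_le_def ssyt_def mem_Collect_eq
    proof (intro conjI allI impI)
      fix i j
      show "j < lam i \<Longrightarrow> 1 \<le> extend lam N (mu, T) i j" using T1 by (auto simp: extend_def)
      show "\<not> j < lam i \<Longrightarrow> extend lam N (mu, T) i j = 0" using m(1)[of i] by (auto simp: extend_def)
      show "Suc j < lam i \<Longrightarrow> extend lam N (mu, T) i j \<le> extend lam N (mu, T) i (Suc j)"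
        using T2 T4[of i j] by (auto simp: extend_def le_Suc_eq)
      show "j < lam (Suc i) \<Longrightarrow> extend lam N (mu, T) i j < extend lam N (mu, T) (Suc i) j"
        using T3 T4[of i j] m(2)[of i] by (auto simp: extend_def less_Suc_eq_le)
      show "extend lam N (mu, T) i j \<le> Suc N" using T4[of i j] by (auto simp: extend_def)
    qed
  qed
  show "restrict_tab lam N ` ssyt_le (Suc N) lam \<subseteq> Sigma (hstrip lam) (ssyt_le N)"
  proof (intro subsetI, elim imageE)
    fix p T assume p: "p = restrict_tab lam N T" and T: "T \<in> ssyt_le (Suc N) lam"
    obtain a b where ab: "(a, b) = restrict_tab lam N T" by (metis surj_pair)
    have S: "T \<in> ssyt lam" and T4: "T i j \<le> Suc N" for i j using T by (auto simp: ssyt_le_def)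
    have mem: "j < a i \<longleftrightarrow> j < lam i \<and> T i j \<le> N" for i j
      using restrict_tab_mem[OF S, of j N i] ab by (metis fst_conv)
    have b: "b i j = (if T i j \<le> N then T i j else 0)" for i j using ab by (simp add: restrict_tab_def)
    have T1: "1 \<le> T i j" if "j < lam i" for i j using S that by (auto simp: ssyt_def)
    have T0: "T i j = 0" if "\<not> j < lam i" for i j using S that by (auto simp: ssyt_def)
    have T2: "T i j \<le> T i (Suc j)" if "Suc j < lam i" for i j using S that by (auto simp: ssyt_def)
    have T3: "T i j < T (Suc i) j" if "j < lam (Suc i)" for i j using S that by (auto simp: ssyt_def)
    have dec: "lam (Suc i) \<le> lam i" for i using partition_antimono[OF lam] by simp
    have "a \<in> hstrip lam"
      unfolding hstrip_def
    proof (intro CollectI allI conjI)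
      fix i
      show "a i \<le> lam i" using mem[of "lam i" i] by (simp add: not_less)
      show "lam (Suc i) \<le> a i"
      proof (rule ccontr)
        assume "\<not> lam (Suc i) \<le> a i"
        then have "a i < lam (Suc i)" by simp
        then have "a i < lam i \<and> T i (a i) \<le> N" using T3[of "a i" i] T4[of "Suc i" "a i"] dec[of i] by auto
        then show False using mem[of "a i" i] by simp
      qed
    qed
    moreover have "b \<in> ssyt_le N a"
      unfolding ssyt_le_def ssyt_def mem_Collect_eq
    proof (intro conjI allI impI)
      fix i j
      show "j < a i \<Longrightarrow> 1 \<le> b i j" using mem b T1 by simp
      show "\<not> j < a i \<Longrightarrow> b i j = 0" using mem[of j i] b[of i j] T0[of j i] by (cases "j < lam i") auto
      show "Suc j < a i \<Longrightarrow> b i j \<le> b i (Suc j)" using mem[of "Suc j" i] b[of i j] b[of i "Suc j"] T2[of j i] by auto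
      show "j < a (Suc i) \<Longrightarrow> b i j < b (Suc i) j" using mem[of j "Suc i"] b[of i j] b[of "Suc i" j] T3[of j i] by auto
      show "b i j \<le> N" using b by simp
    qed
    ultimately show "p \<in> Sigma (hstrip lam) (ssyt_le N)" unfolding p ab[symmetric] by blast
  qed
  show "\<forall>p\<in>Sigma (hstrip lam) (ssyt_le N). restrict_tab lam N (extend lam N p) = p"
  proof clarify
    fix mu T assume mu: "mu \<in> hstrip lam" and T: "T \<in> ssyt_le N mu"
    have m: "mu i \<le> lam i" for i using mu by (auto simp: hstrip_def)
    have T4: "T i j \<le> N" for i j using T by (auto simp: ssyt_le_def)
    have T0: "T i j = 0" if "\<not> j < mu i" for i j using T that by (auto simp: ssyt_le_def ssyt_def)
    have "{j. j < lam i \<and> extend lam N (mu, T) i j \<le> N} = {..<mu i}" for i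
      using m[of i] T4[of i] by (auto simp: extend_def split: if_splits)
    then show "restrict_tab lam N (extend lam N (mu, T)) = (mu, T)"
      unfolding restrict_tab_def by (auto simp: fun_eq_iff extend_def T4 T0)
  qed
  show "\<forall>T\<in>ssyt_le (Suc N) lam. extend lam N (restrict_tab lam N T) = T"
  proof
    fix T assume T: "T \<in> ssyt_le (Suc N) lam"
    have S: "T \<in> ssyt lam" and T4: "T i j \<le> Suc N" for i j using T by (auto simp: ssyt_le_def)
    have T0: "T i j = 0" if "\<not> j < lam i" for i j using S that by (auto simp: ssyt_def)
    obtain a b where ab: "restrict_tab lam N T = (a, b)" by fastforce
    have mem: "j < a i \<longleftrightarrow> j < lam i \<and> T i j \<le> N" for i j
      using restrict_tab_mem[OF S, of j N i] ab by (metis fst_conv)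
    have b: "b i j = (if T i j \<le> N then T i j else 0)" for i j using ab by (auto simp: restrict_tab_def)
    show "extend lam N (restrict_tab lam N T) = T"
    proof (intro ext)
      fix i j
      show "extend lam N (restrict_tab lam N T) i j = T i j"
        unfolding ab extend_def using mem[of j i] b[of i j] T0[of j i] T4[of i j] by (auto simp: not_le)
    qed
  qed
qed

lemma ssyt_le_0:
  "lam \<in> partitions \<Longrightarrow> ssyt_le 0 lam = (if lam = (\<lambda>_. 0) then {\<lambda>_ _. 0} else {})"
proof -
  have "lam = (\<lambda>_. 0)" if "T \<in> ssyt_le 0 lam" for T
  proof
    fix i
    show "lam i = 0"
    proof (rule ccontr)
      assume "lam i \<noteq> 0"
      then have "0 < lam i" by simp
      moreover have "\<forall>i j. j < lam i \<longrightarrow> 1 \<le> T i j" "\<forall>i j. T i j \<le> 0"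
        using that unfolding ssyt_le_def ssyt_def by blast+
      ultimately show False by fastforce
    qed
  qed
  then have ne: "ssyt_le 0 lam = {}" if "lam \<noteq> (\<lambda>_. 0)" using that by (metis ex_in_conv)
  have z: "T = (\<lambda>_ _. 0)" if "T \<in> ssyt_le 0 lam" for T lam
    using that by (intro ext) (simp add: ssyt_le_def)
  have m: "(\<lambda>_ _. 0) \<in> ssyt_le 0 (\<lambda>_. 0)" by (simp add: ssyt_le_def ssyt_def)
  have eq: "ssyt_le 0 (\<lambda>_. 0) = {\<lambda>_ _. 0}"
  proof (intro equalityI subsetI)
    fix T assume "T \<in> ssyt_le 0 (\<lambda>_. 0)"
    then have "T = (\<lambda>_ _. 0)" by (rule z)
    then show "T \<in> {\<lambda>_ _. 0}" by (simp only: singleton_iff)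
  next
    fix T :: "nat \<Rightarrow> nat \<Rightarrow> nat" assume "T \<in> {\<lambda>_ _. 0}"
    then have "T = (\<lambda>_ _. 0)" by (rule singletonD)
    then show "T \<in> ssyt_le 0 (\<lambda>_. 0)" using m by (simp only:)
  qed
  show ?thesis
  proof (cases "lam = (\<lambda>_. 0)")
    case True then show ?thesis using eq by (simp only: if_True simp_thms)
  next
    case False then show ?thesis using ne[OF False] by (simp only: if_False)
  qed
qed

lemma finite_ssyt_le: "lam \<in> partitions \<Longrightarrow> finite (ssyt_le N lam)"
proof (induction N arbitrary: lam)
  case (Suc N)
  then show ?case
    using bij_betw_finite[OF bij_extend[of lam N]] finite_hstrip hstrip_partitions by (auto intro!: finite_SigmaI)
qed (simp add: ssyt_le_0)

lemma tab_wt_extend: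
  assumes "lam \<in> partitions" "mu \<in> hstrip lam"
  shows "tab_wt x lam (extend lam N (mu, T)) = x (Suc N) ^ (psize lam - psize mu) * tab_wt x mu T"
proof -
  have m: "mu i \<le> lam i" for i using assms by (auto simp: hstrip_def)
  have sub: "cells mu \<subseteq> cells lam" using m by (auto simp: cells_def intro: less_le_trans)
  note fl = cells_finite_card[OF partition_finite[OF assms(1)]]
  note fm = cells_finite_card[OF partition_finite[OF hstrip_partitions[OF assms]]]
  have "tab_wt x lam (extend lam N (mu, T))
     = (\<Prod>c\<in>cells lam - cells mu. x (extend lam N (mu, T) (fst c) (snd c))) * (\<Prod>c\<in>cells mu. x (extend lam N (mu, T) (fst c) (snd c)))"
    unfolding tab_wt_def by (rule prod.subset_diff[OF sub fl(1)])
  also have "(\<Prod>c\<in>cells lam - cells mu. x (extend lam N (mu, T) (fst c) (snd c))) = (\<Prod>c\<in>cells lam - cells mu. x (Suc N))"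
    by (rule prod.cong) (auto simp: extend_def cells_def)
  also have "\<dots> = x (Suc N) ^ (psize lam - psize mu)"
    using card_Diff_subset[OF fm(1) sub] by (simp add: fl fm)
  also have "(\<Prod>c\<in>cells mu. x (extend lam N (mu, T) (fst c) (snd c))) = tab_wt x mu T"
    unfolding tab_wt_def by (rule prod.cong) (auto simp: extend_def cells_def)
  finally show ?thesis .
qed

lemma sum_ssyt_le_Suc:
  assumes "lam \<in> partitions"
  shows "(\<Sum>T\<in>ssyt_le (Suc N) lam. tab_wt x lam T)
    = (\<Sum>mu\<in>hstrip lam. x (Suc N) ^ (psize lam - psize mu) * (\<Sum>T\<in>ssyt_le N mu. tab_wt x mu T))"
proof -
  have "(\<Sum>T\<in>ssyt_le (Suc N) lam. tab_wt x lam T)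
     = (\<Sum>p\<in>Sigma (hstrip lam) (ssyt_le N). tab_wt x lam (extend lam N p))"
    by (rule sum.reindex_bij_betw[OF bij_extend[OF assms], symmetric])
  also have "\<dots> = (\<Sum>(mu, T)\<in>Sigma (hstrip lam) (ssyt_le N). x (Suc N) ^ (psize lam - psize mu) * tab_wt x mu T)"
    by (rule sum.cong) (auto simp: tab_wt_extend[OF assms])
  also have "\<dots> = (\<Sum>mu\<in>hstrip lam. \<Sum>T\<in>ssyt_le N mu. x (Suc N) ^ (psize lam - psize mu) * tab_wt x mu T)"
    using finite_hstrip[OF assms] finite_ssyt_le hstrip_partitions[OF assms] by (intro sum.Sigma[symmetric]) auto
  finally show ?thesis by (simp add: sum_distrib_left)
qed

text \<open>\<open>vertex_semigroup\<close> splits off the last variable, and its one-variable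
  entries match the removal of the largest entry in \<open>bij_extend\<close>.\<close>

lemma vertex_ssyt:
  assumes "lam \<in> partitions"
  shows "vertex 1 (\<lambda>m. \<Sum>i=1..N. x i ^ m) (vac_state s) (part_state lam s) = (\<Sum>T\<in>ssyt_le N lam. tab_wt x lam T)"
  using assms
proof (induction N arbitrary: lam)
  case 0
  have "cells (\<lambda>_. 0) = {}" by (simp add: cells_def)
  moreover have "vac_state s = part_state lam s \<longleftrightarrow> lam = (\<lambda>_. 0)"
    using part_state_inj[OF 0 zero_partition, of s] part_state_zero[of s] by metis
  ultimately show ?case by (simp add: vertex_id ssyt_le_0[OF 0] tab_wt_def)
next
  case (Suc N)
  let ?p = "\<lambda>m. \<Sum>i=1..N. x i ^ m" and ?p' = "\<lambda>m. x (Suc N) ^ m"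
  let ?F = "\<lambda>u. vertex 1 ?p (vac_state s) u * vertex 1 ?p' u (part_state lam s)"
  have "(?F has_sum vertex 1 (\<lambda>m. ?p m + ?p' m) (vac_state s) (part_state lam s)) UNIV"
    by (rule vertex_semigroup) simp
  moreover have "(?F has_sum (\<Sum>u\<in>(\<lambda>mu. part_state mu s) ` hstrip lam. ?F u)) UNIV"
  proof (rule has_sum_finite_neutralI)
    fix u assume u: "u \<in> UNIV - (\<lambda>mu. part_state mu s) ` hstrip lam"
    have "vertex 1 ?p' u (part_state lam s) = 0"
    proof (cases "ch u = s")
      case True
      then obtain mu where mu: "mu \<in> partitions" "u = part_state mu s" by (rule part_state_surj)
      then have "mu \<notin> hstrip lam" using u by blast
      then show ?thesis unfolding mu(2) using vertex_hstrip[OF Suc.prems mu(1)] by simp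
    next
      case False
      then show ?thesis by (intro vertex_zero_ch) (simp add: ch_part_state[OF Suc.prems])
    qed
    then show "?F u = 0" by simp
  qed (auto simp: finite_hstrip[OF Suc.prems])
  ultimately have "vertex 1 (\<lambda>m. ?p m + ?p' m) (vac_state s) (part_state lam s) = (\<Sum>u\<in>(\<lambda>mu. part_state mu s) ` hstrip lam. ?F u)"
    by (rule has_sum_unique)
  also have "\<dots> = (\<Sum>mu\<in>hstrip lam. ?F (part_state mu s))"
    by (rule sum.reindex_cong[of "\<lambda>mu. part_state mu s"])
       (auto intro!: inj_onI part_state_inj hstrip_partitions[OF Suc.prems])
  also have "\<dots> = (\<Sum>mu\<in>hstrip lam. x (Suc N) ^ (psize lam - psize mu) * (\<Sum>T\<in>ssyt_le N mu. tab_wt x mu T))"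
  proof (rule sum.cong[OF refl])
    fix mu assume mu: "mu \<in> hstrip lam"
    note p = hstrip_partitions[OF Suc.prems mu]
    show "?F (part_state mu s) = x (Suc N) ^ (psize lam - psize mu) * (\<Sum>T\<in>ssyt_le N mu. tab_wt x mu T)"
      unfolding Suc.IH[OF p] vertex_hstrip[OF Suc.prems p] using mu by simp
  qed
  finally show ?case unfolding sum_ssyt_le_Suc[OF Suc.prems] by simp
qed

lemma ssyt_Union: "lam \<in> partitions \<Longrightarrow> T \<in> ssyt lam \<Longrightarrow> \<exists>N. T \<in> ssyt_le N lam"
proof -
  assume lam: "lam \<in> partitions" and T: "T \<in> ssyt lam"
  let ?A = "(\<lambda>c. T (fst c) (snd c)) ` cells lam"
  have fin: "finite ?A" using cells_finite_card(1)[OF partition_finite[OF lam]] by simp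
  have "T i j \<le> Max (insert 0 ?A)" for i j
  proof (cases "j < lam i")
    case True
    then have "T i j \<in> ?A" by (intro image_eqI[of _ _ "(i, j)"]) (auto simp: cells_def)
    then show ?thesis using fin by (intro Max_ge) auto
  next
    case False
    then show ?thesis using T by (auto simp: ssyt_def)
  qed
  then show ?thesis using T by (auto simp: ssyt_le_def)
qed

text \<open>Tableaux with bounded entries exhaust all tableaux, so the limit of their sums is the
  Schur function once absolute summability is known. That follows from the same limit at |r|, where
  all weights are nonnegative.\<close>

lemma vertex_schur:
  assumes "norm r < 1" "lam \<in> partitions"
  shows "vertex 1 (\<lambda>k. r ^ k / (1 - r ^ (2 * k))) (vac_state s) (part_state lam s) = schur_rho r lam"
proof -
  let ?x = "\<lambda>r i. r ^ (2 * i - 1) :: complex"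
  let ?w = "tab_wt (?x r) lam" and ?w' = "tab_wt (?x (of_real (norm r))) lam"
  have lim: "(\<lambda>N. \<Sum>T\<in>ssyt_le N lam. tab_wt (?x r) lam T) \<longlonglongrightarrow> vertex 1 (\<lambda>k. r ^ k / (1 - r ^ (2 * k))) (vac_state s) (part_state lam s)"
    if "norm r < 1" for r
  proof -
    have eq: "(\<Sum>T\<in>ssyt_le N lam. tab_wt (?x r) lam T) = vertex 1 (\<lambda>m. \<Sum>i=1..N. ?x r i ^ m) (vac_state s) (part_state lam s)" for N
      by (rule vertex_ssyt[OF assms(2), symmetric])
    show ?thesis unfolding eq by (rule vertex_tendsto[OF _ rho_sum_tendsto[OF that]]) auto
  qed
  have nw: "of_real (norm (?w T)) = ?w' T" for T
    unfolding tab_wt_def by (simp add: norm_power flip: prod_norm)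
  have "Bseq (\<lambda>N. \<Sum>T\<in>ssyt_le N lam. ?w' T)"
    using lim[of "of_real (norm r)"] assms by (intro convergent_imp_Bseq convergentI) auto
  then obtain B where B: "\<And>N. norm (\<Sum>T\<in>ssyt_le N lam. ?w' T) \<le> B" by (auto simp: Bseq_def)
  have mono: "ssyt_le N lam \<subseteq> ssyt_le M lam" if "N \<le> M" for N M
    using that by (auto simp: ssyt_le_def intro: le_trans)
  have exh: "\<exists>N. F \<subseteq> ssyt_le N lam" if "finite F" "F \<subseteq> ssyt lam" for F
    using that
  proof (induction F)
    case (insert T F)
    then obtain N where N: "F \<subseteq> ssyt_le N lam" by auto
    obtain M where "T \<in> ssyt_le M lam" using ssyt_Union[OF assms(2)] insert by blast
    then have "insert T F \<subseteq> ssyt_le (max N M) lam" using N mono[of N "max N M"] mono[of M "max N M"] by auto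
    then show ?case by blast
  qed simp
  have "(\<lambda>T. norm (?w T)) summable_on ssyt lam"
  proof (rule nonneg_bdd_above_summable_on)
    show "bdd_above (sum (\<lambda>T. norm (?w T)) ` {F. F \<subseteq> ssyt lam \<and> finite F})"
    proof (rule bdd_aboveI2)
      fix F assume "F \<in> {F. F \<subseteq> ssyt lam \<and> finite F}"
      then obtain N where "F \<subseteq> ssyt_le N lam" using exh by blast
      then have "(\<Sum>T\<in>F. norm (?w T)) \<le> (\<Sum>T\<in>ssyt_le N lam. norm (?w T))"
        by (intro sum_mono2 finite_ssyt_le assms) auto
      also have "\<dots> = norm (of_real (\<Sum>T\<in>ssyt_le N lam. norm (?w T)) :: complex)"
        by (simp only: norm_of_real) (simp add: sum_nonneg)
      also have "of_real (\<Sum>T\<in>ssyt_le N lam. norm (?w T)) = (\<Sum>T\<in>ssyt_le N lam. ?w' T)"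
        by (simp only: of_real_sum nw)
      also have "norm \<dots> \<le> B" by (rule B)
      finally show "(\<Sum>T\<in>F. norm (?w T)) \<le> B" .
    qed
  qed auto
  then have "?w summable_on ssyt lam" by (rule abs_summable_summable)
  then have "(?w has_sum infsum ?w (ssyt lam)) (ssyt lam)" by (rule has_sum_infsum)
  moreover have "filterlim (\<lambda>N. ssyt_le N lam) (finite_subsets_at_top (ssyt lam)) sequentially"
    unfolding filterlim_finite_subsets_at_top
  proof (intro allI impI)
    fix X assume "finite X \<and> X \<subseteq> ssyt lam"
    then obtain N where X: "X \<subseteq> ssyt_le N lam" using exh by blast
    then show "\<forall>\<^sub>F N in sequentially. finite (ssyt_le N lam) \<and> X \<subseteq> ssyt_le N lam \<and> ssyt_le N lam \<subseteq> ssyt lam"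
      unfolding eventually_sequentially
    proof (intro exI[of _ N] allI impI conjI)
      fix n assume "N \<le> n"
      then show "X \<subseteq> ssyt_le n lam" using mono[of N n] X by blast
      show "ssyt_le n lam \<subseteq> ssyt lam" by (auto simp: ssyt_le_def)
      show "finite (ssyt_le n lam)" by (rule finite_ssyt_le[OF assms(2)])
    qed
  qed
  ultimately have "(\<lambda>N. \<Sum>T\<in>ssyt_le N lam. ?w T) \<longlonglongrightarrow> infsum ?w (ssyt lam)"
    unfolding has_sum_def by (rule filterlim_compose)
  then have "vertex 1 (\<lambda>k. r ^ k / (1 - r ^ (2 * k))) (vac_state s) (part_state lam s) = infsum ?w (ssyt lam)"
    using lim[OF assms(1)] LIMSEQ_unique by blast
  then show ?thesis unfolding schur_rho_def tab_wt_def[abs_def] .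
qed

section \<open>Reduction of the correlation function\<close>

lemma summable_on_finite_sum:
  fixes f :: "'a \<Rightarrow> 'b \<Rightarrow> complex"
  assumes "finite R" "\<And>u. u \<in> R \<Longrightarrow> f u summable_on A"
  shows "(\<lambda>y. \<Sum>u\<in>R. f u y) summable_on A"
  by (rule has_sum_imp_summable, rule has_sum_finite_sum[OF assms(1)]) (rule has_sum_infsum, rule assms(2))

lemma geometric_has_sum:
  fixes c :: complex
  assumes "norm c < 1" shows "((\<lambda>n. c ^ n) has_sum (1 / (1 - c))) UNIV"
  by (rule norm_summable_imp_has_sum[OF _ geometric_sums[OF assms]])
     (use assms in \<open>simp add: norm_power summable_geometric\<close>)

context rho
begin

definition power_sum' :: "nat \<Rightarrow> complex" where "power_sum' m = - ((- 1) ^ m) * power_sum m"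

lemma r_double: "r ^ (2 * k) = q ^ k"
  by (simp only: power_mult rq)

lemma power_sum_alt: "(\<lambda>k. r ^ k / (1 - r ^ (2 * k))) = power_sum"
  by (simp add: power_sum_def r_double fun_eq_iff)

lemma power_sum'_alt: "(\<lambda>k. - ((- 1) ^ k) * (r ^ k / (1 - r ^ (2 * k)))) = power_sum'"
  by (simp add: power_sum'_def power_sum_def r_double fun_eq_iff)

lemma power_sum_bound: "1 \<le> m \<Longrightarrow> norm (power_sum m) ^ 2 \<le> (1 / (1 - norm q)) ^ 2"
proof (rule power_mono)
  assume m: "1 \<le> m"
  have "norm (q ^ m) \<le> norm q" using m q1 power_decreasing[of 1 m "norm q"] by (simp add: norm_power)
  then have "1 - norm q \<le> norm (1 - q ^ m)" using norm_triangle_ineq2[of 1 "q ^ m"] by simp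
  moreover have "norm (r ^ m) \<le> 1" using norm_r by (simp add: norm_power power_le_one)
  ultimately show "norm (power_sum m) \<le> 1 / (1 - norm q)"
    unfolding power_sum_def norm_divide using q1 by (intro frac_le) auto
qed simp

lemma power_sum'_bound: "1 \<le> m \<Longrightarrow> norm (power_sum' m) ^ 2 \<le> (1 / (1 - norm q)) ^ 2"
  using power_sum_bound[of m] by (simp add: power_sum'_def norm_mult norm_power)

text \<open>The nested sums of \<open>compose\<close> are exchanged into a single one over the state
  \<open>v\<close> at Q^L0; the other intermediate sums are finite by
  \<open>finite_vertex\<close>.\<close>

lemma gprime_has_sum:
  assumes Q: "norm Q < 1"
  shows "((\<lambda>v. r powi quad t * gram power_sum t v * (Q powi en v * (gram power_sum' v s * inverse r powi quad s)))
    has_sum gprime Q r (occ t) (occ s)) UNIV"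
proof -
  let ?R = "\<lambda>s. inverse r powi quad s"
  have G: "rho_prod r (Gam (- 1)) (occ t) (occ u) = vertex 1 power_sum u t"
    "rho_prod r (Gam 1) (occ t) (occ u) = vertex 1 power_sum t u"
    "rho_prod r (Gam' (- 1)) (occ t) (occ u) = vertex 1 power_sum' u t"
    "rho_prod r (Gam' 1) (occ t) (occ u) = vertex 1 power_sum' t u" for t u
    using vertex_adjoint[of "-1" _ t u] by (simp_all only: rho_Gam_occ[OF norm_r] rho_Gam'_occ[OF norm_r] power_sum_alt power_sum'_alt) simp_all
  define D where "D = powdiag (inverse r) W0"
  define Z where "Z = compose (rho_prod r (Gam' (- 1))) (compose (rho_prod r (Gam' 1)) D)"
  define Y2 where "Y2 = compose (rho_prod r (Gam 1)) (compose (powdiag Q L0) Z)"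
  define Y1 where "Y1 = compose (rho_prod r (Gam (- 1))) Y2"
  have D: "D (occ t) (occ s) = (if t = s then ?R t else 0)" for t s unfolding D_def by (rule powdiag_W0_occ)
  have Z: "Z (occ v) (occ s) = gram power_sum' v s * ?R s" for v
  proof -
    have "Z (occ v) (occ s) = (\<Sum>\<^sub>\<infinity>x. vertex 1 power_sum' x v * vertex 1 power_sum' x s * ?R s)"
      unfolding Z_def compose_occ[of "rho_prod r (Gam' (- 1))"] G compose_diag_right[of D, OF D]
      by (simp add: mult.assoc)
    then show ?thesis by (simp add: infsum_cmult_left' gram_def)
  qed
  have Y2: "((\<lambda>v. vertex 1 power_sum u v * (Q powi en v * (gram power_sum' v s * ?R s))) has_sum Y2 (occ u) (occ s)) UNIV" for u
  proof -
    \<comment> \<open>Expanding the right Gram entry over its finite support reduces summability to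
      \<open>vertex_pair_summable\<close>.\<close>
    let ?S = "{x. vertex 1 power_sum' x s \<noteq> 0}"
    have "vertex 1 power_sum u v * (Q powi en v * (gram power_sum' v s * ?R s))
      = (\<Sum>x\<in>?S. (vertex 1 power_sum u v * Q powi en v * vertex 1 power_sum' x v) * (vertex 1 power_sum' x s * ?R s))" for v
      by (subst gram_eq[OF finite_vertex disjI2[OF order_refl]])
         (simp add: sum_distrib_left sum_distrib_right mult_ac)
    moreover have "(\<lambda>v. \<Sum>x\<in>?S. (vertex 1 power_sum u v * Q powi en v * vertex 1 power_sum' x v) * (vertex 1 power_sum' x s * ?R s)) summable_on UNIV"
      by (intro summable_on_finite_sum finite_vertex summable_on_cmult_left vertex_pair_summable[OF power_sum_bound power_sum'_bound Q])
    ultimately have "(\<lambda>v. vertex 1 power_sum u v * (Q powi en v * (gram power_sum' v s * ?R s))) summable_on UNIV" by simp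
    moreover have "Y2 (occ u) (occ s) = (\<Sum>\<^sub>\<infinity>v. vertex 1 power_sum u v * (Q powi en v * (gram power_sum' v s * ?R s)))"
      unfolding Y2_def compose_occ[of "rho_prod r (Gam 1)"] G compose_diag_left[of "powdiag Q L0", OF powdiag_L0_occ] Z ..
    ultimately show ?thesis by simp
  qed
  let ?S = "{u. vertex 1 power_sum u t \<noteq> 0}"
  have "((\<lambda>v. \<Sum>u\<in>?S. vertex 1 power_sum u t * (vertex 1 power_sum u v * (Q powi en v * (gram power_sum' v s * ?R s))))
     has_sum (\<Sum>u\<in>?S. vertex 1 power_sum u t * Y2 (occ u) (occ s))) UNIV"
    by (intro has_sum_finite_sum finite_vertex has_sum_cmult_right Y2)
  moreover have "(\<Sum>u\<in>?S. vertex 1 power_sum u t * Y2 (occ u) (occ s)) = Y1 (occ t) (occ s)"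
    unfolding Y1_def compose_occ[of "rho_prod r (Gam (- 1))"] G
    by (rule infsumI[symmetric], rule has_sum_finite_neutralI) (auto simp: finite_vertex)
  moreover have "(\<Sum>u\<in>?S. vertex 1 power_sum u t * (vertex 1 power_sum u v * (Q powi en v * (gram power_sum' v s * ?R s))))
    = gram power_sum t v * (Q powi en v * (gram power_sum' v s * ?R s))" for v
    by (subst gram_eq[OF finite_vertex disjI1[OF order_refl], of power_sum t v]) (simp only: sum_distrib_right mult.assoc)
  ultimately have "((\<lambda>v. gram power_sum t v * (Q powi en v * (gram power_sum' v s * ?R s))) has_sum Y1 (occ t) (occ s)) UNIV" by simp
  then have "((\<lambda>v. r powi quad t * (gram power_sum t v * (Q powi en v * (gram power_sum' v s * ?R s))))
     has_sum r powi quad t * Y1 (occ t) (occ s)) UNIV"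
    by (rule has_sum_cmult_right)
  moreover have "gprime Q r (occ t) (occ s) = r powi quad t * Y1 (occ t) (occ s)"
    unfolding gprime_def Y1_def Y2_def Z_def D_def by (rule compose_diag_left[OF powdiag_W0_occ])
  ultimately show ?thesis by (simp only: mult.assoc)
qed

end

section \<open>Words in the currents and their eigenvectors\<close>

definition current_word :: "nat list \<Rightarrow> fock \<Rightarrow> fock" where
  "current_word ks v = foldr (\<lambda>k w. current (int k) w) ks v"

lemma current_word_simps [simp]:
  "current_word [] v = v" "current_word (k # ks) v = current (int k) (current_word ks v)"
  "current_word (ks @ ls) v = current_word ks (current_word ls v)"
  by (simp_all add: current_word_def)

lemma rowfin_current_word [simp]: "rowfin (current_word ks)"
proof (induction ks)
  case Nil
  show ?case by (rule rowfin_single[of _ "\<lambda>_. 1" id]) simp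
next
  case (Cons k ks)
  have "current_word (k # ks) = (\<lambda>v. current (int k) (current_word ks v))" by (rule ext) simp
  then show ?case using rowfin_cmp[OF rowfin_hop Cons] by simp
qed

lemma Jop_word:
  assumes "\<forall>k\<in>set ks. 1 \<le> k"
  shows "foldr compose (map (\<lambda>k. Jop (int k)) ks) idop (occ t) (occ s) = current_word ks (ket s) t"
  using assms
proof (induction ks arbitrary: t)
  case Nil
  show ?case by (simp add: idop_def ket_def occ_inject)
next
  case (Cons k ks)
  have J: "Jop (int k) (occ t) (occ u) = current (int k) (ket u) t" for u
    by (rule Jop_occ) (use Cons.prems in auto)
  have IH: "foldr compose (map (\<lambda>k. Jop (int k)) ks) idop (occ u) (occ s) = current_word ks (ket s) u" for u
    using Cons by simp
  have "foldr compose (map (\<lambda>k. Jop (int k)) (k # ks)) idop (occ t) (occ s)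
     = (\<Sum>\<^sub>\<infinity>u. current (int k) (ket u) t * current_word ks (ket s) u)"
    by (simp add: compose_occ J IH)
  also have "\<dots> = current (int k) (current_word ks (ket s)) t"
    by (rule infsumI, rule rowfin_ket_has_sum) simp
  finally show ?case by simp
qed

text \<open>Read on the column index, J_-k becomes J_k and the order of the word is
  reversed.\<close>

lemma Jop_neg_word:
  assumes "\<forall>k\<in>set ks. 1 \<le> k"
  shows "foldr compose (map (\<lambda>k T S. - Jop (- int k) T S) ks) idop (occ t) (occ s)
    = (- 1) ^ length ks * current_word (rev ks) (ket t) s"
  using assms
proof (induction ks arbitrary: t)
  case Nil
  show ?case by (auto simp: idop_def ket_def occ_inject)
next
  case (Cons k ks)
  have J: "Jop (- int k) (occ t) (occ u) = current (int k) (ket t) u" for u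
    using Jop_occ[of "- int k" t u] hop_adjoint[of "\<lambda>_. 1" "- int k" u t] Cons.prems by simp
  have IH: "foldr compose (map (\<lambda>k T S. - Jop (- int k) T S) ks) idop (occ u) (occ s)
     = (- 1) ^ length ks * current_word (rev ks) (ket u) s" for u
    using Cons by simp
  have "foldr compose (map (\<lambda>k T S. - Jop (- int k) T S) (k # ks)) idop (occ t) (occ s)
     = (\<Sum>\<^sub>\<infinity>u. (- 1) ^ length (k # ks) * (current_word (rev ks) (ket u) s * current (int k) (ket t) u))"
    by (simp add: compose_occ J IH mult_ac)
  also have "\<dots> = (- 1) ^ length (k # ks) * current_word (rev ks) (current (int k) (ket t)) s"
    by (rule infsumI, rule has_sum_cmult_right, rule rowfin_ket_has_sum) simp
  finally show ?case by simp
qed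

definition words :: "(nat \<Rightarrow> nat) \<Rightarrow> nat list set" where
  "words \<alpha> = {ks. length ks = mdeg \<alpha> \<and> (\<forall>k. count_list ks k = \<alpha> k)}"

text \<open>Identifies the words with the arrangements of a multiset, which makes them finite and
  counts them.\<close>

lemma words_multiset:
  assumes "finite {k. \<alpha> k \<noteq> 0}"
  obtains M where "words \<alpha> = permutations_of_multiset M" "\<And>k. count M k = \<alpha> k" "set_mset M = {k. \<alpha> k \<noteq> 0}" "size M = mdeg \<alpha>"
proof -
  define M where "M = (\<Sum>k\<in>{k. \<alpha> k \<noteq> 0}. replicate_mset (\<alpha> k) k)"
  have c: "count M k = \<alpha> k" for k
    unfolding M_def count_sum count_replicate_mset using assms by simp
  have s: "set_mset M = {k. \<alpha> k \<noteq> 0}" unfolding set_mset_def using c by (auto simp: Suc_le_eq)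
  have z: "size M = mdeg \<alpha>" unfolding size_multiset_overloaded_eq s c by (simp add: mdeg_def)
  have "ks \<in> words \<alpha> \<longleftrightarrow> mset ks = M" for ks
  proof
    assume "ks \<in> words \<alpha>"
    then show "mset ks = M" by (intro multiset_eqI) (simp add: words_def c count_mset)
  next
    assume "mset ks = M"
    then show "ks \<in> words \<alpha>" using z c by (auto simp: words_def simp flip: size_mset count_mset)
  qed
  then have "words \<alpha> = permutations_of_multiset M" by (auto simp: permutations_of_multiset_def)
  then show thesis using that c s z by blast
qed

lemma words_pos: "monom \<alpha> \<Longrightarrow> ks \<in> words \<alpha> \<Longrightarrow> \<forall>k\<in>set ks. 1 \<le> k"
proof
  fix k assume "monom \<alpha>" "ks \<in> words \<alpha>" "k \<in> set ks"
  then have "\<alpha> k \<noteq> 0" by (metis (mono_tags, lifting) count_list_0_iff mem_Collect_eq words_def)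
  then show "1 \<le> k" using \<open>monom \<alpha>\<close> by (cases k) (auto simp: monom_def)
qed

text \<open>The coefficient of the monomial \<open>\<alpha>\<close> in exp (sum_k c_k t_k).\<close>

definition mono_exp :: "(nat \<Rightarrow> complex) \<Rightarrow> (nat \<Rightarrow> nat) \<Rightarrow> complex" where
  "mono_exp c \<alpha> = (\<Prod>k | \<alpha> k \<noteq> 0. c k ^ \<alpha> k / fact (\<alpha> k))"

definition exp_current :: "(nat \<Rightarrow> nat) \<Rightarrow> fock \<Rightarrow> fock" where
  "exp_current \<alpha> v = (\<lambda>t. \<Sum>ks\<in>words \<alpha>. 1 / fact (mdeg \<alpha>) * current_word ks v t)"

lemma finite_words: "monom \<alpha> \<Longrightarrow> finite (words \<alpha>)"
  using words_multiset[of \<alpha>] by (metis finite_permutations_of_multiset monom_def)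

lemma rowfin_exp_current:
  assumes "monom \<alpha>" shows "rowfin (exp_current \<alpha>)"
proof (rule rowfin_sumI[of current_word _ "\<lambda>_ _. 1 / fact (mdeg \<alpha>)"])
  fix t show "\<exists>I. finite I \<and> (\<forall>i\<in>I. rowfin (current_word i)) \<and>
     (\<forall>v. exp_current \<alpha> v t = (\<Sum>i\<in>I. 1 / fact (mdeg \<alpha>) * current_word i v t))"
    by (rule exI[of _ "words \<alpha>"]) (simp add: finite_words[OF assms] exp_current_def)
qed

lemma exp_coeff_current:
  assumes "monom \<alpha>"
  shows "exp_coeff (\<lambda>k. Jop (int k)) \<alpha> (occ t) (occ s) = exp_current \<alpha> (ket s) t"
proof -
  have S: "(\<Sum>ks\<in>words \<alpha>. foldr compose (map (\<lambda>k. Jop (int k)) ks) idop (occ t) (occ s))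
    = (\<Sum>ks\<in>words \<alpha>. current_word ks (ket s) t)"
    by (intro sum.cong refl Jop_word words_pos[OF assms])
  show ?thesis
    unfolding exp_coeff_def words_def[symmetric] S exp_current_def sum_distrib_left[symmetric] by simp
qed

lemma exp_coeff_current_neg:
  assumes "monom \<alpha>"
  shows "exp_coeff (\<lambda>k T S. - Jop (- int k) T S) \<alpha> (occ t) (occ s) = (- 1) ^ mdeg \<alpha> * exp_current \<alpha> (ket t) s"
proof -
  have "(\<Sum>ks\<in>words \<alpha>. foldr compose (map (\<lambda>k T S. - Jop (- int k) T S) ks) idop (occ t) (occ s))
    = (\<Sum>ks\<in>words \<alpha>. (- 1) ^ mdeg \<alpha> * current_word (rev ks) (ket t) s)"
  proof (intro sum.cong refl)
    fix ks assume ks: "ks \<in> words \<alpha>"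
    then have "length ks = mdeg \<alpha>" by (simp add: words_def)
    then show "foldr compose (map (\<lambda>k T S. - Jop (- int k) T S) ks) idop (occ t) (occ s)
       = (- 1) ^ mdeg \<alpha> * current_word (rev ks) (ket t) s"
      using Jop_neg_word[OF words_pos[OF assms ks], of t s] by simp
  qed
  \<comment> \<open>Words with given multiplicities are closed under reversal, so the reversed order
    disappears.\<close>
  also have "\<dots> = (\<Sum>ks\<in>words \<alpha>. (- 1) ^ mdeg \<alpha> * current_word ks (ket t) s)"
    by (rule sum.reindex_bij_witness[of _ rev rev]) (auto simp: words_def)
  finally have S: "(\<Sum>ks\<in>words \<alpha>. foldr compose (map (\<lambda>k T S. - Jop (- int k) T S) ks) idop (occ t) (occ s))
    = (\<Sum>ks\<in>words \<alpha>. (- 1) ^ mdeg \<alpha> * current_word ks (ket t) s)" .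
  show ?thesis
    unfolding exp_coeff_def words_def[symmetric] S exp_current_def sum_distrib_left[symmetric] by simp
qed

text \<open>Every word contributes the same product of eigenvalues, and the number of words is the
  multinomial coefficient.\<close>

lemma exp_current_eigen:
  assumes "monom \<alpha>" "\<And>k t. 1 \<le> k \<Longrightarrow> current (int k) v t = c k * v t"
  shows "exp_current \<alpha> v t = mono_exp c \<alpha> * v t"
proof -
  have fin: "finite {k. \<alpha> k \<noteq> 0}" using assms(1) by (simp add: monom_def)
  obtain M where M: "words \<alpha> = permutations_of_multiset M" "\<And>k. count M k = \<alpha> k" "set_mset M = {k. \<alpha> k \<noteq> 0}" "size M = mdeg \<alpha>"
    by (rule words_multiset[OF fin]) blast
  have w: "current_word ks v t = prod_list (map c ks) * v t" if "\<forall>k\<in>set ks. 1 \<le> k" for ks t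
    using that
  proof (induction ks arbitrary: t)
    case (Cons k ks)
    then have "current_word ks v = (\<lambda>t. prod_list (map c ks) * v t)" by auto
    then have "current_word (k # ks) v t = prod_list (map c ks) * current (int k) v t"
      by (simp add: rowfin_scale)
    then show ?case using Cons.prems assms(2)[of k t] by simp
  qed simp
  have p: "prod_list (map c ks) = (\<Prod>k | \<alpha> k \<noteq> 0. c k ^ \<alpha> k)" if "ks \<in> words \<alpha>" for ks
  proof -
    have "mset ks = M" using that M(1) by (simp add: permutations_of_multiset_def)
    then have "prod_list (map c ks) = prod_mset (image_mset c M)" by (simp flip: prod_mset_prod_list)
    then show ?thesis by (simp add: image_prod_mset_multiplicity M)
  qed
  let ?F = "\<Prod>k | \<alpha> k \<noteq> 0. fact (\<alpha> k) :: nat"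
  have card: "of_nat (card (words \<alpha>)) / fact (mdeg \<alpha>) = (1 / (\<Prod>k | \<alpha> k \<noteq> 0. fact (\<alpha> k)) :: complex)"
  proof -
    have "card (words \<alpha>) * ?F = fact (mdeg \<alpha>)"
      using card_permutations_of_multiset[of M] by (simp add: M)
    then have "of_nat (card (words \<alpha>) * ?F) = (of_nat (fact (mdeg \<alpha>)) :: complex)" by simp
    then have "of_nat (card (words \<alpha>)) * (\<Prod>k | \<alpha> k \<noteq> 0. fact (\<alpha> k)) = (fact (mdeg \<alpha>) :: complex)"
      by (simp add: of_nat_prod)
    moreover have "(\<Prod>k | \<alpha> k \<noteq> 0. fact (\<alpha> k)) \<noteq> (0 :: complex)" using fin by simp
    ultimately show ?thesis by (simp add: field_simps)
  qed
  have "exp_current \<alpha> v t = (\<Sum>ks\<in>words \<alpha>. 1 / fact (mdeg \<alpha>) * ((\<Prod>k | \<alpha> k \<noteq> 0. c k ^ \<alpha> k) * v t))"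
    unfolding exp_current_def
    by (intro sum.cong refl arg_cong2[where f="(*)"]) (use w[OF words_pos[OF assms(1)]] p in auto)
  also have "\<dots> = of_nat (card (words \<alpha>)) / fact (mdeg \<alpha>) * ((\<Prod>k | \<alpha> k \<noteq> 0. c k ^ \<alpha> k) * v t)" by simp
  also have "\<dots> = mono_exp c \<alpha> * v t" unfolding card mono_exp_def by (simp add: prod_dividef)
  finally show ?thesis .
qed

lemma mom_add: "mom (\<lambda>a. f a + g a) t = mom f t + mom g t"
  by (simp add: mom_def sum.distrib)

lemma mom_minus: "mom (\<lambda>a. - f a) t = - mom f t"
  by (simp add: mom_def sum_negf)

text \<open>From (-1 - a)^2 = a^2 + 2 a + 1; the linear term gives the energy, the constant the
  charge.\<close>

lemma quad_dual: "- quad u = quad (dual u) - 2 * en u + ch u"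
proof -
  have "quad (dual u) = - mom (\<lambda>a. a ^ 2 + (- (- a) + (- (- a) + 1))) u"
    unfolding mom_dual by (rule arg_cong[where f="\<lambda>f. - mom f u"]) (auto simp: power2_eq_square algebra_simps)
  also have "\<dots> = - (quad u + (- en u + (- en u + ch u)))"
    unfolding mom_add mom_minus[of uminus] by simp
  finally show ?thesis by simp
qed

lemma en_vac_state_le: "ch u = s \<Longrightarrow> en u \<le> en (vac_state s) \<Longrightarrow> u = vac_state s"
proof -
  assume "ch u = s" and le: "en u \<le> en (vac_state s)"
  then obtain mu where mu: "mu \<in> partitions" "u = part_state mu s" using part_state_surj by metis
  have "psize (\<lambda>_. 0) = 0" by (simp add: psize_def)
  then have "psize mu = 0" using le unfolding mu(2) part_state_zero[symmetric] en_part_state[OF mu(1)] en_part_state[OF zero_partition] by simp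
  then have "mu i = 0" for i using partition_finite[OF mu(1)] by (auto simp: psize_def)
  then have "mu = (\<lambda>_. 0)" by blast
  then show ?thesis using mu(2) part_state_zero by simp
qed

lemma ch_vac_state: "ch (vac_state s) = s"
  using ch_part_state[OF zero_partition, of s] by (simp add: part_state_zero)

text \<open>The vacuum has the least energy of its charge, so Gamma_+ fixes it and only one
  intermediate state remains.\<close>

lemma gram_vac_state: "gram p (vac_state s) v = vertex 1 p (vac_state s) v"
proof -
  have sub: "{u. vertex 1 p u (vac_state s) \<noteq> 0} \<subseteq> {vac_state s}"
  proof
    fix u assume "u \<in> {u. vertex 1 p u (vac_state s) \<noteq> 0}"
    then have nz: "vertex 1 p u (vac_state s) \<noteq> 0" by simp
    then have ch: "ch u = s" using vertex_zero_ch[of "vac_state s" u 1 p] ch_vac_state[of s] by metis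
    obtain N where "en (vac_state s) = en u + 1 * int N" using nz vertex_zero_en[of "vac_state s" u 1 p] by blast
    then have "u = vac_state s" by (intro en_vac_state_le[OF ch]) simp
    then show "u \<in> {vac_state s}" by simp
  qed
  have "vertex 1 p (vac_state s) (vac_state s) = 1" using vertex_eq[of 1 "vac_state s" "vac_state s" 0 p] by (simp add: ket_def)
  then show ?thesis using gram_eq[OF _ disjI1[OF sub]] by simp
qed

context rho
begin

text \<open>The convergent sum of q^(k a) over the particles a of \<open>v\<close>: reflection turns
  them into holes at -1 - a of the dual, and \<open>inverse (q ^ k)\<close> undoes the offset by
  1.\<close>

definition part_eig :: "nat \<Rightarrow> maya_state \<Rightarrow> complex" where
  "part_eig k v = - inverse (q ^ k) * hole_sum k (dual v)"

lemma gram_power_sum': "gram power_sum' t v = gram power_sum (dual t) (dual v)"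
  using gram_dual[of power_sum t v] unfolding power_sum'_def[abs_def] .

text \<open>Dualizing replaces the inverse conjugation by the direct one times r^(ch - 2 en). A
  current of shift \<open>k\<close> changes this by r^(-2 k) = q^-k, and the sign of
  \<open>current_dual\<close> cancels (-1)^k up to a minus: together the factor in
  \<open>part_eig\<close>.\<close>

lemma current_gram':
  assumes "1 \<le> k"
  shows "current (int k) (\<lambda>u. gram power_sum' v u * inverse r powi quad u) t
    = part_eig k v * (gram power_sum' v t * inverse r powi quad t)"
proof -
  let ?c = "\<lambda>w. r powi quad w * gram power_sum w (dual v)"
  have b: "gram power_sum' v u * inverse r powi quad u = r powi (ch u - 2 * en u) * ?c (dual u)" for u
  proof -
    have "inverse r powi quad u = r powi (- quad u)" by (simp add: power_int_minus power_int_inverse)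
    also have "\<dots> = r powi (ch u - 2 * en u) * r powi quad (dual u)"
      unfolding quad_dual using r_nz by (simp add: algebra_simps flip: power_int_add)
    finally show ?thesis by (simp add: gram_power_sum' gram_sym[of power_sum "dual v"])
  qed
  \<comment> \<open>\<open>hop_local\<close> freezes the exponent: only states of energy
    \<open>en t + k\<close> and the charge of \<open>t\<close> are read.\<close>
  have "current (int k) (\<lambda>u. gram power_sum' v u * inverse r powi quad u) t
    = current (int k) (\<lambda>u. r powi (ch t - 2 * en t - 2 * int k) * ?c (dual u)) t"
    unfolding b by (rule hop_local) (simp add: algebra_simps)
  also have "\<dots> = r powi (ch t - 2 * en t - 2 * int k) * current (int k) (\<lambda>u. ?c (dual u)) t"
    by (rule rowfin_scale) simp
  also have "current (int k) (\<lambda>u. ?c (dual u)) t = - ((- 1) ^ k) * current (int k) ?c (dual t)"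
    using current_dual[of "int k" ?c t] assms by simp
  also have "current (int k) ?c (dual t) = (- 1) ^ k * hole_sum k (dual v) * ?c (dual t)"
    by (rule current_gram[OF assms])
  also have "r powi (ch t - 2 * en t - 2 * int k) * (- ((- 1) ^ k) * ((- 1) ^ k * hole_sum k (dual v) * ?c (dual t)))
     = - (r powi (- 2 * int k) * hole_sum k (dual v)) * (r powi (ch t - 2 * en t) * ?c (dual t))"
  proof -
    have "r powi (ch t - 2 * en t - 2 * int k) = r powi (- 2 * int k) * r powi (ch t - 2 * en t)"
      using r_nz by (simp flip: power_int_add)
    moreover have "(- 1) ^ k * (- 1) ^ k = (1 :: complex)" by (simp flip: power_add mult_2)
    ultimately show ?thesis by (simp add: mult_ac)
  qed
  also have "r powi (- 2 * int k) = inverse (q ^ k)"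
  proof -
    have "r powi (- 2 * int k) = inverse (r powi int (2 * k))" by (simp flip: power_int_minus)
    then show ?thesis by (simp only: power_int_of_nat r_double)
  qed
  finally show ?thesis unfolding b part_eig_def by simp
qed

lemma current_gram_eigen:
  "1 \<le> k \<Longrightarrow> current (int k) (\<lambda>t. r powi quad t * gram power_sum t v) u
    = ((- 1) ^ k * hole_sum k v) * (r powi quad u * gram power_sum u v)"
  by (rule current_gram)

text \<open>For fixed \<open>v\<close> the summand is a function of the row index times one of the
  column index, each an eigenvector of all positive currents. Row-finite operators pass through the
  sum over \<open>v\<close>, first on rows, then on columns. The factor
  \<open>(- 1) ^ mdeg \<beta>\<close> comes from the minus signs of the right exponential.\<close>

lemma tau'_has_sum:
  assumes Q: "norm Q < 1" and \<alpha>: "monom \<alpha>" and \<beta>: "monom \<beta>"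
  shows "((\<lambda>v. mono_exp (\<lambda>k. (- 1) ^ k * hole_sum k v) \<alpha> * mono_exp (\<lambda>k. part_eig k v) \<beta>
      * (gram power_sum (vac_state s) v * Q powi en v * gram power_sum' v (vac_state s)))
    has_sum (- 1) ^ mdeg \<beta> * tau' Q r s \<alpha> \<beta>) UNIV"
proof -
  let ?g = "\<lambda>t u. gprime Q r (occ t) (occ u)"
  let ?a = "\<lambda>v t. r powi quad t * gram power_sum t v" and ?b = "\<lambda>v u. gram power_sum' v u * inverse r powi quad u"
  let ?X = "\<lambda>v. mono_exp (\<lambda>k. (- 1) ^ k * hole_sum k v) \<alpha>" and ?Y = "\<lambda>v. mono_exp (\<lambda>k. part_eig k v) \<beta>"
  define F where "F u = compose (exp_coeff (\<lambda>k. Jop (int k)) \<alpha>) (gprime Q r) (occ (vac_state s)) (occ u)" for u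
  have F: "F u = exp_current \<alpha> (\<lambda>t. ?g t u) (vac_state s)" for u
    unfolding F_def compose_occ exp_coeff_current[OF \<alpha>]
    by (rule infsumI, rule rowfin_ket_has_sum[OF rowfin_exp_current[OF \<alpha>]])
  have X: "exp_current \<alpha> (?a v) t = ?X v * ?a v t" for v t
    by (rule exp_current_eigen[OF \<alpha> current_gram_eigen])
  have Y: "exp_current \<beta> (?b v) t = ?Y v * ?b v t" for v t
    by (rule exp_current_eigen[OF \<beta> current_gram'])
  have g: "((\<lambda>v. ?a v t * (Q powi en v * ?b v u)) has_sum ?g t u) UNIV" for t u
    by (rule gprime_has_sum[OF Q])
  have 1: "((\<lambda>v. ?X v * ?a v (vac_state s) * (Q powi en v * ?b v u)) has_sum F u) UNIV" for u
  proof -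
    have "((\<lambda>v. exp_current \<alpha> (\<lambda>t. ?a v t * (Q powi en v * ?b v u)) (vac_state s)) has_sum F u) UNIV"
      unfolding F by (rule rowfin_has_sum[OF rowfin_exp_current[OF \<alpha>] g])
    moreover have "exp_current \<alpha> (\<lambda>t. ?a v t * (Q powi en v * ?b v u)) (vac_state s)
      = ?X v * ?a v (vac_state s) * (Q powi en v * ?b v u)" for v
    proof -
      have "exp_current \<alpha> (\<lambda>t. ?a v t * (Q powi en v * ?b v u)) (vac_state s)
        = exp_current \<alpha> (\<lambda>t. (Q powi en v * ?b v u) * ?a v t) (vac_state s)"
        by (rule arg_cong[where f="\<lambda>f. exp_current \<alpha> f (vac_state s)"], rule ext, rule mult.commute)
      also have "\<dots> = (Q powi en v * ?b v u) * exp_current \<alpha> (?a v) (vac_state s)"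
        by (rule rowfin_scale[OF rowfin_exp_current[OF \<alpha>]])
      finally show ?thesis unfolding X by (simp only: mult.commute)
    qed
    ultimately show ?thesis by simp
  qed
  have 2: "((\<lambda>v. ?X v * ?a v (vac_state s) * Q powi en v * (?Y v * ?b v (vac_state s))) has_sum exp_current \<beta> F (vac_state s)) UNIV"
  proof -
    have "((\<lambda>v. exp_current \<beta> (\<lambda>u. ?X v * ?a v (vac_state s) * (Q powi en v * ?b v u)) (vac_state s)) has_sum exp_current \<beta> F (vac_state s)) UNIV"
      by (rule rowfin_has_sum[OF rowfin_exp_current[OF \<beta>] 1])
    moreover have "exp_current \<beta> (\<lambda>u. ?X v * ?a v (vac_state s) * (Q powi en v * ?b v u)) (vac_state s)
       = ?X v * ?a v (vac_state s) * Q powi en v * (?Y v * ?b v (vac_state s))" for v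
      using rowfin_scale[OF rowfin_exp_current[OF \<beta>], of "?X v * ?a v (vac_state s) * Q powi en v" "?b v" "vac_state s"]
      by (simp only: Y mult.assoc)
    ultimately show ?thesis by simp
  qed
  have "tau' Q r s \<alpha> \<beta> = (\<Sum>\<^sub>\<infinity>u. F u * ((- 1) ^ mdeg \<beta> * exp_current \<beta> (ket u) (vac_state s)))"
    unfolding tau'_def vac_eq_occ compose_occ[of "compose _ _"] exp_coeff_current_neg[OF \<beta>] F_def ..
  also have "\<dots> = (- 1) ^ mdeg \<beta> * exp_current \<beta> F (vac_state s)"
    using has_sum_cmult_right[OF rowfin_ket_has_sum[OF rowfin_exp_current[OF \<beta>], of "vac_state s" F], of "(- 1) ^ mdeg \<beta>"]
    by (intro infsumI) (simp add: mult_ac)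
  finally have e1: "(- 1) ^ mdeg \<beta> * tau' Q r s \<alpha> \<beta> = exp_current \<beta> F (vac_state s)"
    by (simp flip: mult.assoc power_add mult_2)
  have e2: "?X v * ?a v (vac_state s) * Q powi en v * (?Y v * ?b v (vac_state s))
    = ?X v * ?Y v * (gram power_sum (vac_state s) v * Q powi en v * gram power_sum' v (vac_state s))" for v
  proof -
    have "r powi quad (vac_state s) * inverse r powi quad (vac_state s) = 1" using r_nz by (simp add: power_int_inverse)
    then have "?X v * ?Y v * (gram power_sum (vac_state s) v * Q powi en v * gram power_sum' v (vac_state s)) * (r powi quad (vac_state s) * inverse r powi quad (vac_state s))
       = ?X v * ?Y v * (gram power_sum (vac_state s) v * Q powi en v * gram power_sum' v (vac_state s))" by simp
    then show ?thesis by (simp only: mult_ac)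
  qed
  show ?thesis using 2 unfolding e1 e2 .
qed

lemma gram_vac_state_part_state: "lam \<in> partitions \<Longrightarrow> gram power_sum (vac_state s) (part_state lam s) = schur_rho r lam"
  using vertex_schur[OF norm_r, of lam s] by (simp add: gram_vac_state power_sum_alt)

lemma gram'_vac_state_part_state:
  assumes "lam \<in> partitions" shows "gram power_sum' (part_state lam s) (vac_state s) = schur_rho r (pconj lam)"
  using dual_part_state(1)[OF assms] dual_part_state(2)[OF assms, of s] gram_vac_state_part_state[of "pconj lam" "- s"]
  by (simp add: gram_power_sum' dual_vac_state gram_sym)

text \<open>The holes are all positions below \<open>M\<close> minus the particles there. The
  charge-dependent term of \<open>Phi\<close> cancels one end of the telescoped vacuum sum, leaving
  the constant q^k / (1 - q^k).\<close>

lemma hole_sum_part_state: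
  assumes lam: "lam \<in> partitions" and k: "1 \<le> k"
  shows "hole_sum k (part_state lam s) = Phi q (int k) lam s - q ^ k / (1 - q ^ k)"
proof -
  let ?c = "q ^ k" and ?x = "\<lambda>i. int i - s - int (lam i)"
  obtain n where n: "\<forall>i\<ge>n. lam i = 0" using partition_bound[OF lam] by metis
  have c1: "?c \<noteq> 1" and c0: "?c \<noteq> 0" and cn: "norm ?c < 1"
    using q_pow_neq1[OF k] q_nz q0 q1 k by (auto simp: norm_power power_less_one_iff)
  define M where "M = int n - s"
  have geo: "(wt k has_sum (?c powi (1 - M) / (1 - ?c))) {..<M}"
  proof -
    have "((\<lambda>n. ?c ^ n) has_sum (1 / (1 - ?c))) UNIV"
      by (rule geometric_has_sum[OF cn])
    then have "((\<lambda>n::nat. ?c powi (1 - M) * ?c ^ n) has_sum (?c powi (1 - M) * (1 / (1 - ?c)))) UNIV"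
      by (rule has_sum_cmult_right)
    moreover have "((\<lambda>n::nat. ?c powi (1 - M) * ?c ^ n) has_sum (?c powi (1 - M) * (1 / (1 - ?c)))) UNIV
       \<longleftrightarrow> (wt k has_sum (?c powi (1 - M) * (1 / (1 - ?c)))) {..<M}"
    proof (rule has_sum_reindex_bij_witness[of _ "\<lambda>x. nat (M - 1 - x)" "\<lambda>n. M - 1 - int n"])
      fix n :: nat
      show "wt k (M - 1 - int n) = ?c powi (1 - M) * ?c ^ n"
      proof -
        have "- (M - 1 - int n) = (1 - M) + int n" by simp
        then show ?thesis
          unfolding wt_def using power_int_add[OF disjI1[OF c0], of "1 - M" "int n"] by (simp only: power_int_of_nat)
      qed
    qed auto
    ultimately show ?thesis by simp
  qed
  have inj: "inj_on ?x {..<n}"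
  proof (rule linorder_inj_onI)
    fix i j :: nat assume "i < j"
    then show "?x i \<noteq> ?x j" using partition_antimono[OF lam, of i j] by simp
  qed auto
  have occ: "occ (part_state lam s) = ?x ` {..<n} \<union> {M..}"
    unfolding part_state_list_state[OF n] occ_list_state M_def by (simp add: parts_def atLeast0LessThan)
  have xM: "?x i < M" if "i < n" for i using that by (simp add: M_def)
  have "(wt k has_sum (\<Sum>i<n. wt k (?x i))) (?x ` {..<n})"
    by (rule has_sum_finiteI) (simp_all add: sum.reindex[OF inj])
  from has_sum_Diff[OF geo this] xM
  have "(wt k has_sum (?c powi (1 - M) / (1 - ?c) - (\<Sum>i<n. wt k (?x i)))) ({..<M} - ?x ` {..<n})" by auto
  moreover have "{..<M} - ?x ` {..<n} = - occ (part_state lam s)" unfolding occ by auto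
  ultimately have H: "hole_sum k (part_state lam s) = (\<Sum>i<n. wt k (?x i)) - ?c powi (1 - M) / (1 - ?c)"
    unfolding hole_sum_def by (simp add: infsum_uminus infsumI)
  have tele: "(\<Sum>i<m. ?c powi (s - int i)) = (?c powi (1 - (int m - s)) - ?c powi (s + 1)) / (1 - ?c)" for m
  proof (induction m)
    case (Suc m)
    have "?c powi (1 - (int m - s)) = ?c * ?c powi (s - int m)"
      using c0 by (subst power_int_add_1'[symmetric]) (auto simp: algebra_simps)
    moreover have "?c powi (1 - (int (Suc m) - s)) = ?c powi (s - int m)" by (simp add: algebra_simps)
    ultimately show ?case using Suc c1 by (simp add: field_simps)
  qed (simp add: add.commute)
  have "Phi q (int k) lam s = (\<Sum>j\<in>{j. lam j \<noteq> 0}. ?c powi (- ?x j) - ?c powi (s - int j)) + (1 - ?c powi s) / (1 - ?c) * ?c"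
  proof -
    have e: "q powi (int k * m) = ?c powi m" for m using power_int_mult[of q "int k" m] by simp
    show ?thesis unfolding Phi_def e by (simp add: algebra_simps)
  qed
  also have "(\<Sum>j\<in>{j. lam j \<noteq> 0}. ?c powi (- ?x j) - ?c powi (s - int j)) = (\<Sum>j<n. ?c powi (- ?x j) - ?c powi (s - int j))"
  proof (rule sum.mono_neutral_left)
    show "{j. lam j \<noteq> 0} \<subseteq> {..<n}"
    proof
      fix j assume "j \<in> {j. lam j \<noteq> 0}"
      then show "j \<in> {..<n}" using n by (cases "n \<le> j") auto
    qed
  qed auto
  also have "\<dots> = (\<Sum>i<n. wt k (?x i)) - (?c powi (1 - M) - ?c powi (s + 1)) / (1 - ?c)"
    unfolding sum_subtractf tele wt_def M_def ..
  finally have P: "Phi q (int k) lam s = (\<Sum>i<n. wt k (?x i)) - (?c powi (1 - M) - ?c powi (s + 1)) / (1 - ?c) + (1 - ?c powi s) / (1 - ?c) * ?c" .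
  have "?c powi (s + 1) = ?c powi s * ?c" using c0 by (simp add: power_int_add_1)
  moreover have "A - X / D = A - (X - Y * c) / D + (1 - Y) / D * c - c / D" for A X Y c D :: complex
    by (simp add: diff_divide_distrib left_diff_distrib)
  ultimately show ?thesis unfolding H P by (simp only:)
qed

text \<open>The sum over particles is a finite deviation from the vacuum plus the geometric series
  q^(-k s) / (1 - q^k); removing the charge-dependent term of \<open>Phi\<close> leaves 1 / (1 -
  q^k).\<close>

lemma part_eig_part_state:
  assumes lam: "lam \<in> partitions" and k: "1 \<le> k"
  shows "part_eig k (part_state lam s) = Phi q (- int k) lam s + 1 / (1 - q ^ k)"
proof -
  let ?c = "q ^ k" and ?x = "\<lambda>i. int i - s - int (lam i)"
  obtain n where n: "\<forall>i\<ge>n. lam i = 0" using partition_bound[OF lam] by metis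
  have c1: "?c \<noteq> 1" and c0: "?c \<noteq> 0" and cn: "norm ?c < 1"
    using q_pow_neq1[OF k] q_nz q0 q1 k by (auto simp: norm_power power_less_one_iff)
  have w: "- wt k (- 1 - ?x i) = - ?c * ?c powi ?x i" for i
  proof -
    have "- (- 1 - ?x i) = ?x i + 1" by simp
    then show ?thesis unfolding wt_def using power_int_add_1'[of ?c "?x i"] c0 by (simp only:) simp
  qed
  have bij: "bij_betw (\<lambda>i. - 1 - ?x i) UNIV (- occ (dual (part_state lam s)))"
  proof -
    have inj: "inj ?x"
    proof (rule linorder_inj_onI)
      fix i j :: nat assume "i < j"
      then show "?x i \<noteq> ?x j" using partition_antimono[OF lam, of i j] by simp
    qed auto
    show ?thesis
      unfolding bij_betw_def
    proof (intro conjI)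
      show "inj (\<lambda>i. - 1 - ?x i)" using inj by (auto simp: inj_def)
      show "range (\<lambda>i. - 1 - ?x i) = - occ (dual (part_state lam s))"
      proof (intro equalityI subsetI)
        fix y assume "y \<in> - occ (dual (part_state lam s))"
        then have "- 1 - y \<in> range ?x" unfolding occ_dual occ_part_state[OF lam] by simp
        then obtain i where "- 1 - y = ?x i" by blast
        then have "y = - 1 - ?x i" by linarith
        then show "y \<in> range (\<lambda>i. - 1 - ?x i)" by blast
      next
        fix y assume "y \<in> range (\<lambda>i. - 1 - ?x i)"
        then obtain i where "y = - 1 - ?x i" by blast
        then have "- 1 - y = ?x i" by linarith
        then have "- 1 - y \<in> range ?x" by (rule range_eqI)
        then show "y \<in> - occ (dual (part_state lam s))" unfolding occ_dual occ_part_state[OF lam] by simp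
      qed
    qed
  qed
  have "hole_sum k (dual (part_state lam s)) = (\<Sum>\<^sub>\<infinity>i. - wt k (- 1 - ?x i))"
    unfolding hole_sum_def by (rule infsum_reindex_bij_betw[OF bij, symmetric])
  then have "hole_sum k (dual (part_state lam s)) = (\<Sum>\<^sub>\<infinity>i. - ?c * ?c powi ?x i)" unfolding w .
  then have E: "part_eig k (part_state lam s) = (\<Sum>\<^sub>\<infinity>i. ?c powi ?x i)"
    unfolding part_eig_def using c0 by (simp add: infsum_uminus infsum_cmult_right')
  have geo: "((\<lambda>i. ?c powi (int i - s)) has_sum (?c powi (- s) * (1 / (1 - ?c)))) UNIV"
  proof -
    have "((\<lambda>n. ?c ^ n) has_sum (1 / (1 - ?c))) UNIV"
      by (rule geometric_has_sum[OF cn])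
    from has_sum_cmult_right[OF this, of "?c powi (- s)"] show ?thesis
      using c0 by (simp add: power_int_diff power_int_minus field_simps)
  qed
  have fin: "((\<lambda>i. ?c powi ?x i - ?c powi (int i - s)) has_sum (\<Sum>j\<in>{j. lam j \<noteq> 0}. ?c powi ?x j - ?c powi (int j - s))) UNIV"
    by (rule has_sum_finite_neutralI[OF partition_finite[OF lam]]) auto
  have "part_eig k (part_state lam s) = (\<Sum>j\<in>{j. lam j \<noteq> 0}. ?c powi ?x j - ?c powi (int j - s)) + ?c powi (- s) * (1 / (1 - ?c))"
    unfolding E using has_sum_add[OF fin geo] by (intro infsumI) simp
  moreover have "Phi q (- int k) lam s = (\<Sum>j\<in>{j. lam j \<noteq> 0}. ?c powi ?x j - ?c powi (int j - s)) + (1 - ?c powi (- s)) / (1 - inverse ?c) * inverse ?c"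
  proof -
    have e: "q powi (- int k * m) = ?c powi (- m)" for m
      using power_int_mult[of q "int k" "- m"] by simp
    show ?thesis unfolding Phi_def e using e[of 1] by (simp add: algebra_simps power_int_minus)
  qed
  moreover have "(1 - ?c powi (- s)) / (1 - inverse ?c) * inverse ?c + 1 / (1 - ?c) = ?c powi (- s) * (1 / (1 - ?c))"
    using c0 c1 by (simp add: field_simps)
  ultimately show ?thesis by (simp add: add.assoc)
qed

end

section \<open>Exponentials of linear power series\<close>

lemma mono_exp_superset:
  assumes "finite A" "{k. \<alpha> k \<noteq> 0} \<subseteq> A"
  shows "mono_exp c \<alpha> = (\<Prod>k\<in>A. c k ^ \<alpha> k / fact (\<alpha> k))"
  unfolding mono_exp_def by (rule prod.mono_neutral_left) (use assms in auto)

lemma binomial_fact: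
  fixes c h :: complex
  shows "(\<Sum>j\<le>n. c ^ j / fact j * (h ^ (n - j) / fact (n - j))) = (c + h) ^ n / fact n"
proof -
  have "c ^ j / fact j * (h ^ (n - j) / fact (n - j)) = of_nat (n choose j) * c ^ j * h ^ (n - j) / fact n"
    if "j \<le> n" for j
    using binomial_fact[OF that, where ?'a = complex] by (simp add: field_simps)
  then have "(\<Sum>j\<le>n. c ^ j / fact j * (h ^ (n - j) / fact (n - j)))
    = (\<Sum>j\<le>n. of_nat (n choose j) * c ^ j * h ^ (n - j) / fact n)"
    by (intro sum.cong refl) simp
  then show ?thesis by (simp add: binomial_ring sum_divide_distrib)
qed

lemma below_support: "\<gamma> \<in> below \<alpha> \<Longrightarrow> {k. \<gamma> k \<noteq> 0} \<subseteq> {k. \<alpha> k \<noteq> 0}"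
proof
  fix k assume "\<gamma> \<in> below \<alpha>" "k \<in> {k. \<gamma> k \<noteq> 0}"
  moreover from this have "\<gamma> k \<le> \<alpha> k" by (simp add: below_def)
  ultimately show "k \<in> {k. \<alpha> k \<noteq> 0}" by simp
qed

text \<open>Coefficient form of exp c exp h = exp (c + h): the sum over \<open>below\<close> factors
  over the support into one binomial theorem per variable.\<close>

lemma mono_exp_add:
  assumes fin: "finite {k. \<alpha> k \<noteq> 0}"
  shows "(\<Sum>\<gamma>\<in>below \<alpha>. mono_exp c \<gamma> * mono_exp h (\<lambda>k. \<alpha> k - \<gamma> k)) = mono_exp (\<lambda>k. c k + h k) \<alpha>"
proof -
  let ?A = "{k. \<alpha> k \<noteq> 0}"
  let ?f = "\<lambda>k j. c k ^ j / fact j * (h k ^ (\<alpha> k - j) / fact (\<alpha> k - j))"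
  have "(\<Sum>\<gamma>\<in>below \<alpha>. mono_exp c \<gamma> * mono_exp h (\<lambda>k. \<alpha> k - \<gamma> k)) = (\<Sum>\<gamma>\<in>below \<alpha>. \<Prod>k\<in>?A. ?f k (\<gamma> k))"
  proof (rule sum.cong[OF refl])
    fix \<gamma> assume g: "\<gamma> \<in> below \<alpha>"
    have s2: "{k. \<alpha> k - \<gamma> k \<noteq> 0} \<subseteq> ?A" by auto
    show "mono_exp c \<gamma> * mono_exp h (\<lambda>k. \<alpha> k - \<gamma> k) = (\<Prod>k\<in>?A. ?f k (\<gamma> k))"
      unfolding mono_exp_superset[OF fin below_support[OF g]] mono_exp_superset[OF fin s2] prod.distrib ..
  qed
  also have "\<dots> = (\<Sum>g\<in>PiE ?A (\<lambda>k. {..\<alpha> k}). \<Prod>k\<in>?A. ?f k (g k))"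
  proof (rule sum.reindex_bij_witness[of _ "\<lambda>g k. if k \<in> ?A then g k else 0" "\<lambda>\<gamma>. restrict \<gamma> ?A"])
    fix \<gamma> assume g: "\<gamma> \<in> below \<alpha>"
    have le: "\<gamma> k \<le> \<alpha> k" for k using g by (simp add: below_def)
    have "\<gamma> k = 0" if "\<alpha> k = 0" for k using le[of k] that by simp
    then show "(\<lambda>k. if k \<in> ?A then restrict \<gamma> ?A k else 0) = \<gamma>" by (intro ext) simp
    show "restrict \<gamma> ?A \<in> PiE ?A (\<lambda>k. {..\<alpha> k})" using le by auto
    show "(\<Prod>k\<in>?A. ?f k (restrict \<gamma> ?A k)) = (\<Prod>k\<in>?A. ?f k (\<gamma> k))" by (rule prod.cong) auto
  next
    fix g assume g: "g \<in> PiE ?A (\<lambda>k. {..\<alpha> k})"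
    show "restrict (\<lambda>k. if k \<in> ?A then g k else 0) ?A = g"
      by (rule PiE_ext[OF _ g]) (use g in \<open>auto simp: PiE_iff\<close>)
    show "(\<lambda>k. if k \<in> ?A then g k else 0) \<in> below \<alpha>" using g by (auto simp: below_def PiE_iff)
  qed
  also have "\<dots> = (\<Prod>k\<in>?A. \<Sum>j\<in>{..\<alpha> k}. ?f k j)"
    by (rule prod_sum_PiE[symmetric]) (use fin in auto)
  also have "\<dots> = mono_exp (\<lambda>k. c k + h k) \<alpha>"
    unfolding mono_exp_def binomial_fact ..
  finally show ?thesis .
qed

abbreviation unit_mon :: "nat \<Rightarrow> nat \<Rightarrow> nat" where
  "unit_mon k \<equiv> (\<lambda>i. if i = k then 1 else 0)"

text \<open>Puts the sums over a common finite index set, so that they can be exchanged with those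
  over \<open>below\<close>.\<close>

lemma linfps_sum:
  assumes "finite A" "finite B" "\<And>k. k \<in> A \<Longrightarrow> 1 \<le> k" "\<And>k. k \<in> B \<Longrightarrow> 1 \<le> k"
    and "{k. \<gamma> k \<noteq> 0} \<subseteq> A" "{k. \<delta> k \<noteq> 0} \<subseteq> B"
  shows "linfps a b \<gamma> \<delta> = (\<Sum>k\<in>A. if \<gamma> = unit_mon k \<and> \<delta> = (\<lambda>_. 0) then a k else 0)
    + (\<Sum>k\<in>B. if \<gamma> = (\<lambda>_. 0) \<and> \<delta> = unit_mon k then b k else 0)"
proof -
  have z: "(\<forall>i. \<eta> i = 0) \<longleftrightarrow> \<eta> = (\<lambda>_. 0)" for \<eta> :: "nat \<Rightarrow> nat" by (auto simp: fun_eq_iff)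
  have 1: "{k. 1 \<le> k \<and> \<gamma> = unit_mon k \<and> \<delta> = (\<lambda>_. 0)} = {k \<in> A. \<gamma> = unit_mon k \<and> \<delta> = (\<lambda>_. 0)}"
  proof (intro equalityI subsetI)
    fix k assume "k \<in> {k. 1 \<le> k \<and> \<gamma> = unit_mon k \<and> \<delta> = (\<lambda>_. 0)}"
    then have k: "\<gamma> = unit_mon k" "\<delta> = (\<lambda>_. 0)" by auto
    then have "\<gamma> k \<noteq> 0" by simp
    then show "k \<in> {k \<in> A. \<gamma> = unit_mon k \<and> \<delta> = (\<lambda>_. 0)}" using k assms(5) by blast
  qed (use assms(3) in auto)
  have 2: "{k. 1 \<le> k \<and> \<gamma> = (\<lambda>_. 0) \<and> \<delta> = unit_mon k} = {k \<in> B. \<gamma> = (\<lambda>_. 0) \<and> \<delta> = unit_mon k}"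
  proof (intro equalityI subsetI)
    fix k assume "k \<in> {k. 1 \<le> k \<and> \<gamma> = (\<lambda>_. 0) \<and> \<delta> = unit_mon k}"
    then have k: "\<gamma> = (\<lambda>_. 0)" "\<delta> = unit_mon k" by auto
    then have "\<delta> k \<noteq> 0" by simp
    then show "k \<in> {k \<in> B. \<gamma> = (\<lambda>_. 0) \<and> \<delta> = unit_mon k}" using k assms(6) by blast
  qed (use assms(4) in auto)
  show ?thesis unfolding linfps_def z 1 2 by (simp only: sum.inter_filter[OF assms(1)] sum.inter_filter[OF assms(2)])
qed

lemma fps_mult_linfps:
  assumes "monom \<alpha>" "monom \<beta>"
  shows "fps_mult (linfps a b) G \<alpha> \<beta>
    = (\<Sum>k | \<alpha> k \<noteq> 0. a k * G (\<lambda>i. \<alpha> i - unit_mon k i) \<beta>)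
    + (\<Sum>k | \<beta> k \<noteq> 0. b k * G \<alpha> (\<lambda>i. \<beta> i - unit_mon k i))"
proof -
  let ?A = "{k. \<alpha> k \<noteq> 0}" and ?B = "{k. \<beta> k \<noteq> 0}"
  have fin: "finite ?A" "finite ?B" using assms by (auto simp: monom_def)
  have pos: "k \<in> ?A \<Longrightarrow> 1 \<le> k" "k \<in> ?B \<Longrightarrow> 1 \<le> k" for k
    using assms by (auto simp: monom_def Suc_le_eq intro: gr0I)
  note fb = finite_below[OF fin(1)] finite_below[OF fin(2)]
  let ?H = "\<lambda>\<gamma> \<delta>. G (\<lambda>k. \<alpha> k - \<gamma> k) (\<lambda>k. \<beta> k - \<delta> k)"
  have z: "(\<lambda>_. 0) \<in> below \<eta>" for \<eta> by (simp add: below_def)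
  have u: "unit_mon k \<in> below \<eta>" if "\<eta> k \<noteq> 0" for k and \<eta> :: "nat \<Rightarrow> nat"
    using that by (auto simp: below_def Suc_le_eq)
  have delta: "(\<Sum>\<gamma>\<in>below \<alpha>. \<Sum>\<delta>\<in>below \<beta>. (if \<gamma> = x \<and> \<delta> = y then w else 0) * ?H \<gamma> \<delta>) = w * ?H x y"
    if "x \<in> below \<alpha>" "y \<in> below \<beta>" for x y w
  proof -
    have "(\<Sum>\<gamma>\<in>below \<alpha>. \<Sum>\<delta>\<in>below \<beta>. (if \<gamma> = x \<and> \<delta> = y then w else 0) * ?H \<gamma> \<delta>)
      = (\<Sum>\<gamma>\<in>below \<alpha>. if \<gamma> = x then w * ?H x y else 0)"
    proof (rule sum.cong[OF refl])
      fix \<gamma>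
      have "(\<Sum>\<delta>\<in>below \<beta>. (if \<gamma> = x \<and> \<delta> = y then w else 0) * ?H \<gamma> \<delta>)
        = (\<Sum>\<delta>\<in>below \<beta>. if \<delta> = y then (if \<gamma> = x then w * ?H x y else 0) else 0)"
        by (rule sum.cong) auto
      also have "\<dots> = (if \<gamma> = x then w * ?H x y else 0)" using that fb by (simp add: sum.delta)
      finally show "(\<Sum>\<delta>\<in>below \<beta>. (if \<gamma> = x \<and> \<delta> = y then w else 0) * ?H \<gamma> \<delta>)
        = (if \<gamma> = x then w * ?H x y else 0)" .
    qed
    also have "\<dots> = w * ?H x y" using that fb by (simp add: sum.delta)
    finally show ?thesis .
  qed
  have "fps_mult (linfps a b) G \<alpha> \<beta> = (\<Sum>\<gamma>\<in>below \<alpha>. \<Sum>\<delta>\<in>below \<beta>.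
      (\<Sum>k\<in>?A. (if \<gamma> = unit_mon k \<and> \<delta> = (\<lambda>_. 0) then a k else 0) * ?H \<gamma> \<delta>)
    + (\<Sum>k\<in>?B. (if \<gamma> = (\<lambda>_. 0) \<and> \<delta> = unit_mon k then b k else 0) * ?H \<gamma> \<delta>))"
    unfolding fps_mult_def
    by (intro sum.cong refl) (simp only: linfps_sum[OF fin pos below_support below_support] distrib_right sum_distrib_right)
  also have "\<dots> = (\<Sum>\<gamma>\<in>below \<alpha>. \<Sum>\<delta>\<in>below \<beta>. \<Sum>k\<in>?A. (if \<gamma> = unit_mon k \<and> \<delta> = (\<lambda>_. 0) then a k else 0) * ?H \<gamma> \<delta>)
    + (\<Sum>\<gamma>\<in>below \<alpha>. \<Sum>\<delta>\<in>below \<beta>. \<Sum>k\<in>?B. (if \<gamma> = (\<lambda>_. 0) \<and> \<delta> = unit_mon k then b k else 0) * ?H \<gamma> \<delta>)"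
    by (simp only: sum.distrib)
  also have "(\<Sum>\<gamma>\<in>below \<alpha>. \<Sum>\<delta>\<in>below \<beta>. \<Sum>k\<in>?A. (if \<gamma> = unit_mon k \<and> \<delta> = (\<lambda>_. 0) then a k else 0) * ?H \<gamma> \<delta>)
    = (\<Sum>k\<in>?A. \<Sum>\<gamma>\<in>below \<alpha>. \<Sum>\<delta>\<in>below \<beta>. (if \<gamma> = unit_mon k \<and> \<delta> = (\<lambda>_. 0) then a k else 0) * ?H \<gamma> \<delta>)"
    by (subst sum.swap[of _ ?A]) (intro sum.cong refl sum.swap)
  also have "\<dots> = (\<Sum>k\<in>?A. a k * ?H (unit_mon k) (\<lambda>_. 0))"
    by (intro sum.cong refl delta z u) auto
  also have "(\<Sum>\<gamma>\<in>below \<alpha>. \<Sum>\<delta>\<in>below \<beta>. \<Sum>k\<in>?B. (if \<gamma> = (\<lambda>_. 0) \<and> \<delta> = unit_mon k then b k else 0) * ?H \<gamma> \<delta>)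
    = (\<Sum>k\<in>?B. \<Sum>\<gamma>\<in>below \<alpha>. \<Sum>\<delta>\<in>below \<beta>. (if \<gamma> = (\<lambda>_. 0) \<and> \<delta> = unit_mon k then b k else 0) * ?H \<gamma> \<delta>)"
    by (subst sum.swap[of _ ?B]) (intro sum.cong refl sum.swap)
  also have "\<dots> = (\<Sum>k\<in>?B. b k * ?H (\<lambda>_. 0) (unit_mon k))"
    by (intro sum.cong refl delta z u) auto
  finally show ?thesis by simp
qed

lemma monom_minus: "monom \<alpha> \<Longrightarrow> monom (\<lambda>i. \<alpha> i - \<gamma> i)"
  by (auto simp: monom_def elim: finite_subset[rotated])

lemma monom_below: "monom \<alpha> \<Longrightarrow> \<gamma> \<in> below \<alpha> \<Longrightarrow> monom \<gamma>"
proof -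
  assume a: "monom \<alpha>" and g: "\<gamma> \<in> below \<alpha>"
  have "finite {k. \<gamma> k \<noteq> 0}" using below_support[OF g] a finite_subset by (auto simp: monom_def)
  moreover have "\<gamma> 0 \<le> \<alpha> 0" using g by (simp add: below_def)
  ultimately show ?thesis using a by (simp add: monom_def)
qed

text \<open>The second claim compares t_k d/dt_k of the exponential with its product by a_k
  t_k.\<close>

lemma minus_unit:
  assumes "monom \<alpha>" "\<alpha> k \<noteq> 0"
  shows "Suc (mdeg (\<lambda>i. \<alpha> i - unit_mon k i)) = mdeg \<alpha>"
    and "a k * mono_exp a (\<lambda>i. \<alpha> i - unit_mon k i) = of_nat (\<alpha> k) * mono_exp a \<alpha>"
proof -
  let ?A = "{k. \<alpha> k \<noteq> 0}" and ?\<gamma> = "\<lambda>i. \<alpha> i - unit_mon k i"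
  have fin: "finite ?A" and k: "k \<in> ?A" using assms by (auto simp: monom_def)
  have sub: "{i. ?\<gamma> i \<noteq> 0} \<subseteq> ?A" by auto
  have d: "mdeg ?\<gamma> = (\<Sum>i\<in>?A. ?\<gamma> i)" unfolding mdeg_def by (rule sum.mono_neutral_left[OF fin sub]) auto
  have "mdeg \<alpha> = \<alpha> k + (\<Sum>i\<in>?A - {k}. \<alpha> i)" unfolding mdeg_def by (rule sum.remove[OF fin k])
  moreover have "mdeg ?\<gamma> = (\<alpha> k - 1) + (\<Sum>i\<in>?A - {k}. \<alpha> i)" unfolding d sum.remove[OF fin k] by simp
  ultimately show "Suc (mdeg ?\<gamma>) = mdeg \<alpha>" using assms(2) by simp
  obtain n where n: "\<alpha> k = Suc n" using assms(2) by (cases "\<alpha> k") auto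
  let ?P = "\<Prod>i\<in>?A - {k}. a i ^ \<alpha> i / fact (\<alpha> i)"
  have "mono_exp a ?\<gamma> = a k ^ n / fact n * ?P"
    unfolding mono_exp_superset[OF fin sub] prod.remove[OF fin k] by (simp add: n)
  moreover have "mono_exp a \<alpha> = a k ^ Suc n / fact (Suc n) * ?P"
    unfolding mono_exp_def prod.remove[OF fin k] by (simp only: n)
  moreover have "a k * (a k ^ n / fact n) = of_nat (Suc n) * (a k ^ Suc n / fact (Suc n))"
    by (simp del: of_nat_Suc)
  ultimately show "a k * mono_exp a ?\<gamma> = of_nat (\<alpha> k) * mono_exp a \<alpha>"
    unfolding n by (simp only: mult.assoc[symmetric])
qed

text \<open>A power of a linear form lives in one total degree. Splitting off a factor removes one
  unit from one exponent, with multiplicity \<open>\<alpha> k\<close> or \<open>\<beta> k\<close>;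
  these add up to the degree, which turns n! into (n + 1)!.\<close>

lemma fps_pow_linfps:
  assumes "monom \<alpha>" "monom \<beta>"
  shows "fps_pow (linfps a b) n \<alpha> \<beta>
    = (if n = mdeg \<alpha> + mdeg \<beta> then fact n * mono_exp a \<alpha> * mono_exp b \<beta> else 0)"
  using assms
proof (induction n arbitrary: \<alpha> \<beta>)
  case 0
  have d: "mdeg \<eta> = 0 \<longleftrightarrow> \<eta> = (\<lambda>_. 0)" if "monom \<eta>" for \<eta>
    using that by (auto simp: mdeg_def monom_def fun_eq_iff)
  have e: "mono_exp c (\<lambda>_. 0) = 1" for c by (simp add: mono_exp_def)
  have z: "(\<forall>i. \<eta> i = 0) \<longleftrightarrow> \<eta> = (\<lambda>_. 0)" for \<eta> :: "nat \<Rightarrow> nat" by (auto simp: fun_eq_iff)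
  show ?case using d[OF 0(1)] d[OF 0(2)] by (auto simp: fps_one_def z e)
next
  case (Suc n)
  let ?E = "mono_exp a \<alpha> * mono_exp b \<beta>" and ?N = "mdeg \<alpha> + mdeg \<beta>"
  have 1: "a k * fps_pow (linfps a b) n (\<lambda>i. \<alpha> i - unit_mon k i) \<beta>
     = of_nat (\<alpha> k) * (if Suc n = ?N then fact n * ?E else 0)" if "\<alpha> k \<noteq> 0" for k
  proof (cases "Suc n = ?N")
    case True
    then have n: "n = mdeg (\<lambda>i. \<alpha> i - unit_mon k i) + mdeg \<beta>" using minus_unit(1)[OF Suc.prems(1) that] by linarith
    have "a k * fps_pow (linfps a b) n (\<lambda>i. \<alpha> i - unit_mon k i) \<beta>
      = fact n * (a k * mono_exp a (\<lambda>i. \<alpha> i - unit_mon k i)) * mono_exp b \<beta>"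
      unfolding Suc.IH[OF monom_minus[OF Suc.prems(1)] Suc.prems(2)] if_P[OF n] by (simp only: mult_ac)
    then show ?thesis unfolding minus_unit(2)[OF Suc.prems(1) that] if_P[OF True] by (simp only: mult_ac)
  next
    case False
    then have "n \<noteq> mdeg (\<lambda>i. \<alpha> i - unit_mon k i) + mdeg \<beta>" using minus_unit(1)[OF Suc.prems(1) that] by linarith
    then show ?thesis using False
      unfolding Suc.IH[OF monom_minus[OF Suc.prems(1)] Suc.prems(2)] by (simp only: if_False mult_zero_right)
  qed
  have 2: "b k * fps_pow (linfps a b) n \<alpha> (\<lambda>i. \<beta> i - unit_mon k i)
     = of_nat (\<beta> k) * (if Suc n = ?N then fact n * ?E else 0)" if "\<beta> k \<noteq> 0" for k
  proof (cases "Suc n = ?N")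
    case True
    then have n: "n = mdeg \<alpha> + mdeg (\<lambda>i. \<beta> i - unit_mon k i)" using minus_unit(1)[OF Suc.prems(2) that] by linarith
    have "b k * fps_pow (linfps a b) n \<alpha> (\<lambda>i. \<beta> i - unit_mon k i)
      = fact n * mono_exp a \<alpha> * (b k * mono_exp b (\<lambda>i. \<beta> i - unit_mon k i))"
      unfolding Suc.IH[OF Suc.prems(1) monom_minus[OF Suc.prems(2)]] if_P[OF n] by (simp only: mult_ac)
    then show ?thesis unfolding minus_unit(2)[OF Suc.prems(2) that] if_P[OF True] by (simp only: mult_ac)
  next
    case False
    then have "n \<noteq> mdeg \<alpha> + mdeg (\<lambda>i. \<beta> i - unit_mon k i)" using minus_unit(1)[OF Suc.prems(2) that] by linarith
    then show ?thesis using False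
      unfolding Suc.IH[OF Suc.prems(1) monom_minus[OF Suc.prems(2)]] by (simp only: if_False mult_zero_right)
  qed
  have "fps_pow (linfps a b) (Suc n) \<alpha> \<beta>
    = (\<Sum>k | \<alpha> k \<noteq> 0. of_nat (\<alpha> k) * (if Suc n = ?N then fact n * ?E else 0))
    + (\<Sum>k | \<beta> k \<noteq> 0. of_nat (\<beta> k) * (if Suc n = ?N then fact n * ?E else 0))"
    unfolding fps_pow.simps fps_mult_linfps[OF Suc.prems] using 1 2 by (intro arg_cong2[where f="(+)"] sum.cong) auto
  also have "\<dots> = of_nat ?N * (if Suc n = ?N then fact n * ?E else 0)"
    by (simp only: sum_distrib_right[symmetric] distrib_right[symmetric] mdeg_def of_nat_sum of_nat_add)
  also have "\<dots> = (if Suc n = ?N then fact (Suc n) * mono_exp a \<alpha> * mono_exp b \<beta> else 0)"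
  proof (cases "Suc n = ?N")
    case True
    have "of_nat (Suc n) * (fact n * ?E) = fact (Suc n) * mono_exp a \<alpha> * mono_exp b \<beta>"
      by (simp only: fact_Suc of_nat_mult of_nat_fact mult.assoc)
    then show ?thesis unfolding if_P[OF True] unfolding True[symmetric] .
  qed simp
  finally show ?case .
qed

lemma fps_exp_linfps:
  assumes "monom \<alpha>" "monom \<beta>"
  shows "fps_exp (linfps a b) \<alpha> \<beta> = mono_exp a \<alpha> * mono_exp b \<beta>"
proof -
  let ?N = "mdeg \<alpha> + mdeg \<beta>"
  have "fps_exp (linfps a b) \<alpha> \<beta> = (\<Sum>n\<le>?N. if n = ?N then mono_exp a \<alpha> * mono_exp b \<beta> else 0)"
    unfolding fps_exp_def fps_pow_linfps[OF assms] by (intro sum.cong refl) auto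
  then show ?thesis by simp
qed

lemma mono_exp_scale:
  assumes "monom \<alpha>"
  shows "(\<Prod>k\<in>{k. \<alpha> k \<noteq> 0}. c k ^ \<alpha> k) * mono_exp h \<alpha> = mono_exp (\<lambda>k. c k * h k) \<alpha>"
  unfolding mono_exp_def prod.distrib[symmetric] by (simp add: power_mult_distrib)

lemma mono_exp_cong:
  assumes "monom \<alpha>" "\<And>k. 1 \<le> k \<Longrightarrow> c k = h k"
  shows "mono_exp c \<alpha> = mono_exp h \<alpha>"
  unfolding mono_exp_def
proof (rule prod.cong[OF refl])
  fix k assume "k \<in> {k. \<alpha> k \<noteq> 0}"
  then have "1 \<le> k" using assms(1) by (cases k) (auto simp: monom_def)
  then show "c k ^ \<alpha> k / fact (\<alpha> k) = h k ^ \<alpha> k / fact (\<alpha> k)" using assms(2) by simp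
qed

context rho
begin

definition crystal_wt :: "complex \<Rightarrow> int \<Rightarrow> (nat \<Rightarrow> nat) \<Rightarrow> complex" where
  "crystal_wt Q s lam = schur_rho r lam * schur_rho r (pconj lam) * Q powi (int (psize lam) + s * (s + 1) div 2)"

text \<open>The scaling by (-1)^k for t_k meets the sign in the eigenvalue, and the one by -1 for
  tbar_k meets the sign of the right exponential; both cancel.\<close>

lemma scaled_tau'_has_sum:
  assumes Q: "norm Q < 1" and \<alpha>: "monom \<alpha>" and \<beta>: "monom \<beta>"
  shows "((\<lambda>lam. crystal_wt Q s lam
      * (mono_exp (\<lambda>k. Phi q (int k) lam s - q ^ k / (1 - q ^ k)) \<alpha>
        * mono_exp (\<lambda>k. Phi q (- int k) lam s + 1 / (1 - q ^ k)) \<beta>))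
    has_sum fps_scale (\<lambda>k. (- 1) ^ k) (\<lambda>k. - 1) (tau' Q r s) \<alpha> \<beta>) partitions"
proof -
  let ?F = "\<lambda>v. mono_exp (\<lambda>k. (- 1) ^ k * hole_sum k v) \<alpha> * mono_exp (\<lambda>k. part_eig k v) \<beta>
      * (gram power_sum (vac_state s) v * Q powi en v * gram power_sum' v (vac_state s))"
  let ?p = "\<Prod>k\<in>{k. \<alpha> k \<noteq> 0}. ((- 1) ^ k) ^ \<alpha> k :: complex"
  have sign: "(\<Prod>k\<in>{k. \<beta> k \<noteq> 0}. (- 1) ^ \<beta> k) = (- 1 :: complex) ^ mdeg \<beta>"
    by (simp add: mdeg_def power_sum)
  have "(?F has_sum (- 1) ^ mdeg \<beta> * tau' Q r s \<alpha> \<beta>) UNIV" by (rule tau'_has_sum[OF assms])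
  \<comment> \<open>States of other charge drop out because Gamma_+ preserves the charge.\<close>
  then have "(?F has_sum (- 1) ^ mdeg \<beta> * tau' Q r s \<alpha> \<beta>) {v. ch v = s}"
  proof (rule has_sum_cong_neutral[THEN iffD1, rotated -1])
    fix v assume "v \<in> UNIV - {v. ch v = s}"
    then have "gram power_sum (vac_state s) v = 0" unfolding gram_vac_state by (intro vertex_zero_ch) (simp add: ch_vac_state)
    then show "?F v = 0" by simp
  qed auto
  then have "((\<lambda>lam. ?F (part_state lam s)) has_sum (- 1) ^ mdeg \<beta> * tau' Q r s \<alpha> \<beta>) partitions"
    by (rule has_sum_reindex_bij_betw[OF bij_part_state, THEN iffD2])
  then have H: "((\<lambda>lam. ?p * ?F (part_state lam s)) has_sum ?p * ((- 1) ^ mdeg \<beta> * tau' Q r s \<alpha> \<beta>)) partitions"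
    by (rule has_sum_cmult_right)
  have e1: "?p * ((- 1) ^ mdeg \<beta> * tau' Q r s \<alpha> \<beta>) = fps_scale (\<lambda>k. (- 1) ^ k) (\<lambda>k. - 1) (tau' Q r s) \<alpha> \<beta>"
    unfolding fps_scale_def sign by (simp only: mult.assoc)
  have e2: "?p * ?F (part_state lam s) = crystal_wt Q s lam
      * (mono_exp (\<lambda>k. Phi q (int k) lam s - q ^ k / (1 - q ^ k)) \<alpha>
        * mono_exp (\<lambda>k. Phi q (- int k) lam s + 1 / (1 - q ^ k)) \<beta>)" if lam: "lam \<in> partitions" for lam
  proof -
    have "?p * mono_exp (\<lambda>k. (- 1) ^ k * hole_sum k (part_state lam s)) \<alpha>
      = mono_exp (\<lambda>k. (- 1) ^ k * ((- 1) ^ k * hole_sum k (part_state lam s))) \<alpha>"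
      by (rule mono_exp_scale[OF \<alpha>])
    also have "\<dots> = mono_exp (\<lambda>k. Phi q (int k) lam s - q ^ k / (1 - q ^ k)) \<alpha>"
      by (rule mono_exp_cong[OF \<alpha>]) (simp add: hole_sum_part_state[OF lam] flip: mult.assoc power_add mult_2)
    finally have 1: "?p * mono_exp (\<lambda>k. (- 1) ^ k * hole_sum k (part_state lam s)) \<alpha>
      = mono_exp (\<lambda>k. Phi q (int k) lam s - q ^ k / (1 - q ^ k)) \<alpha>" .
    have 2: "mono_exp (\<lambda>k. part_eig k (part_state lam s)) \<beta> = mono_exp (\<lambda>k. Phi q (- int k) lam s + 1 / (1 - q ^ k)) \<beta>"
      by (rule mono_exp_cong[OF \<beta>]) (rule part_eig_part_state[OF lam])
    show ?thesis
      unfolding 1[symmetric] 2[symmetric] crystal_wt_def gram_vac_state_part_state[OF lam] gram'_vac_state_part_state[OF lam] en_part_state[OF lam]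
      by (simp only: mult_ac)
  qed
  show ?thesis by (rule has_sum_cong[THEN iffD1, OF e2 H[unfolded e1]])
qed

text \<open>The prefactor adds to each exponent the constant by which the eigenvalue differs from
  \<open>Phi\<close>. Multiplication is a finite sum over \<open>below\<close>, so it can be done
  inside the sum over partitions.\<close>

lemma Zprime_tau:
  assumes Q: "norm Q < 1" and \<alpha>: "monom \<alpha>" and \<beta>: "monom \<beta>"
  shows "Zprime q Q r s \<alpha> \<beta> =
    fps_mult
      (fps_exp (linfps (\<lambda>k. q ^ k / (1 - q ^ k)) (\<lambda>k. - 1 / (1 - q ^ k))))
      (fps_scale (\<lambda>k. (- 1) ^ k) (\<lambda>k. - 1) (tau' Q r s)) \<alpha> \<beta>"
proof -
  let ?a = "\<lambda>k. q ^ k / (1 - q ^ k)" and ?b = "\<lambda>k. - 1 / (1 - q ^ k)"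
  let ?c = "\<lambda>lam k. Phi q (int k) lam s - q ^ k / (1 - q ^ k)" and ?d = "\<lambda>lam k. Phi q (- int k) lam s + 1 / (1 - q ^ k)"
  let ?T = "fps_scale (\<lambda>k. (- 1) ^ k) (\<lambda>k. - 1) (tau' Q r s)"
  have fa: "finite {k. \<alpha> k \<noteq> 0}" and fb: "finite {k. \<beta> k \<noteq> 0}" using \<alpha> \<beta> by (auto simp: monom_def)
  have "((\<lambda>lam. \<Sum>\<gamma>\<in>below \<alpha>. \<Sum>\<delta>\<in>below \<beta>. (mono_exp ?a \<gamma> * mono_exp ?b \<delta>)
        * (crystal_wt Q s lam * (mono_exp (?c lam) (\<lambda>k. \<alpha> k - \<gamma> k) * mono_exp (?d lam) (\<lambda>k. \<beta> k - \<delta> k))))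
    has_sum (\<Sum>\<gamma>\<in>below \<alpha>. \<Sum>\<delta>\<in>below \<beta>. (mono_exp ?a \<gamma> * mono_exp ?b \<delta>)
        * ?T (\<lambda>k. \<alpha> k - \<gamma> k) (\<lambda>k. \<beta> k - \<delta> k))) partitions"
    by (intro has_sum_finite_sum finite_below fa fb has_sum_cmult_right scaled_tau'_has_sum Q monom_minus \<alpha> \<beta>)
  moreover have "(\<Sum>\<gamma>\<in>below \<alpha>. \<Sum>\<delta>\<in>below \<beta>. (mono_exp ?a \<gamma> * mono_exp ?b \<delta>)
        * ?T (\<lambda>k. \<alpha> k - \<gamma> k) (\<lambda>k. \<beta> k - \<delta> k)) = fps_mult (fps_exp (linfps ?a ?b)) ?T \<alpha> \<beta>"
    unfolding fps_mult_def
    by (intro sum.cong refl arg_cong2[where f="(*)"] fps_exp_linfps[symmetric] monom_below[OF \<alpha>] monom_below[OF \<beta>])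
  moreover have "(\<Sum>\<gamma>\<in>below \<alpha>. \<Sum>\<delta>\<in>below \<beta>. (mono_exp ?a \<gamma> * mono_exp ?b \<delta>)
        * (crystal_wt Q s lam * (mono_exp (?c lam) (\<lambda>k. \<alpha> k - \<gamma> k) * mono_exp (?d lam) (\<lambda>k. \<beta> k - \<delta> k))))
    = crystal_wt Q s lam * fps_exp (linfps (\<lambda>k. Phi q (int k) lam s) (\<lambda>k. Phi q (- int k) lam s)) \<alpha> \<beta>" for lam
  proof -
    have "(\<Sum>\<gamma>\<in>below \<alpha>. \<Sum>\<delta>\<in>below \<beta>. (mono_exp ?a \<gamma> * mono_exp ?b \<delta>)
        * (crystal_wt Q s lam * (mono_exp (?c lam) (\<lambda>k. \<alpha> k - \<gamma> k) * mono_exp (?d lam) (\<lambda>k. \<beta> k - \<delta> k))))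
      = crystal_wt Q s lam * ((\<Sum>\<gamma>\<in>below \<alpha>. mono_exp ?a \<gamma> * mono_exp (?c lam) (\<lambda>k. \<alpha> k - \<gamma> k))
        * (\<Sum>\<delta>\<in>below \<beta>. mono_exp ?b \<delta> * mono_exp (?d lam) (\<lambda>k. \<beta> k - \<delta> k)))"
      unfolding sum_product unfolding sum_distrib_left by (intro sum.cong refl) (simp only: mult_ac)
    also have "\<dots> = crystal_wt Q s lam * (mono_exp (\<lambda>k. ?a k + ?c lam k) \<alpha> * mono_exp (\<lambda>k. ?b k + ?d lam k) \<beta>)"
      unfolding mono_exp_add[OF fa] mono_exp_add[OF fb] ..
    also have "\<dots> = crystal_wt Q s lam * fps_exp (linfps (\<lambda>k. Phi q (int k) lam s) (\<lambda>k. Phi q (- int k) lam s)) \<alpha> \<beta>"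
      unfolding fps_exp_linfps[OF \<alpha> \<beta>] by simp
    finally show ?thesis .
  qed
  ultimately have "((\<lambda>lam. crystal_wt Q s lam * fps_exp (linfps (\<lambda>k. Phi q (int k) lam s) (\<lambda>k. Phi q (- int k) lam s)) \<alpha> \<beta>)
    has_sum fps_mult (fps_exp (linfps ?a ?b)) ?T \<alpha> \<beta>) partitions"
    by (simp only:)
  then show ?thesis unfolding Zprime_def crystal_wt_def by (rule infsumI)
qed

end

theorem theorem2:
  fixes q Q r :: complex and s :: int and \<alpha> \<beta> :: "nat \<Rightarrow> nat"
  assumes "0 < norm q" and "norm q < 1" and "norm Q < 1" and "r ^ 2 = q"
    and "monom \<alpha>" and "monom \<beta>"
  shows "Zprime q Q r s \<alpha> \<beta> =
    fps_mult
      (fps_exp (linfps (\<lambda>k. q ^ k / (1 - q ^ k)) (\<lambda>k. - 1 / (1 - q ^ k))))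
      (fps_scale (\<lambda>k. (- 1) ^ k) (\<lambda>k. - 1) (tau' Q r s)) \<alpha> \<beta>"
proof -
  interpret rho q r by unfold_locales (fact assms)+
  show ?thesis by (rule Zprime_tau[OF assms(3,5,6)])
qed

end
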